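(* Let $q=2^n$ with $n\geq5$ odd. Then $\mathrm{Aut}(\mathcal X_3)=G$.
   Context: Here $q\equiv 2\pmod 3$. Let $m=(q+1)/3$ and let $\mathcal X_3$ be the nonsingular projective model (defined over $\mathbb F_{q^2}$) of the plane curve $y^{q+1}+x^{2m}+x^m=0$; $\mathrm{Aut}(\mathcal X_3)$ is its full automorphism group over $\overline{\mathbb F}_{q^2}$. $G$ is the group of automorphisms of $\mathcal X_3$ generated by the maps $\theta_{\gamma,\delta}:(x,y)\mapsto(\gamma x,\delta y)$ with $\gamma^m=\delta^{q+1}=1$, together with $\theta_2:(x,y)\mapsto(1/x,\,y/x)$ and $\theta_3:(x,y)\mapsto(y^3/x^2,\,y/x)$; it has order $2(q+1)^2$. *)

theory Defs
  imports "HOL-Algebra.Algebraic_Closure_Type" "HOL-Library.Z2"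
    "HOL-Computational_Algebra.Fraction_Field" "HOL-Algebra.Generated_Groups"
begin

text \<open>Ground field: K = algebraic closure of GF(2) (contains every GF(q^2), q = 2^n).\<close>
type_synonym K = "bit alg_closure"
type_synonym RF = "K poly fract"
type_synonym P = "RF poly"

definition Xf :: RF where "Xf = Fract [:0, 1:] 1"

definition cK :: "K \<Rightarrow> RF" where "cK c = Fract [:c:] 1"

definition m_of :: "nat \<Rightarrow> nat" where "m_of q = (q + 1) div 3"

definition F3 :: "nat \<Rightarrow> P" where
  "F3 q = monom 1 (q + 1) + [: Xf ^ (2 * m_of q) + Xf ^ (m_of q) :]"

text \<open>The function field K(X_3) = K(x)[y]/(F3), modelled by reduced representatives
  (polynomials in y of degree < q+1) with multiplication modulo F3.\<close>
definition FF :: "nat \<Rightarrow> P ring" where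
  "FF q = \<lparr> carrier = {p. degree p < q + 1},
            monoid.mult = (\<lambda>a b. (a * b) mod F3 q),
            one = 1,
            ring.zero = 0,
            add = (\<lambda>a b. a + b) \<rparr>"

definition xL :: P where "xL = [: Xf :]"
definition yL :: P where "yL = [: 0, 1 :]"
definition constL :: "K \<Rightarrow> P" where "constL c = [: cK c :]"

text \<open>Aut(X_3) = group of K-automorphisms of the function field K(X_3)
  (functions made extensional outside the carrier).\<close>
definition AutX3 :: "nat \<Rightarrow> (P \<Rightarrow> P) set" where
  "AutX3 q = {\<sigma>. \<sigma> \<in> ring_iso (FF q) (FF q) \<and> (\<forall>c. \<sigma> (constL c) = constL c)
               \<and> \<sigma> \<in> extensional (carrier (FF q))}"

definition AutGrp :: "nat \<Rightarrow> (P \<Rightarrow> P) monoid" where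
  "AutGrp q = \<lparr> carrier = AutX3 q,
                monoid.mult = (\<lambda>\<sigma> \<tau>. compose (carrier (FF q)) \<sigma> \<tau>),
                one = restrict id (carrier (FF q)) \<rparr>"

definition autmap :: "nat \<Rightarrow> P \<Rightarrow> P \<Rightarrow> (P \<Rightarrow> P)" where
  "autmap q u v = (THE \<sigma>. \<sigma> \<in> AutX3 q \<and> \<sigma> xL = u \<and> \<sigma> yL = v)"

definition theta_gd :: "nat \<Rightarrow> K \<Rightarrow> K \<Rightarrow> (P \<Rightarrow> P)" where
  "theta_gd q \<gamma> \<delta> = autmap q [: cK \<gamma> * Xf :] [: 0, cK \<delta> :]"

definition theta2 :: "nat \<Rightarrow> (P \<Rightarrow> P)" where
  "theta2 q = autmap q [: inverse Xf :] [: 0, inverse Xf :]"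

definition theta3 :: "nat \<Rightarrow> (P \<Rightarrow> P)" where
  "theta3 q = autmap q (monom (inverse (Xf ^ 2)) 3) [: 0, inverse Xf :]"

definition gensG :: "nat \<Rightarrow> (P \<Rightarrow> P) set" where
  "gensG q = {theta_gd q \<gamma> \<delta> | \<gamma> \<delta>. \<gamma> ^ m_of q = 1 \<and> \<delta> ^ (q + 1) = 1}
             \<union> {theta2 q, theta3 q}"

definition GroupG :: "nat \<Rightarrow> (P \<Rightarrow> P) set" where
  "GroupG q = generate (AutGrp q) (gensG q)"

end

theory Submission
  imports Defs "HOL-Computational_Algebra.Formal_Laurent_Series"
begin

text \<open>
  Let \<open>t = x^m\<close>, so that \<open>t^2 + t = y^(q+1)\<close> and \<open>x^(q+1) = t^3\<close>, and write \<open>F\<close> for the function field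
  and \<open>F^q\<close> for the field of its \<open>q\<close>-th powers. An automorphism permutes the holomorphic differentials
  and commutes with the Cartier operator \<open>C\<close>, hence preserves the \<open>F^q\<close>-space
  \<open>N = {g. C^n (g \<omega>) = 0 for all holomorphic \<omega>}\<close>. The holomorphic differentials are spanned by
  monomials in \<open>x\<close> and \<open>y\<close>; up to \<open>q\<close>-th powers they are the forms \<open>t^a (1+t)^b dt\<close> with
  \<open>a + b \<le> q - 2\<close> and \<open>a \<equiv> b (mod 3)\<close>, that is, the polynomials \<open>f\<close> in \<open>t\<close> of degree at most
  \<open>q - 2\<close> with \<open>f(\<omega>) = f(\<omega>^2)\<close> at the primitive cube roots of unity (a nodal cubic). Therefore \<open>N\<close> is
  the two-dimensional space spanned by \<open>1\<close> and \<open>g0 = (t^q + t^2) / (t^2 + t + 1)\<close>, and every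
  automorphism sends \<open>g0\<close> to \<open>\<alpha>^q g0 + \<beta>^q\<close>. Comparing the orders modulo \<open>q\<close> of \<open>g0\<close> and \<open>d g0\<close>
  shows that the \<open>q + 1\<close> points over \<open>t = 0, 1, \<infinity>\<close> are permuted. Their sum is a divisor whose
  Riemann--Roch space has the basis \<open>1, p = x/y, s = 1/y, w = y^2/x\<close> with \<open>p s w = 1\<close> and
  \<open>p^m + s^m + w^m = 0\<close>. As \<open>p s w = 1\<close> is the only relation of degree at most 3, the automorphism
  permutes \<open>p, s, w\<close> up to scalars, and this is how \<open>G\<close> acts.
\<close>

section \<open>Laurent series over the algebraic closure of GF(2)\<close>

text \<open>The powers \<open>1, t, ..., t^(q-1)\<close> form a basis of \<open>F\<close> over
  \<open>F^q\<close>, and \<open>C^n\<close> reads off the q-th root of the coefficient of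
  \<open>t^(q-1)\<close>. Polynomials of degree at most \<open>q - 2\<close> with no further
  condition would have annihilator \<open>F^q\<close>; the nodal condition has codimension one and
  so adds one generator. It can be written down because multiplication by
  \<open>(t + e)^(q-1)\<close> turns \<open>C^n\<close> into the q-th root of the value at
  \<open>e\<close>: hence \<open>g0 = 1 + (t + \<omega>)^(q-1) + (t + \<omega>^2)^(q-1)\<close>. The
  congruence \<open>a \<equiv> b (mod 3)\<close> is the nodal condition because
  \<open>1 + \<omega> = \<omega>^2\<close>. As \<open>g0\<close> is determined only up to
  \<open>\<alpha>^q\<close> and \<open>\<beta>^q\<close>, only orders modulo \<open>q\<close> carry
  information, and \<open>q\<close> has to be large against the orders 2 and -2 that occur
  elsewhere. Places, poles and holomorphy are expressed through embeddings of \<open>F\<close> into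
  Laurent series. An embedding preceded by an automorphism is again an embedding, so spaces defined
  in this way are visibly invariant, and no theory of divisors is involved.\<close>

type_synonym L = "K fls"

abbreviation val :: "'a::zero fls \<Rightarrow> int" where
  "val \<equiv> fls_subdegree"

lemma CHAR_K: "CHAR(K) = 2"
proof -
  have "CHAR(bit) = 2"
  proof (rule CHAR_eqI)
    fix n :: nat assume "of_nat n = (0::bit)"
    moreover have "of_nat n = (if even n then 0 else 1 :: bit)" by (induction n) auto
    ultimately show "2 dvd n" by (auto split: if_splits)
  qed auto
  thus ?thesis by simp
qed

lemma char2_add_self:
  fixes a :: "'a :: comm_ring_1"
  assumes "CHAR('a) = 2"
  shows "a + a = 0"
proof -
  have "of_nat 2 = (0::'a)" using assms of_nat_CHAR[where 'a='a] by simp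
  thus ?thesis by (metis mult_2 mult_zero_left of_nat_numeral)
qed

lemma char2_power_add:
  fixes a b :: "'a :: comm_ring_1"
  assumes "CHAR('a) = 2"
  shows "(a + b) ^ (2 ^ n) = a ^ (2 ^ n) + b ^ (2 ^ n)"
  by (rule freshmans_dream') (simp_all add: assms)

lemma char2_square_inj:
  fixes a b :: "'a :: idom"
  assumes "CHAR('a) = 2" "a ^ 2 = b ^ 2"
  shows "a = b"
proof -
  have "(a + b) ^ 2 = 0"
    using char2_power_add[OF assms(1), of a b 1] char2_add_self[OF assms(1), of "b^2"] assms(2) by simp
  hence "a + b = 0" by simp
  thus ?thesis using char2_add_self[OF assms(1), of b] by (metis add_right_cancel)
qed

section \<open>Substituting Laurent series into polynomials; algebraic series and roots\<close>

abbreviation cst :: "'a::zero \<Rightarrow> 'a fls" where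
  "cst \<equiv> fls_const"

abbreviation ordp :: "'a::idom \<Rightarrow> 'a poly \<Rightarrow> nat" where
  "ordp \<equiv> Polynomial.order"

definition pe :: "'a::field poly \<Rightarrow> 'a fls \<Rightarrow> 'a fls" where
  "pe p u = poly (map_poly cst p) u"

lemma pe_pCons [simp]: "pe (pCons a p) u = cst a + u * pe p u"
  by (simp add: pe_def map_poly_pCons)

lemma pe_0 [simp]: "pe 0 u = 0"
  by (simp add: pe_def)

lemma pe_add: "pe (p + r) u = pe p u + pe r u"
  by (induction p r rule: poly_induct2) (simp_all add: algebra_simps flip: fls_plus_const)

lemma pe_smult: "pe (smult c p) u = cst c * pe p u"
  by (induction p) (simp_all add: algebra_simps flip: fls_const_mult_const)

lemma pe_mult: "pe (p * r) u = pe p u * pe r u"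
  by (induction p) (simp_all add: algebra_simps pe_add pe_smult)

lemma pe_1 [simp]: "pe 1 u = 1"
  by (simp add: one_pCons)

lemma pe_power: "pe (p ^ n) u = pe p u ^ n"
  by (induction n) (simp_all add: pe_mult)

lemma pe_monom: "pe (monom c n) u = cst c * u ^ n"
  by (induction n) (simp_all add: monom_0 monom_Suc algebra_simps)

text \<open>Over an algebraically closed coefficient field \<open>p\<close> splits into linear
  factors, and since Laurent series form a domain, one factor \<open>u - cst c\<close> must
  vanish.\<close>

lemma fls_algebraic_imp_const:
  fixes u :: "'a :: alg_closed_field fls"
  assumes "p \<noteq> 0" "pe p u = 0"
  shows "\<exists>c. u = cst c"
  using assms
proof (induction "degree p" arbitrary: p rule: less_induct)
  case less
  show ?case
  proof (cases "degree p = 0")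
    case True
    thus ?thesis using less.prems by (auto elim!: degree_eq_zeroE)
  next
    case False
    then obtain c where "poly p c = 0" using alg_closed_imp_poly_has_root[of p] by auto
    then obtain r where r: "p = [:-c, 1:] * r" by (auto simp: poly_eq_0_iff_dvd dvd_def)
    with less.prems(1) have "r \<noteq> 0" by auto
    hence deg: "degree r < degree p" unfolding r by (subst degree_mult_eq) auto
    have "(u - cst c) * pe r u = 0"
      using less.prems(2) unfolding r by (simp only: pe_mult) (simp add: algebra_simps)
    thus ?thesis using less.hyps[OF deg \<open>r \<noteq> 0\<close>] by auto
  qed
qed

text \<open>The quotient is a root of \<open>X^k - 1\<close>, hence algebraic, hence constant. This
  determines \<open>y\<close> up to a constant once \<open>x\<close> is known.\<close>

lemma fls_root_of_unity_const:
  fixes u v :: "'a :: alg_closed_field fls"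
  assumes "u ^ k = v ^ k" "k > 0"
  shows "\<exists>e. e ^ k = 1 \<and> u = cst e * v"
proof (cases "v = 0")
  case True
  thus ?thesis using assms by (intro exI[of _ 1]) (auto simp: power_0_left)
next
  case False
  have "pe (monom 1 k - 1) (u / v) = (u / v) ^ k - 1"
    using pe_add[of "monom 1 k - 1" 1 "u / v"] by (simp add: pe_monom)
  also have "\<dots> = 0" using assms False by (simp add: power_divide)
  finally have "pe (monom 1 k - 1) (u / v) = 0" .
  moreover have "monom 1 k - 1 \<noteq> (0 :: 'a poly)"
    using assms(2) by (metis degree_1 degree_monom_eq eq_iff_diff_eq_0 less_numeral_extra(3) one_neq_zero)
  ultimately obtain e where e: "u / v = cst e" using fls_algebraic_imp_const by blast
  hence u: "u = cst e * v" using False by (simp add: field_simps)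
  with assms False have "cst e ^ k = 1" by (simp add: power_mult_distrib)
  hence "e ^ k = 1" by (simp flip: fls_const_power)
  with u show ?thesis by blast
qed

text \<open>A k-th root of \<open>1 + X\<close> is \<open>1 + fps_inv P\<close>, where the
  compositional inverse of \<open>P\<close> exists because its linear coefficient \<open>k\<close>
  is nonzero in the field. Substituting \<open>u - 1\<close> for \<open>X\<close> gives a root of
  \<open>u\<close>.\<close>

lemma fps_root_exists:
  fixes u :: "'a :: field fps"
  assumes "of_nat k \<noteq> (0::'a)" "fps_nth u 0 = 1"
  shows "\<exists>b. b ^ k = u"
proof -
  define P where "P = (1 + fps_X) ^ k - (1 :: 'a fps)"
  have P: "fps_nth P 0 = 0" "fps_nth P 1 \<noteq> 0"
    using assms(1) fps_deriv_nth[of "(1 + fps_X :: 'a fps) ^ k" 0]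
    by (auto simp: P_def fps_deriv_power fps_power_zeroth)
  let ?I = "fps_inv P"
  have I0: "fps_nth ?I 0 = 0" by (simp add: fps_inv_def)
  have "P oo ?I = fps_X" by (rule fps_inv_right[OF P])
  hence 1: "(1 + ?I) ^ k = 1 + fps_X"
    using I0 fps_compose_power[of "fps_inv P" "1 + fps_X" k]
    by (simp add: P_def fps_compose_sub_distrib fps_compose_add_distrib algebra_simps)
  have u0: "fps_nth (u - 1) 0 = 0" using assms(2) by simp
  have "((1 + ?I) oo (u - 1)) ^ k = ((1 + ?I) ^ k) oo (u - 1)"
    using u0 by (simp add: fps_compose_power)
  also have "\<dots> = u" unfolding 1 using u0 by (simp add: fps_compose_add_distrib)
  finally show ?thesis by blast
qed

text \<open>Splitting off the power of \<open>fls_X\<close>, whose exponent is a multiple of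
  \<open>k\<close>, and the leading coefficient leaves a power series with constant term 1.\<close>

lemma fls_root_exists:
  fixes a :: "'a :: alg_closed_field fls"
  assumes k: "of_nat k \<noteq> (0::'a)" and a: "int k dvd val a"
  shows "\<exists>b. b ^ k = a"
proof (cases "a = 0")
  case True
  thus ?thesis using k by (intro exI[of _ 0]) (auto simp: power_0_left intro!: gr0I)
next
  case False
  from a obtain d where d: "val a = int k * d" by (auto simp: dvd_def)
  define c where "c = fls_nth a (val a)"
  have c: "c \<noteq> 0" using False by (simp add: c_def)
  define u where "u = fps_const (inverse c) * fls_base_factor_to_fps a"
  have "fps_nth u 0 = 1" using c by (simp add: u_def c_def)
  then obtain b where b: "b ^ k = u" using fps_root_exists[OF k] by blast
  have "k > 0" using k by (auto intro!: gr0I)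
  then obtain e where e: "e ^ k = c" using nth_root_exists by blast
  have "a = fls_X powi (val a) * fps_to_fls (fls_base_factor_to_fps a)"
    using fls_conv_base_factor_to_fps_shift_subdegree[of a] by (simp add: fls_X_intpow_times_conv_shift)
  also have "fls_base_factor_to_fps a = fps_const c * u"
    using c by (simp add: u_def mult.assoc[symmetric])
  finally have "a = fls_X powi (int k * d) * (cst c * fps_to_fls u)"
    by (simp add: d fls_times_fps_to_fls)
  also have "\<dots> = (fls_X powi d * (cst e * fps_to_fls b)) ^ k"
    by (simp add: power_mult_distrib e[symmetric] b[symmetric] fls_const_power fps_to_fls_power
         power_int_mult mult.commute[of "int k"] del: fls_X_power_int)
  finally show ?thesis by metis
qed

lemma fls_subdegree_compose:
  fixes G :: "'a::field fps"
  assumes "G \<noteq> 0" "fps_nth G 0 = 0"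
  shows "val (fls_compose_fps F G) = val F * int (subdegree G)"
proof (cases "F = 0")
  case False
  define H where "H = fls_base_factor_to_fps F"
  have H: "fps_nth H 0 \<noteq> 0" unfolding H_def using False by (rule fls_base_factor_to_fps_base)
  hence "fps_nth (H oo G) 0 \<noteq> 0" by (simp add: fps_compose_nth)
  hence HG: "H oo G \<noteq> 0" by (metis fps_zero_nth)
  have "subdegree H = 0" using H by simp
  moreover have "fls_compose_fps F G = fps_to_fls (H oo G) * fps_to_fls G powi val F"
    by (simp only: fls_compose_fps_def H_def)
  ultimately show ?thesis using assms HG by (simp add: fls_subdegree_fls_to_fps)
qed simp

text \<open>\<open>vge k f\<close> says that \<open>f\<close> has order at least \<open>k\<close>; it is used instead of an inequality
  between subdegrees because \<open>fls_subdegree 0 = 0\<close>.\<close>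

definition vge :: "int \<Rightarrow> 'a::zero fls \<Rightarrow> bool" where
  "vge k f \<longleftrightarrow> (\<forall>j<k. fls_nth f j = 0)"

lemma vge_0 [simp]: "vge k 0"
  by (simp add: vge_def)

lemma vge_iff: "vge k f \<longleftrightarrow> f = 0 \<or> k \<le> val f"
proof
  assume "vge k f"
  thus "f = 0 \<or> k \<le> val f"
    by (cases "f = 0") (auto simp: vge_def intro: fls_subdegree_geI)
qed (auto simp: vge_def)

lemma vge_nz: "f \<noteq> 0 \<Longrightarrow> vge k f \<longleftrightarrow> k \<le> val f"
  by (simp add: vge_iff)

lemma vge_add: "vge k f \<Longrightarrow> vge k g \<Longrightarrow> vge k (f + g :: 'a::monoid_add fls)"
  by (simp add: vge_def)

lemma vge_mono: "vge k f \<Longrightarrow> j \<le> k \<Longrightarrow> vge j f"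
  by (auto simp: vge_def)

lemma vge_mult: "vge j f \<Longrightarrow> vge k g \<Longrightarrow> vge (j + k) (f * g :: 'a::idom fls)"
  by (cases "f = 0 \<or> g = 0") (auto simp: vge_iff)

lemma vge_mult0: "vge 0 f \<Longrightarrow> vge 0 g \<Longrightarrow> vge 0 (f * g :: 'a::idom fls)"
  using vge_mult[of 0 f 0 g] by simp

lemma vge_const [simp]: "vge 0 (cst c)"
  by (simp add: vge_iff)

lemma vge_deriv: "vge 0 (f :: 'a::ring_1 fls) \<Longrightarrow> vge 0 (fls_deriv f)"
proof (unfold vge_def, intro allI impI)
  fix j :: int assume f: "\<forall>j<0. fls_nth f j = 0" and j: "j < 0"
  show "fls_nth (fls_deriv f) j = 0"
    by (cases "j = -1") (use f j in auto)
qed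

lemma subdegree_sum_ge1:
  assumes "val f = k" "vge (k + 1) g" "f \<noteq> 0"
  shows "val (f + g :: 'a::monoid_add fls) = k" "f + g \<noteq> 0"
proof -
  have nz: "fls_nth (f + g) k \<noteq> 0" using assms by (auto simp: vge_def)
  thus "f + g \<noteq> 0" by (metis fls_zero_nth)
  show "val (f + g) = k"
    by (rule fls_subdegree_eqI) (use nz assms in \<open>auto simp: vge_def\<close>)
qed

lemma sum_distinct_subdegree_nz:
  fixes f :: "'b \<Rightarrow> 'a::comm_monoid_add fls"
  assumes "finite A" "A \<noteq> {}" "\<And>i. i \<in> A \<Longrightarrow> f i \<noteq> 0" "inj_on (\<lambda>i. val (f i)) A"
  shows "sum f A \<noteq> 0"
proof -
  obtain i where i: "i \<in> A" "\<And>j. j \<in> A \<Longrightarrow> val (f i) \<le> val (f j)"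
    using finite_has_minimal[of "(\<lambda>i. val (f i)) ` A"] assms(1,2)
    by (metis (no_types, lifting) arg_min_if_finite(1) arg_min_least)
  let ?k = "val (f i)"
  have "fls_nth (sum f A) ?k = (\<Sum>j\<in>A. fls_nth (f j) ?k)" by (simp add: fls_nth_sum)
  also have "\<dots> = (\<Sum>j\<in>{i}. fls_nth (f j) ?k)"
  proof (rule sum.mono_neutral_right)
    show "\<forall>j\<in>A - {i}. fls_nth (f j) ?k = 0"
    proof
      fix j assume j: "j \<in> A - {i}"
      hence "?k \<noteq> val (f j)" using assms(4) i(1) by (auto dest: inj_onD)
      with i(2)[of j] j show "fls_nth (f j) ?k = 0" by auto
    qed
  qed (use assms i in auto)
  also have "\<dots> \<noteq> 0" using assms(3) i(1) by simp
  finally show ?thesis by (metis fls_zero_nth)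
qed

text \<open>First-order Taylor expansion. Integrality of the remainder \<open>s\<close> is put
  inside the existential so that one induction yields both facts.\<close>

lemma pe_at:
  "\<exists>s. (vge 0 \<eta> \<longrightarrow> vge 0 s) \<and> pe p (cst c + \<eta>) = cst (poly p c) + \<eta> * s"
proof (induction p)
  case 0
  show ?case by (intro exI[of _ 0]) simp
next
  case (pCons a p)
  then obtain s where s: "vge 0 \<eta> \<longrightarrow> vge 0 s" "pe p (cst c + \<eta>) = cst (poly p c) + \<eta> * s"
    by blast
  show ?case
    by (rule exI[of _ "cst (poly p c) + (cst c + \<eta>) * s"])
       (use s in \<open>auto simp: algebra_simps intro!: vge_add vge_mult0 simp flip: fls_plus_const fls_const_mult_const\<close>)
qed

lemma pe_at_unit:
  assumes "val \<eta> > 0" "poly p c \<noteq> 0"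
  shows "val (pe p (cst c + \<eta>)) = 0" "pe p (cst c + \<eta>) \<noteq> 0"
proof -
  obtain s where s: "vge 0 \<eta> \<longrightarrow> vge 0 s" "pe p (cst c + \<eta>) = cst (poly p c) + \<eta> * s"
    using pe_at by blast
  have "vge 1 \<eta>" "vge 0 \<eta>" using assms by (auto simp: vge_iff)
  hence "vge 1 (\<eta> * s)" using s(1) vge_mult[of 1 \<eta> 0 s] by simp
  thus "val (pe p (cst c + \<eta>)) = 0" "pe p (cst c + \<eta>) \<noteq> 0"
    using subdegree_sum_ge1[of "cst (poly p c)" 0 "\<eta> * s"] assms(2) by (auto simp: s(2))
qed

lemma subdegree_pe_at:
  fixes \<eta> :: "'a::field fls"
  assumes "val \<eta> > 0" "p \<noteq> 0"
  shows "val (pe p (cst c + \<eta>)) = int (ordp c p) * val \<eta>"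
    and "pe p (cst c + \<eta>) \<noteq> 0"
proof -
  obtain r where r: "p = [:-c, 1:] ^ ordp c p * r" "\<not> [:-c, 1:] dvd r"
    using order_decomp[OF assms(2)] by blast
  have rc: "poly r c \<noteq> 0" using r(2) by (simp add: poly_eq_0_iff_dvd)
  have "pe [:-c, 1:] (cst c + \<eta>) = \<eta>" by simp
  hence eq: "pe p (cst c + \<eta>) = \<eta> ^ ordp c p * pe r (cst c + \<eta>)"
    by (subst r(1)) (simp add: pe_mult pe_power)
  have "\<eta> \<noteq> 0" using assms by auto
  thus "val (pe p (cst c + \<eta>)) = int (ordp c p) * val \<eta>"
    "pe p (cst c + \<eta>) \<noteq> 0"
    using pe_at_unit[OF assms(1) rc] by (simp_all add: eq fls_subdegree_pow)
qed

lemma subdegree_pe_simple_root: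
  fixes \<eta> :: "'a::field fls"
  assumes "val \<eta> > 0" "poly p c = 0" "poly (pderiv p) c \<noteq> 0"
  shows "val (pe p (cst c + \<eta>)) = val \<eta>"
    and "pe p (cst c + \<eta>) \<noteq> 0"
proof -
  obtain r where r: "p = [:-c, 1:] * r" using assms(2) by (auto simp: poly_eq_0_iff_dvd dvd_def)
  have "poly r c \<noteq> 0" using assms(3) by (simp only: r pderiv_mult) (simp add: pderiv_pCons)
  note u = pe_at_unit[OF assms(1) this]
  have "pe [:-c, 1:] (cst c + \<eta>) = \<eta>" by simp
  hence eq: "pe p (cst c + \<eta>) = \<eta> * pe r (cst c + \<eta>)"
    by (simp only: r pe_mult)
  have "\<eta> \<noteq> 0" using assms by auto
  thus "val (pe p (cst c + \<eta>)) = val \<eta>" "pe p (cst c + \<eta>) \<noteq> 0"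
    using u by (simp_all add: eq)
qed

lemma subdegree_pe_neg:
  fixes u :: "'a::field fls"
  assumes "val u < 0" "p \<noteq> 0"
  shows "val (pe p u) = int (degree p) * val u \<and> pe p u \<noteq> 0"
  using assms(2)
proof (induction p)
  case (pCons a p)
  have u: "u \<noteq> 0" using assms(1) by auto
  show ?case
  proof (cases "p = 0")
    case True
    thus ?thesis using pCons by simp
  next
    case False
    have IH: "val (pe p u) = int (degree p) * val u" "pe p u \<noteq> 0"
      using pCons False by auto
    hence sd: "val (u * pe p u) = int (degree (pCons a p)) * val u" "u * pe p u \<noteq> 0"
      using False u by (auto simp: algebra_simps)
    moreover have "vge (int (degree (pCons a p)) * val u + 1) (cst a)"
    proof -
      have "int (degree (pCons a p)) * val u \<le> -1"
        using assms(1) False mult_mono[of 1 "int (degree (pCons a p))" 1 "- val u"] by simp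
      thus ?thesis using vge_mono[OF vge_const, of "int (degree (pCons a p)) * val u + 1" a] by simp
    qed
    ultimately show ?thesis
      using subdegree_sum_ge1[of "u * pe p u" "int (degree (pCons a p)) * val u" "cst a"]
      by (simp add: add.commute)
  qed
qed simp

text \<open>By \<open>fls_algebraic_imp_const\<close> this is transcendence over the constants, the
  condition under which substituting \<open>u\<close> for \<open>x\<close> extends to rational
  functions.\<close>

definition nonconst :: "'a::zero fls \<Rightarrow> bool" where
  "nonconst u \<longleftrightarrow> (\<forall>c. u \<noteq> cst c)"

lemma pe_nonconst_nz:
  fixes u :: "'a::alg_closed_field fls"
  shows "nonconst u \<Longrightarrow> p \<noteq> 0 \<Longrightarrow> pe p u \<noteq> 0"
  using fls_algebraic_imp_const[of p u] by (auto simp: nonconst_def)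

lemma nonconst_subdegree: "val u \<noteq> 0 \<Longrightarrow> nonconst u"
  by (auto simp: nonconst_def)

text \<open>Any fraction representing \<open>r\<close> may be chosen: for nonconstant
  \<open>u\<close> they all give the same value, by \<open>evR_Fract\<close>.\<close>

definition evR :: "L \<Rightarrow> RF \<Rightarrow> L" where
  "evR u r = (SOME v. \<exists>a b. b \<noteq> 0 \<and> r = Fract a b \<and> v = pe a u / pe b u)"

lemma evR_Fract:
  assumes "nonconst u" "b \<noteq> 0"
  shows "evR u (Fract a b) = pe a u / pe b u"
proof -
  have "\<exists>v a' b'. b' \<noteq> 0 \<and> Fract a b = Fract a' b' \<and> v = pe a' u / pe b' u"
    using assms by blast
  from someI_ex[OF this] obtain a' b' where
    *: "b' \<noteq> 0" "Fract a b = Fract a' b'" "evR u (Fract a b) = pe a' u / pe b' u"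
    unfolding evR_def by blast
  hence "a * b' = a' * b" using assms by (simp add: eq_fract)
  hence "pe a u * pe b' u = pe a' u * pe b u" by (metis pe_mult)
  thus ?thesis using * assms by (simp add: pe_nonconst_nz frac_eq_eq)
qed

context
  fixes u :: L
  assumes u: "nonconst u"
begin

lemma evR_0: "evR u 0 = 0"
  using evR_Fract[OF u, of 1 0] by (simp add: Zero_fract_def)

lemma evR_1: "evR u 1 = 1"
  using evR_Fract[OF u, of 1 1] by (simp add: One_fract_def)

lemma evR_cK: "evR u (cK c) = cst c"
  using evR_Fract[OF u, of 1 "[:c:]"] by (simp add: cK_def)

lemma evR_Xf: "evR u Xf = u"
  using evR_Fract[OF u, of 1 "[:0, 1:]"] by (simp add: Xf_def)

lemma evR_add: "evR u (r + s) = evR u r + evR u s"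
proof -
  obtain a b where r: "r = Fract a b" "b \<noteq> 0" by (cases r) auto
  obtain c d where s: "s = Fract c d" "d \<noteq> 0" by (cases s) auto
  show ?thesis using u r s
    by (simp add: evR_Fract pe_add pe_mult pe_nonconst_nz add_frac_eq)
qed

lemma evR_mult: "evR u (r * s) = evR u r * evR u s"
proof -
  obtain a b where r: "r = Fract a b" "b \<noteq> 0" by (cases r) auto
  obtain c d where s: "s = Fract c d" "d \<noteq> 0" by (cases s) auto
  show ?thesis using u r s by (simp add: evR_Fract pe_mult)
qed

lemma evR_power: "evR u (r ^ k) = evR u r ^ k"
  by (induction k) (simp_all add: evR_1 evR_mult)

lemma evR_eq_0_iff: "evR u r = 0 \<longleftrightarrow> r = 0"
proof
  assume "evR u r = 0"
  hence "r * inverse r \<noteq> 1" by (metis evR_1 evR_mult mult_zero_left zero_neq_one)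
  thus "r = 0" using right_inverse by blast
qed (simp add: evR_0)

lemma evR_inverse: "evR u (inverse r) = inverse (evR u r)"
proof (cases "r = 0")
  case False
  hence "evR u (inverse r) * evR u r = 1" by (metis evR_1 evR_mult left_inverse)
  thus ?thesis by (metis inverse_unique mult.commute)
qed (simp add: evR_0)

lemma evR_nz_obtain:
  assumes "r \<noteq> 0"
  obtains a b where "r = Fract a b" "a \<noteq> 0" "b \<noteq> 0" "evR u r = pe a u / pe b u"
proof -
  obtain a b where r: "r = Fract a b" "b \<noteq> 0" by (cases r) auto
  moreover have "a \<noteq> 0" using assms r by (auto simp: fract_collapse)
  ultimately show ?thesis using that evR_Fract[OF u] by blast
qed

end

definition ev :: "L \<Rightarrow> L \<Rightarrow> P \<Rightarrow> L" where
  "ev u v p = poly (map_poly (evR u) p) v"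

context
  fixes u v :: L
  assumes u: "nonconst u"
begin

lemma ev_0: "ev u v 0 = 0"
  by (simp add: ev_def)

lemma ev_pCons: "ev u v (pCons a p) = evR u a + v * ev u v p"
  by (simp add: ev_def map_poly_pCons evR_0[OF u])

lemma ev_1: "ev u v 1 = 1"
  by (simp add: one_pCons ev_pCons ev_0 evR_1[OF u])

lemma ev_add: "ev u v (p + r) = ev u v p + ev u v r"
  by (induction p r rule: poly_induct2) (simp_all add: ev_pCons ev_0 evR_add[OF u] algebra_simps)

lemma ev_smult: "ev u v (smult c p) = evR u c * ev u v p"
  by (induction p) (simp_all add: ev_pCons ev_0 evR_mult[OF u] algebra_simps)

lemma ev_mult: "ev u v (p * r) = ev u v p * ev u v r"
  by (induction p) (simp_all add: ev_pCons ev_0 ev_add ev_smult evR_0[OF u] algebra_simps)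

lemma ev_monom: "ev u v (monom c k) = evR u c * v ^ k"
  by (induction k) (simp_all add: monom_0 monom_Suc ev_pCons ev_0 evR_0[OF u] algebra_simps)

lemma ev_const: "ev u v [:c:] = evR u c"
  by (simp add: ev_pCons ev_0)

lemma ev_altdef: "ev u v p = (\<Sum>i\<le>degree p. evR u (coeff p i) * v ^ i)"
proof -
  have "p = (\<Sum>i\<le>degree p. monom (coeff p i) i)" by (simp add: poly_as_sum_of_monoms)
  have *: "ev u v (\<Sum>i\<in>A. monom (f i) i) = (\<Sum>i\<in>A. evR u (f i) * v ^ i)" if "finite A" for A f
    using that by induction (simp_all add: ev_0 ev_add ev_monom)
  show ?thesis using *[of "{..degree p}" "coeff p"] by (simp add: poly_as_sum_of_monoms)
qed

lemma ev_altdef':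
  assumes "degree p \<le> d"
  shows "ev u v p = (\<Sum>i\<le>d. evR u (coeff p i) * v ^ i)"
  unfolding ev_altdef
  by (rule sum.mono_neutral_left) (use assms in \<open>auto simp: coeff_eq_0 evR_0[OF u]\<close>)

end

section \<open>The function field as a subfield of the Laurent series\<close>

lemma CHAR_L: "CHAR(L) = 2"
  using CHAR_K by simp

lemma char2_arith:
  fixes a b :: "'a :: comm_ring_1"
  assumes "CHAR('a) = 2"
  shows "a + a = 0" "a + (a + b) = b" "- a = a" "a - b = a + b" "a + b = 0 \<longleftrightarrow> a = b"
    "numeral (Num.Bit0 k) = (0::'a)" "numeral (Num.Bit1 k) = (1::'a)"
proof -
  note self = char2_add_self[OF assms]
  show "a + a = 0" "a + (a + b) = b" using self by (simp_all flip: add.assoc)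
  show neg: "- c = c" for c :: 'a using self by (rule minus_unique)
  show "a - b = a + b" using neg[of b] by (simp add: diff_conv_add_uminus del: add_uminus_conv_diff)
  show "a + b = 0 \<longleftrightarrow> a = b" using neg by (metis add_eq_0_iff)
  show "numeral (Num.Bit0 k) = (0::'a)" "numeral (Num.Bit1 k) = (1::'a)"
    by (simp_all only: numeral.simps self add_0)
qed

lemmas L_add_self = char2_arith(1)[OF CHAR_L]
  and L_eq_iff = char2_arith(5)[OF CHAR_L]
  and L_numeral = char2_arith(6,7)[OF CHAR_L]
  and K_eq_iff = char2_arith(5)[OF CHAR_K]

declare char2_arith(1-4,6,7)[OF CHAR_L, simp] char2_arith(1-4,6,7)[OF CHAR_K, simp]

lemma of_nat_char2:
  fixes k :: nat
  shows "of_nat k = (if even k then 0 else 1 :: L)" "of_nat k = (if even k then 0 else 1 :: K)"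
  by (induction k) auto

lemma L_power_add: "(a + b :: L) ^ (2 ^ k) = a ^ (2 ^ k) + b ^ (2 ^ k)"
  by (rule char2_power_add[OF CHAR_L])

lemma L_square_add: "(a + b :: L) ^ 2 = a ^ 2 + b ^ 2"
  using L_power_add[of a b 1] by simp

lemma L_square_inj: "a ^ 2 = b ^ 2 \<Longrightarrow> a = (b::L)"
  by (rule char2_square_inj[OF CHAR_L])

lemma L_deriv_square: "fls_deriv (a ^ 2 :: L) = 0"
  by (simp add: fls_deriv_power)

locale curve =
  fixes n q m :: nat
  assumes q_def: "q = 2 ^ n" and n5: "n \<ge> 5" and n_odd: "odd n" and m_def: "m = m_of q"
begin

lemma q1: "q + 1 = 3 * m"
proof -
  from n_odd obtain k where "n = 2 * k + 1" by (auto elim: oddE)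
  hence "q = 2 * 4 ^ k" by (simp add: q_def power_mult)
  moreover have "3 dvd (2 * 4 ^ k + 1 :: nat)"
    by (induction k) (simp_all add: dvd_def, presburger)
  ultimately show ?thesis by (simp add: m_def m_of_def)
qed

lemma q_ge: "q \<ge> 32"
  using power_increasing[OF n5, of "2::nat"] by (simp add: q_def)

lemma q_even: "even q"
  using n5 by (simp add: q_def)

lemma m_odd: "odd m"
  using q1 q_even by presburger

lemma m_ge: "m \<ge> 11"
  using q1 q_ge by simp

lemma m_pos [simp]: "m > 0"
  using m_ge by simp

lemma m_nz [simp]: "m \<noteq> 0"
  using m_pos by simp

lemma L_power_q_add: "(a + b :: L) ^ q = a ^ q + b ^ q"
  unfolding q_def by (rule L_power_add)

lemma root_q1_exists:
  fixes a :: L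
  assumes "int (q + 1) dvd val a"
  shows "\<exists>b. b ^ (q + 1) = a"
  by (rule fls_root_exists) (use assms q_even in \<open>auto simp: of_nat_char2\<close>)

section \<open>Laurent series points of the curve: orders of \<open>x^(2m) + x^m\<close> over the
  \<open>x\<close>-line\<close>

definition rel :: "L \<Rightarrow> L \<Rightarrow> bool" where
  "rel u v \<longleftrightarrow> v ^ (q + 1) = u ^ (2 * m) + u ^ m"

lemma rel_rhs_branch:
  fixes \<eta> :: L
  assumes "c ^ m = 1" "val \<eta> > 0"
  shows "val ((cst c + \<eta>) ^ (2 * m) + (cst c + \<eta>) ^ m) = val \<eta>"
proof -
  let ?p = "monom 1 (2 * m) + monom 1 m :: K poly"
  have 1: "poly ?p c = 0" using assms(1) by (simp add: poly_monom mult_2 power_add)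
  have "c \<noteq> 0" using assms(1) by (auto simp: power_0_left)
  hence 2: "poly (pderiv ?p) c \<noteq> 0"
    using m_odd by (simp add: pderiv_add pderiv_monom poly_monom of_nat_char2)
  show ?thesis using subdegree_pe_simple_root[OF assms(2) 1 2] by (simp add: pe_add pe_monom)
qed

lemma rel_rhs_unit:
  fixes \<eta> :: L
  assumes "c \<noteq> 0" "c ^ m \<noteq> 1" "val \<eta> > 0"
  shows "val ((cst c + \<eta>) ^ (2 * m) + (cst c + \<eta>) ^ m) = 0"
    "(cst c + \<eta>) ^ (2 * m) + (cst c + \<eta>) ^ m \<noteq> 0"
proof -
  let ?p = "monom 1 (2 * m) + monom 1 m :: K poly"
  have "poly ?p c = c ^ m * (c ^ m + 1)" by (simp add: poly_monom mult_2 power_add distrib_left del: mult_2_right)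
  hence "poly ?p c \<noteq> 0" using assms K_eq_iff by auto
  from pe_at_unit[OF assms(3) this]
  show "val ((cst c + \<eta>) ^ (2 * m) + (cst c + \<eta>) ^ m) = 0"
    "(cst c + \<eta>) ^ (2 * m) + (cst c + \<eta>) ^ m \<noteq> 0" by (simp_all add: pe_add pe_monom)
qed

text \<open>A cube is substituted for \<open>x\<close> because \<open>q + 1 = 3 * m\<close>: this
  makes the order divisible by \<open>q + 1\<close>, so that a matching \<open>y\<close> exists,
  here of order 1. At infinity the inverse cube gives a \<open>y\<close> of order -2.\<close>

lemma rel_rhs_zero: "val ((fls_X ^ 3 :: L) ^ (2 * m) + (fls_X ^ 3) ^ m) = int (q + 1) * 1"
proof -
  have "(fls_X ^ 3 :: L) ^ m = fls_X ^ (3 * m)" "(fls_X ^ 3 :: L) ^ (2 * m) = fls_X ^ (3 * (2 * m))"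
    by (simp_all only: power_mult)
  moreover have "val (fls_X ^ (3 * (2 * m)) + fls_X ^ (3 * m) :: L) = int (3 * m)"
    by (subst fls_subdegree_add_eq2) simp_all
  ultimately show ?thesis by (simp only: q1)
qed

lemma inverse_X3_subdegree: "val (inverse (fls_X ^ 3) :: L) = - 3"
  by (subst fls_inverse_subdegree) simp

lemma rel_rhs_infinity:
  "val ((inverse (fls_X ^ 3) :: L) ^ (2 * m) + inverse (fls_X ^ 3) ^ m) = int (q + 1) * (-2)"
proof -
  have s: "val ((inverse (fls_X ^ 3) :: L) ^ k) = - 3 * int k" for k
    by (simp only: fls_subdegree_pow inverse_X3_subdegree)
  show ?thesis unfolding q1 by (subst fls_subdegree_add_eq1) (simp_all only: s, (simp; fail)+)
qed

text \<open>The function field is realised inside its completion at the point \<open>(x, y) = (1, 0)\<close>, where \<open>y\<close> is a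
  uniformizer. There \<open>K(x)\<close> has orders divisible by \<open>q + 1\<close>, so the orders of the terms \<open>c y^j\<close>
  with \<open>c \<in> K(x)\<close> and \<open>0 \<le> j \<le> q\<close> are distinct, and reduced representatives embed.\<close>

definition xx :: L where "xx = 1 + fls_X ^ (q + 1)"
definition yy :: L where "yy = (SOME v. rel xx v)"
definition tt :: L where "tt = xx ^ m"

lemma rel_base: "rel xx yy"
proof -
  have "val (xx ^ (2 * m) + xx ^ m) = int (q + 1)"
    unfolding xx_def using rel_rhs_branch[of 1 "fls_X ^ (q + 1)"] by simp
  hence "int (q + 1) dvd val (xx ^ (2 * m) + xx ^ m)" by simp
  from root_q1_exists[OF this] show ?thesis unfolding yy_def rel_def by (rule someI_ex)
qed

lemma yy_subdegree: "val yy = 1"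
proof -
  have "val (xx ^ (2 * m) + xx ^ m) = int (q + 1)"
    unfolding xx_def using rel_rhs_branch[of 1 "fls_X ^ (q + 1)"] by simp
  hence "int (q + 1) * val yy = int (q + 1) * 1"
    using rel_base fls_subdegree_pow[of yy "q + 1"] by (simp only: rel_def mult_1_right)
  thus ?thesis by (simp only: mult_cancel_left) simp
qed

lemma yy_nz [simp]: "yy \<noteq> 0"
  using yy_subdegree by auto

lemma xx_nonconst: "nonconst xx"
proof -
  have "fls_nth xx (int (q + 1)) = 1"
    by (simp add: xx_def del: power_Suc of_nat_Suc of_nat_add)
  thus ?thesis by (auto simp: nonconst_def)
qed

lemmas evx_0 = evR_0[OF xx_nonconst] and evx_1 = evR_1[OF xx_nonconst]
  and evx_Fract = evR_Fract[OF xx_nonconst] and evx_Xf = evR_Xf[OF xx_nonconst]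
  and evx_cK = evR_cK[OF xx_nonconst] and evx_eq_0_iff = evR_eq_0_iff[OF xx_nonconst]
  and evx_inverse = evR_inverse[OF xx_nonconst] and evx_mult = evR_mult[OF xx_nonconst]
  and evx_power = evR_power[OF xx_nonconst]

lemmas ev0_0 = ev_0[OF xx_nonconst] and ev0_1 = ev_1[OF xx_nonconst]
  and ev0_add = ev_add[OF xx_nonconst] and ev0_const = ev_const[OF xx_nonconst]
  and ev0_monom = ev_monom[OF xx_nonconst] and ev0_mult = ev_mult[OF xx_nonconst]
  and ev0_pCons = ev_pCons[OF xx_nonconst]

lemma xx_nz [simp]: "xx \<noteq> 0"
  using xx_nonconst fls_const_0 by (metis nonconst_def)

lemma xx_subdegree: "val xx = 0"
proof -
  have "val (1 + fls_X ^ (q + 1) :: L) = 0" by (subst fls_subdegree_add_eq1) simp_all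
  thus ?thesis by (simp only: xx_def)
qed

lemma tt_nz [simp]: "tt \<noteq> 0"
  by (simp add: tt_def)

lemma F3_eq: "F3 q = monom 1 (q + 1) + [:Xf ^ (2 * m) + Xf ^ m:]"
  by (simp add: F3_def m_def)

lemma degree_F3: "degree (F3 q) = q + 1"
  unfolding F3_eq using q_ge by (subst degree_add_eq_left) (auto simp: degree_monom_eq)

lemma F3_nz [simp]: "F3 q \<noteq> 0"
  using degree_F3 by auto

lemma ev_F3:
  assumes "nonconst u" "rel u v"
  shows "ev u v (F3 q) = 0"
  using assms(2)
  by (simp add: F3_eq ev_add[OF assms(1)] ev_monom[OF assms(1)] ev_const[OF assms(1)]
      evR_add[OF assms(1)] evR_power[OF assms(1)] evR_Xf[OF assms(1)] evR_1[OF assms(1)] rel_def)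

lemma ev_mod:
  assumes "nonconst u" "rel u v"
  shows "ev u v (p mod F3 q) = ev u v p"
proof -
  have "ev u v p = ev u v (p div F3 q * F3 q + p mod F3 q)" by simp
  also have "\<dots> = ev u v (p mod F3 q)"
    by (simp only: ev_add[OF assms(1)] ev_mult[OF assms(1)] ev_F3[OF assms]) simp
  finally show ?thesis by simp
qed

abbreviation ev0 :: "P \<Rightarrow> L" where "ev0 \<equiv> ev xx yy"
abbreviation Car :: "P set" where "Car \<equiv> {p. degree p < q + 1}"

lemma evR_xx_subdegree:
  assumes "r \<noteq> 0"
  shows "int (q + 1) dvd val (evR xx r)"
proof -
  obtain a b where ab: "a \<noteq> 0" "b \<noteq> 0" "evR xx r = pe a xx / pe b xx"
    using evR_nz_obtain[OF xx_nonconst assms] .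
  have *: "int (q + 1) dvd val (pe p xx)" if "p \<noteq> 0" for p :: "K poly"
    using subdegree_pe_at(1)[of "fls_X ^ (q + 1)" p 1] that by (simp add: xx_def)
  show ?thesis unfolding ab(3)
    by (subst fls_divide_subdegree) (use ab * in \<open>auto simp: pe_nonconst_nz[OF xx_nonconst] intro!: dvd_diff\<close>)
qed

lemma ev0_eq_0:
  assumes "ev0 p = 0" "p \<in> Car"
  shows "p = 0"
proof (rule ccontr)
  assume "p \<noteq> 0"
  let ?f = "\<lambda>i. evR xx (coeff p i) * yy ^ i"
  let ?A = "{i. i \<le> degree p \<and> coeff p i \<noteq> 0}"
  have nz: "?f i \<noteq> 0" if "i \<in> ?A" for i
    using that by (simp add: evx_eq_0_iff)
  have "ev0 p = sum ?f ?A"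
    unfolding ev_altdef[OF xx_nonconst]
    by (rule sum.mono_neutral_right) (auto simp: evx_0)
  moreover have "sum ?f ?A \<noteq> 0"
  proof (rule sum_distinct_subdegree_nz)
    show "finite ?A" by simp
    show "?A \<noteq> {}" using \<open>p \<noteq> 0\<close> by (auto intro!: exI[of _ "degree p"])
    show "inj_on (\<lambda>i. val (?f i)) ?A"
    proof (rule inj_onI)
      fix i j assume ij: "i \<in> ?A" "j \<in> ?A" "val (?f i) = val (?f j)"
      have sd: "val (?f k) = val (evR xx (coeff p k)) + int k" if "k \<in> ?A" for k
        using that nz[OF that] by (subst fls_subdegree_mult) (auto simp: fls_subdegree_pow yy_subdegree)
      have "int (q + 1) dvd int i - int j"
      proof -
        have "int i - int j = val (evR xx (coeff p j)) - val (evR xx (coeff p i))"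
          using ij sd[of i] sd[of j] by simp
        thus ?thesis using ij evR_xx_subdegree by (auto intro!: dvd_diff simp del: of_nat_add)
      qed
      hence "int i mod int (q + 1) = int j mod int (q + 1)" by (simp only: mod_eq_dvd_iff)
      moreover have "i < q + 1" "j < q + 1" using ij assms(2) by auto
      ultimately show "i = j" by simp
    qed
  qed (use nz in auto)
  ultimately show False using assms(1) by simp
qed

lemma ev0_inj: "inj_on ev0 Car"
proof (rule inj_onI)
  fix a b assume ab: "a \<in> Car" "b \<in> Car" "ev0 a = ev0 b"
  have "ev0 (a - b) + ev0 b = ev0 a" by (simp flip: ev0_add)
  hence "ev0 (a - b) = 0" using ab by simp
  moreover have "a - b \<in> Car" using ab degree_diff_le_max[of a b] by auto
  ultimately show "a = b" using ev0_eq_0 by fastforce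
qed

lemma mod_Car: "p mod F3 q \<in> Car"
  using degree_mod_less[OF F3_nz, of p] degree_F3 by auto

text \<open>Irreducibility of \<open>F3 q\<close> is never invoked. Division of \<open>F3 q\<close>
  by \<open>p\<close> leaves a remainder of smaller degree, which is inverted recursively; a zero
  remainder would make \<open>p\<close> or the cofactor vanish under \<open>ev0\<close>, contrary to
  \<open>ev0_eq_0\<close>.\<close>

lemma ev0_inverse_aux:
  assumes "p \<in> Car" "p \<noteq> 0"
  shows "\<exists>r. ev0 r * ev0 p = 1"
  using assms
proof (induction "degree p" arbitrary: p rule: less_induct)
  case less
  show ?case
  proof (cases "degree p = 0")
    case True
    then obtain c where c: "p = [:c:]" "c \<noteq> 0" using less.prems by (auto elim!: degree_eq_zeroE)
    show ?thesis
      by (rule exI[of _ "[:inverse c:]"])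
         (use c in \<open>simp add: ev0_const evx_inverse evx_eq_0_iff\<close>)
  next
    case False
    let ?d = "F3 q div p" and ?r = "F3 q mod p"
    have F3: "F3 q = p * ?d + ?r" by simp
    have eq: "ev0 p * ev0 ?d + ev0 ?r = 0"
      using ev_F3[OF xx_nonconst rel_base] by (subst (asm) F3) (simp only: ev0_add ev0_mult)
    have deg: "?r = 0 \<or> degree ?r < degree p" using degree_mod_less[OF less.prems(2)] by blast
    have "?r \<noteq> 0"
    proof
      assume r0: "?r = 0"
      have p0: "ev0 p \<noteq> 0" using ev0_eq_0 less.prems by blast
      hence "ev0 ?d = 0" using eq r0 by (simp add: ev0_0)
      moreover have "?d \<noteq> 0" using F3 r0 by (metis F3_nz add.right_neutral mult_zero_right)
      moreover have "degree (F3 q) = degree p + degree ?d"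
        using F3 r0 \<open>?d \<noteq> 0\<close> less.prems(2) by (metis add.right_neutral degree_mult_eq)
      ultimately show False using ev0_eq_0[of ?d] False degree_F3 by auto
    qed
    moreover from this deg less.prems have "degree ?r < degree p" "?r \<in> Car" by auto
    ultimately obtain s where s: "ev0 s * ev0 ?r = 1" using less.hyps by blast
    from eq have "ev0 ?r = ev0 p * ev0 ?d" using L_eq_iff by metis
    hence "ev0 (s * ?d) * ev0 p = 1" using s by (simp add: ev0_mult mult_ac)
    thus ?thesis by blast
  qed
qed

text \<open>The field generated by the constants, \<open>x\<close> and \<open>y\<close>, given
  inductively so that a property of all functions can be checked on generators and field operations.
  \<open>F_eq\<close> matches it with the reduced representatives.\<close>

inductive_set F :: "L set" where
  F_const [intro, simp]: "cst c \<in> F"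
| F_xx [intro, simp]: "xx \<in> F"
| F_yy [intro, simp]: "yy \<in> F"
| F_add [intro, simp]: "a \<in> F \<Longrightarrow> b \<in> F \<Longrightarrow> a + b \<in> F"
| F_mult [intro, simp]: "a \<in> F \<Longrightarrow> b \<in> F \<Longrightarrow> a * b \<in> F"
| F_inverse [intro, simp]: "a \<in> F \<Longrightarrow> inverse a \<in> F"

lemma F_0 [intro, simp]: "0 \<in> F" and F_1 [intro, simp]: "1 \<in> F"
  using F_const[of 0] F_const[of 1] by simp_all

lemma F_divide [intro, simp]: "a \<in> F \<Longrightarrow> b \<in> F \<Longrightarrow> a / b \<in> F"
  by (simp add: divide_inverse)

lemma F_power [intro, simp]: "a \<in> F \<Longrightarrow> a ^ k \<in> F"
  by (induction k) auto

lemma F_sum [intro]: "(\<And>i. i \<in> A \<Longrightarrow> f i \<in> F) \<Longrightarrow> sum f A \<in> F"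
  by (induction A rule: infinite_finite_induct) auto

lemma F_tt [intro, simp]: "tt \<in> F"
  by (simp add: tt_def)

lemma F_pe [intro]: "a \<in> F \<Longrightarrow> pe p a \<in> F"
  by (induction p) auto

lemma F_evR [intro]: "evR xx r \<in> F"
proof (cases "r = 0")
  case False
  then obtain a b where "evR xx r = pe a xx / pe b xx" using evR_nz_obtain[OF xx_nonconst] by blast
  thus ?thesis by auto
qed (simp add: evx_0)

lemma F_ev0 [intro, simp]: "ev0 p \<in> F"
  unfolding ev_altdef[OF xx_nonconst] by auto

lemma F_eq: "F = ev0 ` Car"
proof
  show "ev0 ` Car \<subseteq> F" by auto
  have red: "ev0 p \<in> ev0 ` Car" for p
    using ev_mod[OF xx_nonconst rel_base, of p] mod_Car[of p] by (metis image_eqI)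
  show "F \<subseteq> ev0 ` Car"
  proof
    fix f assume "f \<in> F"
    thus "f \<in> ev0 ` Car"
    proof induction
      case (F_const c)
      show ?case using red[of "[:cK c:]"] by (simp add: ev0_const evx_cK)
    next
      case F_xx
      show ?case using red[of "[:Xf:]"] by (simp add: ev0_const evx_Xf)
    next
      case F_yy
      show ?case using red[of "monom 1 1"] by (simp add: ev0_monom evx_1)
    next
      case (F_add a b)
      then obtain p r where "a = ev0 p" "b = ev0 r" by blast
      thus ?case using red[of "p + r"] by (simp add: ev0_add)
    next
      case (F_mult a b)
      then obtain p r where "a = ev0 p" "b = ev0 r" by blast
      thus ?case using red[of "p * r"] by (simp add: ev0_mult)
    next
      case (F_inverse a)
      then obtain p where p: "a = ev0 p" "p \<in> Car" by blast
      show ?case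
      proof (cases "p = 0")
        case True
        thus ?thesis using red[of 0] p by (simp add: ev0_0)
      next
        case False
        then obtain r where "ev0 r * a = 1" using ev0_inverse_aux p by blast
        hence "inverse a = ev0 r" by (metis inverse_unique mult.commute)
        thus ?thesis using red by simp
      qed
    qed
  qed
qed

definition rep :: "L \<Rightarrow> P" where "rep = the_inv_into Car ev0"

lemma ev0_rep [simp]: "f \<in> F \<Longrightarrow> ev0 (rep f) = f"
  unfolding rep_def F_eq by (rule f_the_inv_into_f[OF ev0_inj])

lemma rep_Car [simp]: "f \<in> F \<Longrightarrow> rep f \<in> Car"
  unfolding rep_def F_eq by (rule the_inv_into_into[OF ev0_inj]) auto

lemma rep_ev0 [simp]: "p \<in> Car \<Longrightarrow> rep (ev0 p) = p"
  unfolding rep_def by (rule the_inv_into_f_f[OF ev0_inj])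

text \<open>A \<open>K\<close>-embedding of \<open>F\<close> into the Laurent series; the values outside \<open>F\<close> are irrelevant.\<close>

definition hom :: "(L \<Rightarrow> L) \<Rightarrow> bool" where
  "hom E \<longleftrightarrow> (\<forall>c. E (cst c) = cst c) \<and>
     (\<forall>a\<in>F. \<forall>b\<in>F. E (a + b) = E a + E b \<and> E (a * b) = E a * E b)"

context
  fixes E assumes hom: "hom E"
begin

lemma hom_const: "E (cst c) = cst c"
  using hom by (simp add: hom_def)

lemma hom_0: "E 0 = 0" and hom_1: "E 1 = 1"
  using hom_const[of 0] hom_const[of 1] by simp_all

lemma hom_add: "a \<in> F \<Longrightarrow> b \<in> F \<Longrightarrow> E (a + b) = E a + E b"
  using hom by (simp add: hom_def)

lemma hom_mult: "a \<in> F \<Longrightarrow> b \<in> F \<Longrightarrow> E (a * b) = E a * E b"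
  using hom by (simp add: hom_def)

lemma hom_power: "a \<in> F \<Longrightarrow> E (a ^ k) = E a ^ k"
  by (induction k) (simp_all add: hom_1 hom_mult)

lemma hom_eq_0_iff: "a \<in> F \<Longrightarrow> E a = 0 \<longleftrightarrow> a = 0"
proof
  assume a: "a \<in> F" "E a = 0"
  hence "E (a * inverse a) = 0" using hom_mult[of a "inverse a"] by simp
  thus "a = 0" by (metis hom_1 right_inverse zero_neq_one)
qed (simp add: hom_0)

lemma hom_inverse: "a \<in> F \<Longrightarrow> E (inverse a) = inverse (E a)"
proof (cases "a = 0")
  case False
  assume a: "a \<in> F"
  have "E a * E (inverse a) = 1" using a False by (simp flip: hom_mult add: hom_1)
  thus ?thesis by (metis inverse_unique)
qed (simp add: hom_0)

lemma hom_divide: "a \<in> F \<Longrightarrow> b \<in> F \<Longrightarrow> E (a / b) = E a / E b"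
  by (simp add: divide_inverse hom_mult hom_inverse)

lemma hom_sum: "(\<And>i. i \<in> A \<Longrightarrow> f i \<in> F) \<Longrightarrow> E (sum f A) = (\<Sum>i\<in>A. E (f i))"
  by (induction A rule: infinite_finite_induct) (simp_all add: hom_0 hom_add F_sum)

lemma hom_inj: "a \<in> F \<Longrightarrow> b \<in> F \<Longrightarrow> E a = E b \<Longrightarrow> a = b"
  by (metis F_add L_eq_iff hom_add hom_eq_0_iff)

lemma hom_pe: "a \<in> F \<Longrightarrow> E (pe p a) = pe p (E a)"
  by (induction p) (simp_all add: hom_0 hom_add hom_mult hom_const F_pe)

lemma hom_nonconst:
  assumes "a \<in> F" "nonconst a"
  shows "nonconst (E a)"
  unfolding nonconst_def
proof (intro allI notI)
  fix c assume "E a = cst c"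
  hence "a = cst c" using hom_inj[of a "cst c"] assms by (simp add: hom_const)
  thus False using assms(2) unfolding nonconst_def by blast
qed

lemma hom_ev0: "E (ev0 p) = ev (E xx) (E yy) p"
proof -
  have nc: "nonconst (E xx)" by (rule hom_nonconst) (simp_all add: xx_nonconst)
  have *: "E (evR xx r) = evR (E xx) r" for r
  proof -
    obtain a b where r: "r = Fract a b" "b \<noteq> 0" by (cases r) auto
    thus ?thesis by (simp add: evx_Fract evR_Fract[OF nc] hom_divide hom_pe F_pe)
  qed
  show ?thesis
    unfolding ev_altdef[OF xx_nonconst] ev_altdef[OF nc]
    by (subst hom_sum) (auto simp: hom_mult hom_power * F_evR)
qed

lemma hom_rel: "rel (E xx) (E yy)"
proof -
  have "E (yy ^ (q + 1)) = E (xx ^ (2 * m) + xx ^ m)" using rel_base by (simp only: rel_def)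
  thus ?thesis by (simp only: rel_def hom_power hom_add F_power F_xx F_yy)
qed

end

lemma hom_eqI:
  assumes "hom E" "hom \<psi>" "E xx = \<psi> xx" "E yy = \<psi> yy" "f \<in> F"
  shows "E f = \<psi> f"
  using assms hom_ev0[of E "rep f"] hom_ev0[of \<psi> "rep f"] by simp

text \<open>Reducing a product modulo \<open>F3 q\<close> changes it by a multiple of
  \<open>F3 q\<close>, which \<open>ev u v\<close> kills. So each point of the curve with
  transcendental first coordinate yields an embedding.\<close>

lemma hom_exists:
  assumes "nonconst u" "rel u v"
  obtains E where "hom E" "E xx = u" "E yy = v" "\<And>p. E (ev0 p) = ev u v p"
proof
  let ?f = "\<lambda>f. ev u v (rep f)"
  show *: "?f (ev0 p) = ev u v p" for p
  proof -
    have "rep (ev0 p) = p mod F3 q"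
      using ev_mod[OF xx_nonconst rel_base, of p] mod_Car[of p] rep_ev0 by metis
    thus ?thesis by (simp add: ev_mod[OF assms])
  qed
  show "hom ?f" unfolding hom_def
  proof (intro conjI allI ballI)
    fix c
    show "?f (cst c) = cst c"
      using *[of "[:cK c:]"] by (simp add: ev0_const ev_const[OF assms(1)]
         evx_cK evR_cK[OF assms(1)])
  next
    fix a b assume ab: "a \<in> F" "b \<in> F"
    show "?f (a + b) = ?f a + ?f b"
      using *[of "rep a + rep b"] ab by (simp add: ev0_add ev_add[OF assms(1)])
    show "?f (a * b) = ?f a * ?f b"
      using *[of "rep a * rep b"] ab by (simp add: ev0_mult ev_mult[OF assms(1)])
  qed
  show "?f xx = u" using *[of "[:Xf:]"]
    by (simp add: ev0_const ev_const[OF assms(1)] evx_Xf evR_Xf[OF assms(1)])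
  show "?f yy = v" using *[of "monom 1 1"]
    by (simp add: ev0_monom ev_monom[OF assms(1)] evx_1 evR_1[OF assms(1)])
qed

section \<open>The Cartier operator and holomorphic differentials\<close>

lemma tt_rel: "yy ^ (q + 1) = tt ^ 2 + tt"
  using rel_base by (simp only: rel_def tt_def power_mult[symmetric] mult.commute[of m])

lemma xx_tt: "xx ^ (q + 1) = tt ^ 3"
  by (simp only: q1 tt_def power_mult[symmetric] mult.commute[of m])

lemma hom_tt: "hom E \<Longrightarrow> E tt = E xx ^ m"
  by (simp add: tt_def hom_power)

lemma hom_tt_rel: "hom E \<Longrightarrow> E yy ^ (q + 1) = E tt ^ 2 + E tt"
  using hom_rel[of E] by (simp only: rel_def hom_tt power_mult[symmetric] mult.commute[of m])

lemma hom_xx_tt: "hom E \<Longrightarrow> E xx ^ (q + 1) = E tt ^ 3"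
  by (simp only: q1 hom_tt power_mult[symmetric] mult.commute[of m])

lemma q_half: obtains h where "q = 2 * h"
  using q_even by (auto elim: evenE)

text \<open>Squares have derivative zero and \<open>q + 1\<close> is odd. For \<open>u = t\<close>
  and \<open>v = y\<close> this reads \<open>dt = y^q dy\<close>.\<close>

lemma rel_deriv:
  fixes u v :: L
  assumes "v ^ (q + 1) = u ^ 2 + u"
  shows "fls_deriv u = v ^ q * fls_deriv v"
proof -
  have "fls_deriv (v ^ (q + 1)) = fls_deriv (u ^ 2 + u)" by (simp only: assms)
  thus ?thesis using q_even
    by (simp add: L_deriv_square fls_deriv_power of_nat_char2 del: power_Suc)
qed

text \<open>The generators are treated through \<open>x = t^3 / x^q\<close> and
  \<open>y = (t^2 + t) / y^q\<close>, where the denominators are squares. Inverses follow from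
  \<open>1/f = f / f^2\<close>.\<close>

lemma F_decomp:
  assumes "f \<in> F"
  shows "\<exists>a\<in>F. \<exists>b\<in>F. f = a ^ 2 + b ^ 2 * tt"
  using assms
proof induction
  case (F_const c)
  obtain e where "e ^ 2 = c" using nth_root_exists[of 2 c] by auto
  thus ?case by (intro bexI[of _ "cst e"] bexI[of _ 0]) (auto simp: fls_const_power)
next
  case F_xx
  obtain h where h: "q = 2 * h" by (rule q_half)
  have xh: "xx ^ q = (xx ^ h) ^ 2" by (simp only: h power_mult mult.commute[of 2 h])
  have "(tt / xx ^ h) ^ 2 * tt = tt ^ 3 / xx ^ q"
    by (simp add: xh power_divide power3_eq_cube power2_eq_square)
  also have "\<dots> = xx" unfolding xx_tt[symmetric] by simp
  finally have "xx = 0 ^ 2 + (tt / xx ^ h) ^ 2 * tt" by simp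
  thus ?case using F_0 F_tt F_divide F_power F_xx by blast
next
  case F_yy
  obtain h where h: "q = 2 * h" by (rule q_half)
  have yh: "yy ^ q = (yy ^ h) ^ 2" by (simp only: h power_mult mult.commute[of 2 h])
  have "(tt / yy ^ h) ^ 2 + (1 / yy ^ h) ^ 2 * tt = (tt ^ 2 + tt) / yy ^ q"
    by (simp only: yh power_divide add_divide_distrib times_divide_eq_left power_one mult_1_left)
  also have "\<dots> = yy" unfolding tt_rel[symmetric] by simp
  finally have "yy = (tt / yy ^ h) ^ 2 + (1 / yy ^ h) ^ 2 * tt" by simp
  thus ?case using F_1 F_tt F_divide F_power F_yy by blast
next
  case (F_add f g)
  then obtain a b c d where "a \<in> F" "b \<in> F" "f = a ^ 2 + b ^ 2 * tt" "c \<in> F" "d \<in> F" "g = c ^ 2 + d ^ 2 * tt"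
    by blast
  thus ?case
    by (intro bexI[of _ "a + c"] bexI[of _ "b + d"]) (auto simp: L_square_add algebra_simps)
next
  case (F_mult f g)
  then obtain a b c d where "a \<in> F" "b \<in> F" "f = a ^ 2 + b ^ 2 * tt" "c \<in> F" "d \<in> F" "g = c ^ 2 + d ^ 2 * tt"
    by blast
  thus ?case
    by (intro bexI[of _ "a * c + b * d * tt"] bexI[of _ "a * d + b * c"])
       (auto simp: L_square_add power_mult_distrib algebra_simps power2_eq_square)
next
  case (F_inverse f)
  then obtain a b where ab: "a \<in> F" "b \<in> F" "f = a ^ 2 + b ^ 2 * tt" by blast
  have "inverse f = f / f ^ 2" by (cases "f = 0") (simp_all add: power2_eq_square inverse_eq_divide)
  also have "\<dots> = (a ^ 2 + b ^ 2 * tt) / f ^ 2" by (simp only: ab(3))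
  also have "\<dots> = (a / f) ^ 2 + (b / f) ^ 2 * tt"
    by (simp add: power_divide add_divide_distrib)
  finally show ?case using ab(1,2) F_inverse(1) F_divide by blast
qed

lemma tt_deriv_nz: "fls_deriv tt \<noteq> 0"
proof -
  have "fls_deriv yy \<noteq> 0"
  proof
    assume "fls_deriv yy = 0"
    hence "fls_nth (fls_deriv yy) 0 = 0" by simp
    hence "fls_nth yy (val yy) = 0" by (simp add: yy_subdegree)
    thus False using nth_fls_subdegree_nonzero[OF yy_nz] by blast
  qed
  thus ?thesis using rel_deriv[OF tt_rel] by simp
qed

text \<open>As \<open>F = F^2 + F^2 t\<close>, the Cartier operator sends \<open>(a^2 + b^2 t) dt\<close> to \<open>b dt\<close>.\<close>

definition cop :: "L \<Rightarrow> L" where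
  "cop f = (THE b. b \<in> F \<and> (\<exists>a\<in>F. f = a ^ 2 + b ^ 2 * tt))"

text \<open>Differentiation kills \<open>a^2\<close> and leaves \<open>b^2\<close> times the nonzero
  derivative of \<open>tt\<close>, so \<open>b\<close> is unique.\<close>

lemma cop_eq:
  assumes "a \<in> F" "b \<in> F"
  shows "cop (a ^ 2 + b ^ 2 * tt) = b"
  unfolding cop_def
proof (rule the_equality)
  fix b' assume "b' \<in> F \<and> (\<exists>a'\<in>F. a ^ 2 + b ^ 2 * tt = a' ^ 2 + b' ^ 2 * tt)"
  then obtain a' where "a ^ 2 + b ^ 2 * tt = a' ^ 2 + b' ^ 2 * tt" by blast
  hence "fls_deriv (a ^ 2 + b ^ 2 * tt) = fls_deriv (a' ^ 2 + b' ^ 2 * tt)" by simp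
  hence "b ^ 2 * fls_deriv tt = b' ^ 2 * fls_deriv tt" by (simp add: L_deriv_square)
  thus "b' = b" using tt_deriv_nz L_square_inj by auto
qed (use assms in blast)

lemma cop_decomp:
  assumes "f \<in> F"
  obtains a b where "a \<in> F" "b \<in> F" "f = a ^ 2 + b ^ 2 * tt" "cop f = b"
  using F_decomp[OF assms] cop_eq by metis

lemma cop_F [simp]: "f \<in> F \<Longrightarrow> cop f \<in> F"
  by (metis cop_decomp)

lemma cop_0 [simp]: "cop 0 = 0"
  using cop_eq[of 0 0] by simp

lemma cop_add: "f \<in> F \<Longrightarrow> g \<in> F \<Longrightarrow> cop (f + g) = cop f + cop g"
proof -
  assume "f \<in> F" "g \<in> F"
  then obtain a b c d where *: "a \<in> F" "b \<in> F" "f = a ^ 2 + b ^ 2 * tt" "c \<in> F" "d \<in> F"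
    "g = c ^ 2 + d ^ 2 * tt" "cop f = b" "cop g = d" by (metis cop_decomp)
  have "f + g = (a + c) ^ 2 + (b + d) ^ 2 * tt" using * by (simp add: L_square_add algebra_simps)
  thus ?thesis using * cop_eq[of "a + c" "b + d"] by simp
qed

lemma cop_square_mult: "u \<in> F \<Longrightarrow> f \<in> F \<Longrightarrow> cop (u ^ 2 * f) = u * cop f"
proof -
  assume u: "u \<in> F" and "f \<in> F"
  then obtain a b where *: "a \<in> F" "b \<in> F" "f = a ^ 2 + b ^ 2 * tt" "cop f = b" by (metis cop_decomp)
  have "u ^ 2 * f = (u * a) ^ 2 + (u * b) ^ 2 * tt" using * by (simp add: power_mult_distrib algebra_simps)
  thus ?thesis using * u cop_eq[of "u * a" "u * b"] by simp
qed

lemma cop_tt_mult: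
  assumes "a \<in> F" "b \<in> F"
  shows "cop (tt * (a ^ 2 + b ^ 2 * tt)) = a"
proof -
  have "tt * (a ^ 2 + b ^ 2 * tt) = (b * tt) ^ 2 + a ^ 2 * tt"
    by (simp add: power_mult_distrib algebra_simps power2_eq_square)
  thus ?thesis using cop_eq[of "b * tt" a] assms by simp
qed

abbreviation copn :: "nat \<Rightarrow> L \<Rightarrow> L" where "copn k \<equiv> cop ^^ k"

lemma copn_F [simp]: "f \<in> F \<Longrightarrow> copn k f \<in> F"
  by (induction k) auto

lemma copn_0 [simp]: "copn k 0 = 0"
  by (induction k) auto

lemma copn_add: "f \<in> F \<Longrightarrow> g \<in> F \<Longrightarrow> copn k (f + g) = copn k f + copn k g"
  by (induction k) (auto simp: cop_add)

lemma copn_sum: "(\<And>i. i \<in> A \<Longrightarrow> f i \<in> F) \<Longrightarrow> copn k (sum f A) = (\<Sum>i\<in>A. copn k (f i))"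
  by (induction A rule: infinite_finite_induct) (auto simp: copn_add F_sum)

lemma copn_power_mult: "u \<in> F \<Longrightarrow> f \<in> F \<Longrightarrow> copn k (u ^ (2 ^ k) * f) = u * copn k f"
proof (induction k arbitrary: f)
  case (Suc k)
  have "copn (Suc k) (u ^ (2 ^ Suc k) * f) = copn k (cop ((u ^ (2 ^ k)) ^ 2 * f))"
    by (simp add: funpow_Suc_right power_mult[symmetric] mult.commute del: funpow.simps)
  also have "\<dots> = copn k (u ^ (2 ^ k) * cop f)" using Suc.prems by (simp add: cop_square_mult)
  also have "\<dots> = u * copn k (cop f)" using Suc by simp
  finally show ?case by (simp add: funpow_Suc_right del: funpow.simps)
qed simp

lemma copn_q_mult: "u \<in> F \<Longrightarrow> f \<in> F \<Longrightarrow> copn n (u ^ q * f) = u * copn n f"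
proof -
  assume "u \<in> F" "f \<in> F"
  moreover have "u ^ q * f = u ^ (2 ^ n) * f" by (simp only: q_def)
  ultimately show ?thesis using copn_power_mult[of u f n] by metis
qed

lemma K_q_root: "\<exists>e::K. e ^ q = c"
  using nth_root_exists[of q c] q_ge by simp

lemma copn_const_mult:
  assumes "f \<in> F" "copn n f = 0"
  shows "copn n (cst c * f) = 0"
proof -
  obtain e where "e ^ q = c" using K_q_root by blast
  thus ?thesis using copn_q_mult[of "cst e" f] assms by (simp add: fls_const_power[symmetric])
qed

lemma cop_linear_power: "cop ((tt + cst e) ^ i) = (if even i then 0 else (tt + cst e) ^ (i div 2))"
proof (cases "even i")
  case True
  then obtain j where j: "i = 2 * j" by (auto elim: evenE)
  show ?thesis using cop_eq[of "(tt + cst e) ^ j" 0] by (simp add: j power_mult[symmetric] mult.commute)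
next
  case False
  then obtain j where j: "i = 2 * j + 1" by (auto elim: oddE)
  obtain d where d: "d ^ 2 = e" using nth_root_exists[of 2 e] by auto
  let ?s = "tt + cst e"
  have "?s ^ i = (?s ^ j) ^ 2 * ?s" by (simp add: j power_mult[symmetric] mult.commute)
  also have "\<dots> = (?s ^ j * cst d) ^ 2 + (?s ^ j) ^ 2 * tt"
    by (simp add: d[symmetric] algebra_simps power_mult_distrib fls_const_power)
  finally show ?thesis using cop_eq[of "?s ^ j * cst d" "?s ^ j"] by (simp add: j)
qed

text \<open>One step kills even exponents and sends an odd \<open>i\<close> to
  \<open>(i - 1) / 2\<close>; only an exponent whose \<open>k\<close> binary digits are all 1
  survives.\<close>

lemma copn_linear_power:
  "i < 2 ^ k \<Longrightarrow> copn k ((tt + cst e) ^ i) = (if i = 2 ^ k - 1 then 1 else 0)"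
proof (induction k arbitrary: i)
  case (Suc k)
  have eq: "copn (Suc k) ((tt + cst e) ^ i) = copn k (cop ((tt + cst e) ^ i))"
    by (simp add: funpow_Suc_right del: funpow.simps)
  show ?case
  proof (cases "even i")
    case True
    hence "i \<noteq> 2 ^ Suc k - 1" by auto
    thus ?thesis unfolding eq by (simp add: cop_linear_power True)
  next
    case False
    then obtain j where j: "i = 2 * j + 1" by (auto elim: oddE)
    hence "j < 2 ^ k" "(i = 2 ^ Suc k - 1) = (j = 2 ^ k - 1)" using Suc.prems by auto
    moreover have "cop ((tt + cst e) ^ i) = (tt + cst e) ^ j"
      unfolding cop_linear_power using False j by simp
    ultimately show ?thesis unfolding eq using Suc.IH[of j] by simp
  qed
qed simp

text \<open>The two coefficients of \<open>f = a^2 + b^2 t\<close> are \<open>cop (t f)\<close> and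
  \<open>cop f\<close>. By induction both vanish, since the even and the odd exponents
  \<open>2 i + e\<close> supply all moments of each.\<close>

lemma copn_nondegenerate:
  assumes "f \<in> F" "\<And>i. i < 2 ^ k \<Longrightarrow> copn k (tt ^ i * f) = 0"
  shows "f = 0"
  using assms
proof (induction k arbitrary: f)
  case 0
  show ?case using 0(2)[of 0] by simp
next
  case (Suc k)
  have *: "cop (tt ^ e * f) = 0" if "e < 2" for e
  proof (rule Suc.IH)
    fix i :: nat assume "i < 2 ^ k"
    hence "2 * i + e < 2 ^ Suc k" using that by simp
    hence "copn (Suc k) (tt ^ (2 * i + e) * f) = 0" by (rule Suc.prems)
    hence "copn k (cop ((tt ^ i) ^ 2 * (tt ^ e * f))) = 0"
      by (simp add: funpow_Suc_right power_add power_mult[symmetric] mult_ac del: funpow.simps)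
    thus "copn k (tt ^ i * cop (tt ^ e * f)) = 0" using Suc.prems(1) by (simp add: cop_square_mult)
  qed (use Suc.prems in auto)
  obtain a b where ab: "a \<in> F" "b \<in> F" "f = a ^ 2 + b ^ 2 * tt" "cop f = b"
    using cop_decomp[OF Suc.prems(1)] .
  have "b = 0" using *[of 0] ab(4) by simp
  moreover have "a = 0" using *[of 1] cop_tt_mult[OF ab(1,2)] ab(3) by simp
  ultimately show ?case using ab(3) by simp
qed

section \<open>Automorphisms acting on differentials\<close>

definition aut :: "(L \<Rightarrow> L) \<Rightarrow> bool" where
  "aut s \<longleftrightarrow> hom s \<and> s ` F = F"

lemma aut_hom: "aut s \<Longrightarrow> hom s"
  by (simp add: aut_def)

lemma aut_F: "aut s \<Longrightarrow> f \<in> F \<Longrightarrow> s f \<in> F"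
  by (auto simp: aut_def)

lemma hom_aut: "hom E \<Longrightarrow> aut s \<Longrightarrow> hom (\<lambda>f. E (s f))"
  unfolding hom_def[of "\<lambda>f. E (s f)"]
  by (simp add: aut_hom hom_const hom_add hom_mult aut_F)

lemma aut_inverse:
  assumes "aut s"
  obtains u where "aut u" "\<And>f. f \<in> F \<Longrightarrow> u (s f) = f" "\<And>f. f \<in> F \<Longrightarrow> s (u f) = f"
proof
  let ?u = "inv_into F s"
  have inj: "inj_on s F" using hom_inj[OF aut_hom[OF assms]] by (auto intro: inj_onI)
  have im: "s ` F = F" using assms by (simp add: aut_def)
  show us: "?u (s f) = f" if "f \<in> F" for f using inv_into_f_f[OF inj that] .
  show su: "s (?u f) = f" if "f \<in> F" for f using f_inv_into_f[of f s F] that im by simp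
  have uF: "?u f \<in> F" if "f \<in> F" for f using inv_into_into[of f s F] that im by simp
  have "hom ?u" unfolding hom_def
  proof (intro conjI allI ballI)
    fix c show "?u (cst c) = cst c"
      using us[of "cst c"] hom_const[OF aut_hom[OF assms]] by simp
  next
    fix a b assume ab: "a \<in> F" "b \<in> F"
    show "?u (a + b) = ?u a + ?u b"
      using us[of "?u a + ?u b"] hom_add[OF aut_hom[OF assms], of "?u a" "?u b"] ab by (simp add: uF su)
    show "?u (a * b) = ?u a * ?u b"
      using us[of "?u a * ?u b"] hom_mult[OF aut_hom[OF assms], of "?u a" "?u b"] ab by (simp add: uF su)
  qed
  moreover have "?u ` F = F" using us uF aut_F[OF assms] by (metis image_subsetI rev_image_eqI subsetI subset_antisym)
  ultimately show "aut ?u" by (simp add: aut_def)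
qed

text \<open>An element \<open>f\<close> of \<open>Om\<close> stands for the holomorphic differential \<open>f dt\<close>. Regularity is required
  after every embedding into Laurent series, which makes invariance under automorphisms immediate.\<close>

definition Om :: "L set" where
  "Om = {f \<in> F. \<forall>E. hom E \<longrightarrow> vge 0 (E f * fls_deriv (E tt))}"

definition NN :: "L set" where
  "NN = {g \<in> F. \<forall>f\<in>Om. copn n (g * f) = 0}"

lemma hom_deriv:
  assumes "hom E" "f \<in> F"
  shows "fls_deriv (E f) = E (cop f) ^ 2 * fls_deriv (E tt)"
proof -
  obtain a b where ab: "a \<in> F" "b \<in> F" "f = a ^ 2 + b ^ 2 * tt" "cop f = b" using cop_decomp[OF assms(2)] .
  have "E f = E a ^ 2 + E b ^ 2 * E tt" using ab by (simp add: hom_add[OF assms(1)] hom_mult[OF assms(1)] hom_power[OF assms(1)])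
  thus ?thesis by (simp add: L_deriv_square ab(4))
qed

text \<open>Here \<open>cop (s t)^2\<close> is the derivative of \<open>s t\<close> with respect to \<open>t\<close>.\<close>

lemma Om_aut:
  assumes "aut s" "f \<in> Om"
  shows "cop (s tt) ^ 2 * s f \<in> Om"
  unfolding Om_def
proof (intro CollectI conjI allI impI)
  have f: "f \<in> F" using assms(2) by (simp add: Om_def)
  show "cop (s tt) ^ 2 * s f \<in> F" using assms(1) f by (simp add: aut_F)
  fix E assume E: "hom E"
  have "vge 0 (E (s f) * fls_deriv (E (s tt)))"
    using assms(2) hom_aut[OF E assms(1)] unfolding Om_def by blast
  also have "fls_deriv (E (s tt)) = E (cop (s tt)) ^ 2 * fls_deriv (E tt)"
    by (rule hom_deriv[OF E]) (simp add: aut_F[OF assms(1)])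
  finally show "vge 0 (E (cop (s tt) ^ 2 * s f) * fls_deriv (E tt))"
    using assms(1) f by (simp add: hom_mult[OF E] hom_power[OF E] aut_F mult_ac)
qed

text \<open>The pullback of \<open>f dt\<close> is \<open>cop (s tt) ^ 2 * s f dt\<close>, so this
  says that pullback commutes with the Cartier operator. With \<open>s t = a'^2 + b'^2 t\<close>,
  the \<open>t\<close>-coefficient of \<open>s f\<close> is \<open>s b * b'\<close>.\<close>

lemma cop_aut:
  assumes "aut s" "f \<in> F"
  shows "cop (cop (s tt) ^ 2 * s f) = cop (s tt) ^ 2 * s (cop f)"
proof -
  obtain a b where ab: "a \<in> F" "b \<in> F" "f = a ^ 2 + b ^ 2 * tt" "cop f = b" using cop_decomp[OF assms(2)] .
  have sF: "s tt \<in> F" using aut_F[OF assms(1)] by simp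
  obtain a' b' where ab': "a' \<in> F" "b' \<in> F" "s tt = a' ^ 2 + b' ^ 2 * tt" "cop (s tt) = b'" using cop_decomp[OF sF] .
  note h = aut_hom[OF assms(1)]
  have "s f = s a ^ 2 + s b ^ 2 * s tt"
    using ab by (simp add: hom_add[OF h] hom_mult[OF h] hom_power[OF h])
  also have "\<dots> = (s a + s b * a') ^ 2 + (s b * b') ^ 2 * tt"
    by (simp add: ab'(3) L_square_add power_mult_distrib algebra_simps)
  finally have "cop (s f) = s b * b'"
    using cop_eq[of "s a + s b * a'" "s b * b'"] ab ab' aut_F[OF assms(1)] by simp
  moreover have "cop (b' ^ 2 * s f) = b' * cop (s f)"
    by (rule cop_square_mult[OF ab'(2) aut_F[OF assms]])
  ultimately show ?thesis by (simp only: ab'(4) ab(4) power2_eq_square mult_ac)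
qed

lemma copn_aut:
  assumes "aut s" "f \<in> F"
  shows "copn k (cop (s tt) ^ 2 * s f) = cop (s tt) ^ 2 * s (copn k f)"
  by (induction k) (simp_all add: cop_aut[OF assms(1)] assms(2))

text \<open>The condition for \<open>s g\<close> at the form \<open>f dt\<close> is moved by the
  inverse automorphism \<open>u\<close> to the condition for \<open>g\<close> at the pullback of
  \<open>f dt\<close>, which is again holomorphic.\<close>

lemma NN_aut:
  assumes "aut s" "g \<in> NN"
  shows "s g \<in> NN"
  unfolding NN_def
proof (intro CollectI conjI ballI)
  have g: "g \<in> F" using assms(2) by (simp add: NN_def)
  show "s g \<in> F" by (rule aut_F[OF assms(1) g])
  obtain u where u: "aut u" "\<And>f. f \<in> F \<Longrightarrow> u (s f) = f" "\<And>f. f \<in> F \<Longrightarrow> s (u f) = f"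
    using aut_inverse[OF assms(1)] by metis
  let ?h = "cop (u tt) ^ 2"
  have "?h \<noteq> 0"
  proof
    assume "?h = 0"
    hence h0: "cop (u tt) = 0" by simp
    obtain a b where ab: "a \<in> F" "b \<in> F" "u tt = a ^ 2 + b ^ 2 * tt" "cop (u tt) = b"
      using cop_decomp[OF aut_F[OF u(1) F_tt]] .
    hence a: "a \<in> F" "u tt = a ^ 2" using h0 by simp_all
    hence "tt = s a ^ 2" using u(3)[of tt] hom_power[OF aut_hom[OF assms(1)]] by simp
    hence "fls_deriv tt = 0" by (simp add: L_deriv_square)
    thus False using tt_deriv_nz by simp
  qed
  fix f assume f: "f \<in> Om"
  have fF: "f \<in> F" using f by (simp add: Om_def)
  have "?h * u (copn n (s g * f)) = copn n (?h * u (s g * f))"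
    using copn_aut[OF u(1), of "s g * f"] fF aut_F[OF assms(1) g] by simp
  also have "?h * u (s g * f) = g * (?h * u f)"
    using fF g aut_F[OF assms(1) g] by (simp add: hom_mult[OF aut_hom[OF u(1)]] u(2))
  also have "copn n \<dots> = 0" using assms(2) Om_aut[OF u(1) f] by (simp add: NN_def)
  finally have "u (copn n (s g * f)) = 0" using \<open>?h \<noteq> 0\<close> by simp
  thus "copn n (s g * f) = 0"
    using hom_eq_0_iff[OF aut_hom[OF u(1)], of "copn n (s g * f)"] fF aut_F[OF assms(1) g] by simp
qed

section \<open>Explicit differentials and the space annihilating them\<close>

lemma xx_ne_const: "xx \<noteq> cst c"
  using xx_nonconst by (auto simp: nonconst_def)

lemma tt_nonconst: "tt \<noteq> cst c"
  using tt_deriv_nz by (metis fls_deriv_const)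

lemma tt1_nz [simp]: "tt + 1 \<noteq> 0" "1 + tt \<noteq> 0"
  using tt_nonconst[of 1] L_eq_iff[of tt 1] by (auto simp: add.commute)

lemma hom_nz: "hom E \<Longrightarrow> f \<in> F \<Longrightarrow> f \<noteq> 0 \<Longrightarrow> E f \<noteq> 0"
  by (simp add: hom_eq_0_iff)

text \<open>The orders follow from \<open>y^(q+1) = t (t + 1)\<close> and
  \<open>x^(q+1) = t^3\<close>. The factor \<open>\<kappa>\<close> is present because an embedding
  may be a completion followed by a substitution such as \<open>X\<close> to
  \<open>X^\<kappa>\<close>; it becomes 1 in \<open>prim_cases\<close>.\<close>

lemma hom_cases:
  assumes "hom E"
  obtains (zero) \<kappa> where "\<kappa> > 0" "val (E tt) = int (q + 1) * \<kappa>"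
      "val (E yy) = \<kappa>" "val (E xx) = 3 * \<kappa>" "val (E tt + 1) = 0"
  | (one) \<kappa> where "\<kappa> > 0" "val (E tt + 1) = int (q + 1) * \<kappa>"
      "val (E yy) = \<kappa>" "val (E xx) = 0" "val (E tt) = 0"
  | (unit) "val (E tt) = 0" "val (E tt + 1) = 0"
      "val (E yy) = 0" "val (E xx) = 0"
  | (infinity) \<kappa> where "\<kappa> > 0" "val (E tt) = - (int (q + 1) * \<kappa>)"
      "val (E yy) = - (2 * \<kappa>)" "val (E xx) = - (3 * \<kappa>)"
      "val (E tt + 1) = - (int (q + 1) * \<kappa>)"
proof -
  let ?T = "E tt" and ?u = "E xx" and ?v = "E yy"
  have T1: "?T + 1 = E (tt + 1)" using assms by (simp add: hom_add hom_1)
  have nz: "?T \<noteq> 0" "?T + 1 \<noteq> 0" "?u \<noteq> 0" "?v \<noteq> 0"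
    unfolding T1 using assms by (simp_all add: hom_nz)
  have "?v ^ (q + 1) = ?T * (?T + 1)" using hom_tt_rel[OF assms] by (simp add: power2_eq_square algebra_simps)
  hence v: "int (q + 1) * val ?v = val ?T + val (?T + 1)"
    using nz fls_subdegree_pow[of ?v "q + 1"] by (simp del: power_Suc)
  have u: "int (q + 1) * val ?u = 3 * val ?T"
    using hom_xx_tt[OF assms] fls_subdegree_pow[of ?u "q + 1"] fls_subdegree_pow[of ?T 3]
    by (simp del: power_Suc)
  define N where "N = int (q + 1)"
  have N: "N > 0" by (simp add: N_def)
  note v = v[folded N_def] and u = u[folded N_def]
  consider "val ?T > 0" | "val ?T = 0" | "val ?T < 0" by linarith
  thus ?thesis
  proof cases
    case 1
    have "val (?T + 1) = 0" using fls_subdegree_add_eq2[of 1 ?T] 1 by simp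
    moreover from this v have T: "val ?T = N * val ?v" by simp
    moreover from this 1 N have "val ?v > 0" by (simp add: zero_less_mult_iff)
    moreover from T u N have "N * val ?u = N * (3 * val ?v)" by simp
    hence "val ?u = 3 * val ?v" using N by simp
    ultimately show ?thesis using zero[of "val ?v"] by (simp add: N_def)
  next
    case 2
    have u0: "val ?u = 0" using u 2 N by simp
    have "vge 0 (?T + 1)" using 2 by (intro vge_add) (auto simp: vge_iff)
    hence "val (?T + 1) \<ge> 0" using nz by (simp add: vge_nz)
    moreover have T1: "val (?T + 1) = N * val ?v" using v 2 by simp
    ultimately have "val ?v \<ge> 0" using N by (simp add: zero_le_mult_iff)
    then consider "val ?v > 0" | "val ?v = 0" by linarith
    thus ?thesis
    proof cases
      case 1 thus ?thesis using one[of "val ?v"] u0 2 T1 by (simp add: N_def)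
    next
      case 2 thus ?thesis using unit u0 \<open>val ?T = 0\<close> T1 by simp
    qed
  next
    case 3
    have T1: "val (?T + 1) = val ?T"
      using fls_subdegree_add_eq1[of ?T 1] 3 nz by simp
    \<comment> \<open>Over \<open>t = \<infinity>\<close> the natural parameter is
      \<open>y/x\<close>, since \<open>(y/x)^(q+1) = 1/t + 1/t^2\<close>.\<close>
    define \<kappa> where "\<kappa> = val ?v - val ?u"
    have T: "val ?T = - (N * \<kappa>)" unfolding \<kappa>_def using u v T1 by (simp add: algebra_simps)
    with 3 N have "\<kappa> > 0" by (simp add: zero_less_mult_iff)
    moreover have "N * val ?u = N * (- (3 * \<kappa>))" using u T by simp
    hence "val ?u = - (3 * \<kappa>)" using N by (simp only: mult_cancel_left) simp
    moreover have "N * val ?v = N * (- (2 * \<kappa>))" using v T T1 by simp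
    hence "val ?v = - (2 * \<kappa>)" using N by (simp only: mult_cancel_left) simp
    ultimately show ?thesis using infinity[of \<kappa>] T T1 by (simp add: N_def)
  qed
qed

text \<open>The pair \<open>1/T\<close>, \<open>v/u\<close> satisfies the equation of
  \<open>rel_deriv\<close>, and \<open>dT = T^2 d(1/T)\<close> in characteristic 2. This expresses
  \<open>dt\<close> near infinity by the parameter \<open>y/x\<close>.\<close>

lemma rel_deriv_inverse:
  fixes T u v :: L
  assumes "v ^ (q + 1) = T ^ 2 + T" "u ^ (q + 1) = T ^ 3" "T \<noteq> 0"
  shows "fls_deriv T = T ^ 2 * (v / u) ^ q * fls_deriv (v / u)"
proof -
  have "(v / u) ^ (q + 1) = inverse T ^ 2 + inverse T"
    unfolding power_divide assms(1,2) using assms(3)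
    by (simp add: field_simps power2_eq_square power3_eq_cube)
  hence "fls_deriv (inverse T) = (v / u) ^ q * fls_deriv (v / u)" by (rule rel_deriv)
  moreover have "fls_deriv (T * inverse T) = 0" using assms(3) by simp
  hence "fls_deriv T * inverse T = T * fls_deriv (inverse T)"
    by (simp only: fls_deriv_mult) (metis L_eq_iff mult.commute)
  hence "fls_deriv T = T ^ 2 * fls_deriv (inverse T)" using assms(3) by (simp add: field_simps power2_eq_square)
  ultimately show ?thesis by (simp add: mult.assoc)
qed

lemma vge_subdegree_mult:
  fixes f g :: L
  assumes "val f \<ge> 0" "vge 0 g"
  shows "vge 0 (f * g)"
  by (rule vge_mult0) (use assms in \<open>auto simp: vge_iff\<close>)

text \<open>Since \<open>m\<close> is odd, \<open>dt / t = dx / x\<close>; thus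
  \<open>dform A k dt\<close> is the monomial differential \<open>x^A dx / y^(k+2)\<close>.\<close>

definition dform :: "nat \<Rightarrow> nat \<Rightarrow> L" where
  "dform A k = xx ^ (A + 1) / (yy ^ (k + 2) * tt)"

lemma dform_F [simp]: "dform A k \<in> F"
  by (simp add: dform_def del: power_Suc)

text \<open>The hypotheses express regularity over \<open>t = 1\<close>, \<open>t = 0\<close> and
  \<open>t = \<infinity>\<close>, in this order; over other values \<open>x\<close>,
  \<open>y\<close> and \<open>t\<close> are units.\<close>

lemma dform_Om:
  assumes "k \<le> q - 2" "k \<le> 3 * A" "3 * A \<le> 2 * k"
  shows "dform A k \<in> Om"
  unfolding Om_def
proof (intro CollectI conjI allI impI)
  fix E assume E: "hom E"
  let ?T = "E tt" and ?u = "E xx" and ?v = "E yy"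
  have nz: "?T \<noteq> 0" "?u \<noteq> 0" "?v \<noteq> 0" using E by (simp_all add: hom_nz)
  have kq: "int k \<le> int q - 2" using assms(1) q_ge by linarith
  have kA: "int k \<le> 3 * int A" "3 * int A \<le> 2 * int k" using assms(2,3) by linarith+
  have m: "E (dform A k) = ?u ^ (A + 1) / (?v ^ (k + 2) * ?T)"
    unfolding dform_def by (simp only: hom_divide[OF E] hom_mult[OF E] hom_power[OF E] F_power F_mult F_xx F_yy F_tt)
  have sd: "val (E (dform A k)) =
      (int A + 1) * val ?u - (int k + 2) * val ?v - val ?T"
    "E (dform A k) \<noteq> 0"
    unfolding m using nz by (simp_all add: fls_divide_subdegree fls_subdegree_pow algebra_simps del: power_Suc)
  have d1: "fls_deriv ?T = ?v ^ q * fls_deriv ?v" by (rule rel_deriv[OF hom_tt_rel[OF E]])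
  from E show "vge 0 (E (dform A k) * fls_deriv ?T)"
  proof (cases rule: hom_cases)
    case (zero \<kappa>)
    have "val (E (dform A k) * ?v ^ q) = \<kappa> * (3 * int A - int k)"
      using sd nz zero by (simp add: fls_subdegree_pow algebra_simps)
    hence "vge 0 (E (dform A k) * ?v ^ q * fls_deriv ?v)"
      using zero kA by (intro vge_subdegree_mult vge_deriv) (auto simp: vge_iff)
    thus ?thesis by (simp add: d1 mult.assoc)
  next
    case (one \<kappa>)
    have "val (E (dform A k) * ?v ^ q) = \<kappa> * (int q - 2 - int k)"
      using sd nz one by (simp add: fls_subdegree_pow algebra_simps)
    hence "vge 0 (E (dform A k) * ?v ^ q * fls_deriv ?v)"
      using one kq by (intro vge_subdegree_mult vge_deriv) (auto simp: vge_iff)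
    thus ?thesis by (simp add: d1 mult.assoc)
  next
    case unit
    thus ?thesis using sd by (intro vge_subdegree_mult vge_deriv) (auto simp: vge_iff)
  next
    case (infinity \<kappa>)
    have "val (E (dform A k) * ?T ^ 2 * (?v / ?u) ^ q) = \<kappa> * (2 * int k - 3 * int A)"
      using sd nz infinity by (simp add: fls_subdegree_pow fls_divide_subdegree algebra_simps)
    hence "vge 0 (E (dform A k) * ?T ^ 2 * (?v / ?u) ^ q * fls_deriv (?v / ?u))"
      using infinity kA nz by (intro vge_subdegree_mult vge_deriv) (auto simp: vge_iff fls_divide_subdegree)
    thus ?thesis by (simp only: rel_deriv_inverse[OF hom_tt_rel[OF E] hom_xx_tt[OF E] nz(1)] mult.assoc)
  qed
qed simp

text \<open>Modulo q-th powers, \<open>y^(q+1) = t (1 + t)\<close> and \<open>x^(q+1) = t^3\<close>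
  turn the form into powers of \<open>t\<close> and \<open>1 + t\<close>: the exponent of
  \<open>t\<close> is \<open>3 (A + 1) - (k + 2) - 1 = a\<close>, that of \<open>1 + t\<close> is
  \<open>-(k + 2)\<close>, congruent to \<open>b\<close> modulo \<open>q\<close>.\<close>

lemma dform_eq:
  assumes "k + b + 2 = q" "a + k = 3 * A"
  shows "dform A k = (yy ^ (k + 2) / (xx ^ (A + 1) * (1 + tt))) ^ q * (tt ^ a * (1 + tt) ^ b)"
proof -
  have y: "(yy ^ (k + 2)) ^ q * yy ^ (k + 2) = tt ^ (k + 2) * (1 + tt) ^ (k + 2)"
  proof -
    have "(yy ^ (k + 2)) ^ q * yy ^ (k + 2) = (yy ^ (q + 1)) ^ (k + 2)"
      by (simp only: power_mult[symmetric] power_add[symmetric]) (simp add: algebra_simps del: power_Suc)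
    also have "yy ^ (q + 1) = tt * (1 + tt)" unfolding tt_rel by (simp add: power2_eq_square algebra_simps)
    finally show ?thesis by (simp only: power_mult_distrib)
  qed
  have x: "(xx ^ (A + 1)) ^ q * xx ^ (A + 1) = tt ^ (3 * (A + 1))"
  proof -
    have "(xx ^ (A + 1)) ^ q * xx ^ (A + 1) = (xx ^ (q + 1)) ^ (A + 1)"
      by (simp only: power_mult[symmetric] power_add[symmetric]) (simp add: algebra_simps del: power_Suc)
    thus ?thesis by (simp only: xx_tt power_mult[symmetric])
  qed
  have t: "tt ^ (k + 2) * tt ^ a * tt = tt ^ (3 * (A + 1))" "(1 + tt) ^ (k + 2) * (1 + tt) ^ b = (1 + tt) ^ q"
  proof -
    have e: "k + 2 + a + 1 = 3 * (A + 1)" "k + 2 + b = q" using assms by simp_all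
    show "tt ^ (k + 2) * tt ^ a * tt = tt ^ (3 * (A + 1))"
      unfolding e(1)[symmetric] by (simp only: power_add power_one_right)
    show "(1 + tt) ^ (k + 2) * (1 + tt) ^ b = (1 + tt) ^ q" using e(2) power_add by metis
  qed
  let ?Y = "yy ^ (k + 2)" and ?X = "xx ^ (A + 1)"
  have nz: "?Y \<noteq> 0" "?X \<noteq> 0" "?X ^ q \<noteq> 0" "(1 + tt) ^ q \<noteq> 0" by simp_all
  have "?X * (?X ^ q * (1 + tt) ^ q) = ?Y ^ q * (tt ^ a * (1 + tt) ^ b) * (?Y * tt)"
  proof -
    have "?Y ^ q * (tt ^ a * (1 + tt) ^ b) * (?Y * tt) =
        (?Y ^ q * ?Y) * (tt ^ a * tt * (1 + tt) ^ b)" by (simp only: mult_ac)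
    also have "\<dots> = (tt ^ (k + 2) * tt ^ a * tt) * ((1 + tt) ^ (k + 2) * (1 + tt) ^ b)"
      unfolding y by (simp only: mult_ac)
    also have "\<dots> = (?X ^ q * ?X) * (1 + tt) ^ q" unfolding t x ..
    finally show ?thesis by (simp only: mult_ac)
  qed
  hence "?X / (?Y * tt) = ?Y ^ q * (tt ^ a * (1 + tt) ^ b) / (?X ^ q * (1 + tt) ^ q)"
    using nz by (subst frac_eq_eq) (simp_all del: power_Suc)
  thus ?thesis by (simp only: dform_def power_divide power_mult_distrib times_divide_eq_left)
qed

text \<open>\<open>QQ\<close> tests membership in \<open>NN\<close> on the explicit differentials only; both conditions turn out to be
  equivalent.\<close>

definition QQ :: "L \<Rightarrow> bool" where
  "QQ g \<longleftrightarrow> g \<in> F \<and> (\<forall>a b. a + b + 2 \<le> q \<longrightarrow> a mod 3 = b mod 3 \<longrightarrow> copn n (g * (tt ^ a * (1 + tt) ^ b)) = 0)"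

lemma dform_params:
  assumes "k + b + 2 = q" "a + k = 3 * A"
  shows "a mod 3 = b mod 3"
proof -
  have "a + 3 * m = b + 3 * (A + 1)" using assms q1 by simp
  thus ?thesis by (metis mod_mult_self2)
qed

lemma copn_dform:
  assumes "k + b + 2 = q" "a + k = 3 * A" "g \<in> F"
  shows "copn n (g * dform A k) =
    yy ^ (k + 2) / (xx ^ (A + 1) * (1 + tt)) * copn n (g * (tt ^ a * (1 + tt) ^ b))"
proof -
  have "g * dform A k = (yy ^ (k + 2) / (xx ^ (A + 1) * (1 + tt))) ^ q * (g * (tt ^ a * (1 + tt) ^ b))"
    by (simp only: dform_eq[OF assms(1,2)] mult_ac)
  also have "copn n \<dots> = yy ^ (k + 2) / (xx ^ (A + 1) * (1 + tt)) * copn n (g * (tt ^ a * (1 + tt) ^ b))"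
    by (rule copn_q_mult) (use assms(3) in \<open>simp_all del: power_Suc\<close>)
  finally show ?thesis .
qed

lemma NN_imp_QQ: "g \<in> NN \<Longrightarrow> QQ g"
  unfolding QQ_def
proof (intro conjI allI impI)
  assume g: "g \<in> NN"
  thus gF: "g \<in> F" by (simp add: NN_def)
  fix a b :: nat assume ab: "a + b + 2 \<le> q" "a mod 3 = b mod 3"
  \<comment> \<open>The values of \<open>k\<close> and \<open>A\<close> are forced by
    \<open>dform_eq\<close>; \<open>3\<close> divides \<open>a + k\<close> because
    \<open>q \<equiv> 2 (mod 3)\<close>.\<close>
  define k where "k = q - 2 - b"
  have k: "k + b + 2 = q" using ab by (simp add: k_def)
  have "3 dvd a + k" using ab k q1 by presburger
  then obtain A where A: "a + k = 3 * A" by (auto elim: dvdE)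
  have "dform A k \<in> Om" by (rule dform_Om) (use ab k A in linarith)+
  hence "copn n (g * dform A k) = 0" using g by (simp add: NN_def)
  thus "copn n (g * (tt ^ a * (1 + tt) ^ b)) = 0"
    unfolding copn_dform[OF k A gF] by (simp del: power_Suc)
qed

section \<open>Evaluation at a constant as a value of \<open>C^n\<close>, and the space dual to the
  differentials\<close>

lemma pe_pcompose: "pe (pcompose p r) u = pe p (pe r u)"
  by (induction p) (simp_all add: pcompose_pCons pe_add pe_mult)

lemma pe_F_tt [simp]: "pe p tt \<in> F"
  by (rule F_pe) simp

lemma copn_linear_power_q:
  "i < q \<Longrightarrow> copn n ((tt + cst e) ^ i) = (if i = q - 1 then 1 else 0)"
proof -
  assume "i < q"
  hence "i < 2 ^ n" "(i = 2 ^ n - 1) = (i = q - 1)" by (simp_all only: q_def)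
  thus ?thesis using copn_linear_power[of i n e] by simp
qed

lemma poly_shift_expand:
  assumes "degree p < d"
  obtains c where "pe p tt = (\<Sum>i<d. cst (c i) * (tt + cst e) ^ i)" "c 0 = poly p e"
proof
  let ?r = "pcompose p [:e, 1:]"
  have "pe p tt = pe ?r (tt + cst e)"
    by (simp add: pe_pcompose add.commute)
  also have "?r = (\<Sum>i\<le>degree ?r. monom (coeff ?r i) i)" by (simp add: poly_as_sum_of_monoms)
  also have "\<dots> = (\<Sum>i<d. monom (coeff ?r i) i)"
    by (rule sum.mono_neutral_left) (use assms in \<open>auto simp: degree_pcompose coeff_eq_0\<close>)
  also have "pe \<dots> (tt + cst e) = (\<Sum>i<d. cst (coeff ?r i) * (tt + cst e) ^ i)"
  proof -
    have "pe (\<Sum>i\<in>A. monom (coeff ?r i) i) s = (\<Sum>i\<in>A. cst (coeff ?r i) * s ^ i)" for A s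
      by (induction A rule: infinite_finite_induct) (simp_all add: pe_add pe_monom)
    thus ?thesis by blast
  qed
  finally show "pe p tt = (\<Sum>i<d. cst (coeff ?r i) * (tt + cst e) ^ i)" .
  show "coeff ?r 0 = poly p e" by (simp add: poly_pcompose flip: poly_0_coeff_0)
qed

lemma copn_pe_eq_0:
  assumes "degree p + 1 < q"
  shows "copn n (pe p tt) = 0"
proof -
  have "degree p < q - 1" using assms by simp
  then obtain c where c: "pe p tt = (\<Sum>i<q-1. cst (c i) * (tt + cst 0) ^ i)"
    by (rule poly_shift_expand)
  have "copn n (pe p tt) = (\<Sum>i<q-1. copn n (cst (c i) * (tt + cst 0) ^ i))"
    unfolding c by (rule copn_sum) auto
  also have "\<dots> = 0"
  proof (intro sum.neutral ballI copn_const_mult)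
    fix i assume "i \<in> {..<q-1}"
    thus "copn n ((tt + cst 0) ^ i) = 0" by (subst copn_linear_power_q) auto
  qed auto
  finally show ?thesis .
qed

text \<open>In the Taylor expansion of \<open>p\<close> at \<open>e\<close> the constant term alone
  meets the exponent \<open>q - 1\<close>. A term of degree \<open>i > 0\<close> gives exponent
  \<open>q + (i - 1)\<close>: the q-th power comes out and \<open>i - 1\<close> is too small to
  survive.\<close>

lemma copn_pe_shift:
  assumes "degree p + 1 < q" "d ^ q = poly p e"
  shows "copn n ((tt + cst e) ^ (q - 1) * pe p tt) = cst d"
proof -
  let ?s = "tt + cst e"
  have "degree p < q - 1" using assms by simp
  then obtain c where c: "pe p tt = (\<Sum>i<q-1. cst (c i) * ?s ^ i)" "c 0 = poly p e"
    by (rule poly_shift_expand)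
  have "copn n (?s ^ (q - 1) * pe p tt) = (\<Sum>i<q-1. copn n (?s ^ (q - 1) * (cst (c i) * ?s ^ i)))"
    unfolding c sum_distrib_left by (rule copn_sum) auto
  also have "\<dots> = (\<Sum>i<q-1. if i = 0 then cst d else 0)"
  proof (rule sum.cong[OF refl])
    fix i assume i: "i \<in> {..<q-1}"
    show "copn n (?s ^ (q - 1) * (cst (c i) * ?s ^ i)) = (if i = 0 then cst d else 0)"
    proof (cases "i = 0")
      case True
      have "?s ^ (q - 1) * (cst (c i) * ?s ^ i) = cst d ^ q * ?s ^ (q - 1)"
        using True by (simp add: c(2) assms(2)[symmetric] fls_const_power mult.commute)
      also have "copn n \<dots> = cst d * copn n (?s ^ (q - 1))" by (rule copn_q_mult) auto
      also have "copn n (?s ^ (q - 1)) = 1" using q_ge by (subst copn_linear_power_q) auto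
      finally show ?thesis using True by simp
    next
      case False
      have "?s ^ (q - 1) * ?s ^ i = ?s ^ q * ?s ^ (i - 1)"
        unfolding power_add[symmetric] using False q_ge by simp
      hence "?s ^ (q - 1) * (cst (c i) * ?s ^ i) = ?s ^ q * (cst (c i) * ?s ^ (i - 1))"
        by (simp only: mult.left_commute[of _ "cst (c i)"])
      also have "copn n \<dots> = ?s * copn n (cst (c i) * ?s ^ (i - 1))" by (rule copn_q_mult) auto
      also have "copn n (cst (c i) * ?s ^ (i - 1)) = 0"
        by (rule copn_const_mult) (use i False in \<open>auto simp: copn_linear_power_q\<close>)
      finally show ?thesis using False by simp
    qed
  qed
  also have "\<dots> = cst d" using q_ge by simp
  finally show ?thesis .
qed

text \<open>As \<open>q \<equiv> 2 (mod 3)\<close>, the q-th power map swaps the two primitive cube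
  roots of unity.\<close>

lemma omega_exists: obtains w :: K where "w ^ 2 = w + 1" "w ^ 3 = 1" "w ^ q = w ^ 2" "(w ^ 2) ^ q = w"
proof -
  have "\<exists>w::K. poly [:1, 1, 1:] w = 0" by (rule alg_closed_imp_poly_has_root) simp
  then obtain w :: K where "1 + w + w ^ 2 = 0" by (auto simp: algebra_simps power2_eq_square)
  hence w: "w ^ 2 = w + 1" using K_eq_iff[of "1 + w" "w ^ 2"] by (simp add: add.commute)
  have "w ^ 3 = w * w ^ 2" by (simp only: power3_eq_cube power2_eq_square mult.assoc)
  also have "\<dots> = w * w + w" by (simp only: w distrib_left mult_1_right)
  also have "\<dots> = w ^ 2 + w" by (simp only: power2_eq_square)
  also have "\<dots> = 1" unfolding w by (simp add: add_ac)
  finally have w3: "w ^ 3 = 1" .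
  have "q mod 3 = 2" using q1 by presburger
  then obtain k where k: "q = 3 * k + 2" by (metis mult_div_mod_eq)
  have wq: "w ^ q = w ^ 2" by (simp only: k power_add power_mult w3 power_one mult_1_left)
  have "(w ^ 2) ^ q = (w ^ q) ^ 2" by (simp only: power_mult[symmetric] mult.commute)
  also have "\<dots> = w ^ 3 * w" by (simp add: wq power2_eq_square power3_eq_cube)
  finally show ?thesis using that w w3 wq by simp
qed

definition g0 :: L where "g0 = (tt ^ q + tt ^ 2) / (tt ^ 2 + tt + 1)"

lemma g0_F [simp]: "g0 \<in> F"
  by (simp add: g0_def)

text \<open>The two powers represent the functional \<open>p(\<omega>) + p(\<omega>^2)\<close>, up
  to q-th roots. The summand 1 contributes nothing in degree at most \<open>q - 2\<close>, but turns
  the numerator into \<open>t^q + t^2\<close>, whose derivative is zero.\<close>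

lemma g0_omega:
  assumes "w ^ 2 = w + 1" "w ^ 3 = 1" "w ^ q = w ^ 2" "(w ^ 2) ^ q = w"
  shows "g0 = 1 + (tt + cst w) ^ (q - 1) + (tt + cst (w ^ 2)) ^ (q - 1)"
proof -
  let ?w = "cst w" and ?z = "cst (w ^ 2)"
  have wz: "?w + ?z = 1" "?w * ?z = 1" "?z * ?z = ?w" "?w * ?w = ?z" "?w ^ q = ?z" "?z ^ q = ?w"
  proof -
    show "?w + ?z = 1" by (simp add: assms(1) flip: fls_plus_const)
    show "?w * ?z = 1" using assms(2) by (simp add: power2_eq_square power3_eq_cube mult_ac)
    show "?w * ?w = ?z" by (simp only: power2_eq_square fls_const_mult_const)
    have "w ^ 2 * w ^ 2 = w ^ 3 * w" by (simp only: power2_eq_square power3_eq_cube mult_ac)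
    thus "?z * ?z = ?w" by (simp only: fls_const_mult_const assms(2) mult_1_left)
    show "?w ^ q = ?z" "?z ^ q = ?w" using assms(3,4) by (simp_all flip: fls_const_power)
  qed
  have s: "tt + cst e \<noteq> 0" for e using tt_nonconst[of e] L_eq_iff by blast
  have p: "(tt + cst e) ^ (q - 1) = (tt ^ q + cst e ^ q) / (tt + cst e)" for e
  proof -
    have "(tt + cst e) ^ q = (tt + cst e) ^ (q - 1) * (tt + cst e)"
      using q_ge by (simp flip: power_Suc2)
    thus ?thesis using s[of e] by (simp add: L_power_q_add)
  qed
  have den: "(tt + ?w) * (tt + ?z) = tt ^ 2 + tt + 1"
  proof -
    have "(tt + ?w) * (tt + ?z) = tt ^ 2 + (?w + ?z) * tt + ?w * ?z" by (simp only: algebra_simps power2_eq_square)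
    thus ?thesis by (simp only: wz) simp
  qed
  have d0: "tt ^ 2 + tt + 1 \<noteq> 0" using s by (simp only: den[symmetric] mult_eq_0_iff) simp
  have "(tt + ?w) ^ (q - 1) + (tt + ?z) ^ (q - 1) =
      ((tt ^ q + ?z) * (tt + ?z) + (tt ^ q + ?w) * (tt + ?w)) / ((tt + ?w) * (tt + ?z))"
    unfolding p wz(5,6) using s by (subst add_frac_eq) simp_all
  also have "(tt ^ q + ?z) * (tt + ?z) + (tt ^ q + ?w) * (tt + ?w) =
      tt ^ q * (?w + ?z) + tt * (?w + ?z) + (?z * ?z + ?w * ?w) + (tt ^ q * tt + tt ^ q * tt)"
    by (simp only: algebra_simps)
  also have "\<dots> = tt ^ q + tt + 1" by (simp only: wz L_add_self) (simp add: wz(1))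
  finally have "(tt + ?w) ^ (q - 1) + (tt + ?z) ^ (q - 1) = (tt ^ q + tt + 1) / (tt ^ 2 + tt + 1)"
    unfolding den .
  moreover have "1 + (tt ^ q + tt + 1) / (tt ^ 2 + tt + 1) = g0"
    unfolding g0_def using d0 by (subst add_num_frac) (simp_all add: add_ac)
  ultimately show ?thesis by (simp only: add.assoc)
qed

lemma power_mod3: "(w::K) ^ 3 = 1 \<Longrightarrow> i mod 3 = j mod 3 \<Longrightarrow> w ^ i = w ^ j"
  by (metis mult_div_mod_eq mult_1 power_add power_mult power_one)

lemma degree_ab: "degree (monom 1 a * [:1, 1:] ^ b :: K poly) = a + b"
  by (subst degree_mult_eq) (auto simp: degree_monom_eq degree_power_eq)

lemma pe_ab: "pe (monom 1 a * [:1, 1:] ^ b) tt = tt ^ a * (1 + tt) ^ b"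
  by (simp add: pe_mult pe_monom pe_power)

lemma QQ_1: "QQ 1"
  unfolding QQ_def
proof (intro conjI allI impI)
  fix a b :: nat assume "a + b + 2 \<le> q"
  hence "copn n (pe (monom 1 a * [:1, 1:] ^ b) tt) = 0" by (intro copn_pe_eq_0) (simp add: degree_ab)
  thus "copn n (1 * (tt ^ a * (1 + tt) ^ b)) = 0" by (simp add: pe_ab)
qed simp

lemma copn_g0_pe:
  assumes "degree p + 1 < q" "w ^ 2 = w + 1" "w ^ 3 = 1" "w ^ q = w ^ 2" "(w ^ 2) ^ q = w"
    "d ^ q = poly p w" "e ^ q = poly p (w ^ 2)"
  shows "copn n (g0 * pe p tt) = cst (d + e)"
proof -
  have "g0 * pe p tt = pe p tt + ((tt + cst w) ^ (q - 1) * pe p tt + (tt + cst (w ^ 2)) ^ (q - 1) * pe p tt)"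
    unfolding g0_omega[OF assms(2-5)] by (simp only: distrib_right mult_1_left add.assoc)
  also have "copn n \<dots> = copn n (pe p tt) + (copn n ((tt + cst w) ^ (q - 1) * pe p tt) +
      copn n ((tt + cst (w ^ 2)) ^ (q - 1) * pe p tt))"
    by (simp add: copn_add)
  also have "\<dots> = 0 + (cst d + cst e)"
    by (simp only: copn_pe_eq_0[OF assms(1)] copn_pe_shift[OF assms(1,6)] copn_pe_shift[OF assms(1,7)])
  finally show ?thesis by (simp add: fls_plus_const)
qed

text \<open>By \<open>1 + \<omega> = \<omega>^2\<close>, the polynomial \<open>t^a (1 + t)^b\<close>
  takes the values \<open>\<omega>^(a + 2b)\<close> and \<open>\<omega>^(2a + b)\<close> at the two
  roots; for \<open>a \<equiv> b (mod 3)\<close> they agree and cancel.\<close>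

lemma QQ_g0: "QQ g0"
  unfolding QQ_def
proof (intro conjI allI impI)
  fix a b :: nat assume ab: "a + b + 2 \<le> q" "a mod 3 = b mod 3"
  obtain w :: K where w: "w ^ 2 = w + 1" "w ^ 3 = 1" "w ^ q = w ^ 2" "(w ^ 2) ^ q = w" by (rule omega_exists)
  let ?p = "monom 1 a * [:1, 1:] ^ b :: K poly"
  have "1 + w = w ^ 2" using w(1) by (simp add: add.commute)
  hence p1: "poly ?p w = w ^ (a + 2 * b)" by (simp add: poly_monom power_add power_mult)
  have "1 + w ^ 2 = w" using w(1) by (simp add: add.commute)
  hence p2: "poly ?p (w ^ 2) = w ^ (2 * a + b)" by (simp add: poly_monom power_add power_mult)
  have "(a + 2 * b) mod 3 = (2 * a + b) mod 3"
    using mod_add_cong[OF refl[of "(a + b) mod 3"] ab(2)[symmetric]] by (simp add: add.commute add.left_commute mult_2)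
  hence p12: "poly ?p w = poly ?p (w ^ 2)" unfolding p1 p2 by (rule power_mod3[OF w(2)])
  obtain d where d: "d ^ q = poly ?p w" using K_q_root by blast
  have "copn n (g0 * pe ?p tt) = cst (d + d)"
    by (rule copn_g0_pe[OF _ w d]) (use ab(1) d p12 in \<open>simp_all add: degree_ab\<close>)
  thus "copn n (g0 * (tt ^ a * (1 + tt) ^ b)) = 0" by (simp add: pe_ab)
qed simp

text \<open>Normalisation: \<open>t\<close> is a test polynomial separating the two cube roots of
  unity, so \<open>copn n (tt * g)\<close> gives the coefficient \<open>\<alpha>\<close> in
  \<open>QQ_imp\<close>.\<close>

lemma copn_tt_g0: "copn n (tt * g0) = 1"
proof -
  obtain w :: K where w: "w ^ 2 = w + 1" "w ^ 3 = 1" "w ^ q = w ^ 2" "(w ^ 2) ^ q = w" by (rule omega_exists)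
  have "copn n (g0 * pe [:0, 1:] tt) = cst (w ^ 2 + w)"
    by (rule copn_g0_pe[OF _ w]) (use q_ge w in simp_all)
  thus ?thesis by (simp add: mult.commute w(1) add.commute)
qed

lemma QQ_add: "QQ f \<Longrightarrow> QQ g \<Longrightarrow> QQ (f + g)"
  unfolding QQ_def by (simp add: distrib_right copn_add)

lemma QQ_q_mult: "u \<in> F \<Longrightarrow> QQ g \<Longrightarrow> QQ (u ^ q * g)"
  unfolding QQ_def by (simp add: mult.assoc copn_q_mult)

text \<open>The coefficients are chosen so that the remainder \<open>h\<close> has zero moments
  against \<open>t\<close> and \<open>t^(q-1)\<close>, the two exponents that the conditions in
  \<open>QQ\<close> do not control. All other moments then vanish too, and \<open>h = 0\<close> by
  nondegeneracy.\<close>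

lemma QQ_imp:
  assumes "QQ g"
  obtains \<alpha> \<beta> where "\<alpha> \<in> F" "\<beta> \<in> F" "g = \<alpha> ^ q * g0 + \<beta> ^ q"
proof
  have g: "g \<in> F" using assms by (simp add: QQ_def)
  define \<alpha> where "\<alpha> = copn n (tt * g)"
  define \<beta> where "\<beta> = copn n (tt ^ (q - 1) * (g + \<alpha> ^ q * g0))"
  show \<alpha>: "\<alpha> \<in> F" and \<beta>: "\<beta> \<in> F" using g by (simp_all add: \<alpha>_def \<beta>_def)
  define h where "h = (g + \<alpha> ^ q * g0) + \<beta> ^ q * 1"
  have Qh: "QQ h" unfolding h_def using \<alpha> \<beta> assms by (intro QQ_add QQ_q_mult QQ_1 QQ_g0)
  have hF: "h \<in> F" using Qh by (simp add: QQ_def)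
  have t0: "copn n (tt ^ i) = (if i = q - 1 then 1 else 0)" if "i < q" for i
    using copn_linear_power_q[of i 0] that by simp
  have m1: "copn n (tt * h) = 0"
  proof -
    have "tt * h = tt * g + (\<alpha> ^ q * (tt * g0) + \<beta> ^ q * tt ^ 1)" by (simp add: h_def algebra_simps)
    also have "copn n \<dots> = \<alpha> + (\<alpha> * copn n (tt * g0) + \<beta> * copn n (tt ^ 1))"
      using \<alpha> \<beta> g by (simp only: copn_add copn_q_mult F_add F_mult F_power F_tt g0_F \<alpha>_def[symmetric])
    also have "copn n (tt ^ 1) = 0" using q_ge by (subst t0) auto
    finally show ?thesis by (simp add: copn_tt_g0)
  qed
  have mq: "copn n (tt ^ (q - 1) * h) = 0"
  proof -
    have "tt ^ (q - 1) * h = tt ^ (q - 1) * (g + \<alpha> ^ q * g0) + \<beta> ^ q * tt ^ (q - 1)"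
      by (simp add: h_def algebra_simps)
    also have "copn n \<dots> = \<beta> + \<beta> * copn n (tt ^ (q - 1))"
      using \<alpha> \<beta> g by (simp only: copn_add copn_q_mult F_add F_mult F_power F_tt g0_F \<beta>_def[symmetric])
    also have "copn n (tt ^ (q - 1)) = 1" using q_ge by (subst t0) auto
    finally show ?thesis by simp
  qed
  have ab: "copn n (h * (tt ^ a * (1 + tt) ^ b)) = 0" if "a + b + 2 \<le> q" "a mod 3 = b mod 3" for a b
    using Qh that by (simp add: QQ_def)
  \<comment> \<open>For \<open>i\<close> congruent to 0, 2, 1 modulo 3 the test polynomials are
    \<open>t^i\<close>, \<open>t^(i-1) (1 + t)\<close> and \<open>t^(i-2) (1 + t)^2\<close>; the
    latter two relate \<open>i\<close> to a smaller exponent. The choice fails for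
    \<open>i = 1\<close> and, by the degree bound, for \<open>i = q - 1\<close>.\<close>
  have mi: "i < q \<Longrightarrow> copn n (tt ^ i * h) = 0" for i
  proof (induction i rule: less_induct)
    case (less i)
    consider "i = 1" | "i = q - 1" | "i + 2 \<le> q" "i mod 3 = 0" | "i + 2 \<le> q" "i mod 3 = 2"
      | "i + 2 \<le> q" "i mod 3 = 1" "i > 1"
      using less.prems by linarith
    thus ?case
    proof cases
      case 1 thus ?thesis using m1 by simp
    next
      case 2 thus ?thesis using mq by simp
    next
      case 3
      have "copn n (h * (tt ^ i * (1 + tt) ^ 0)) = 0" by (rule ab) (use 3 in simp_all)
      thus ?thesis by (simp only: power_0 mult_1_right mult.commute[of h])
    next
      case 4
      define j where "j = i - 1"
      have "i \<noteq> 0" using 4(2) by (intro notI) simp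
      hence j: "i = j + 1" by (simp add: j_def)
      have j3: "j mod 3 = 1" using 4(2) unfolding j by presburger
      have "h * (tt ^ j * (1 + tt) ^ 1) = tt ^ j * h + tt ^ i * h" by (simp add: j algebra_simps)
      hence "copn n (tt ^ j * h + tt ^ i * h) = 0" using ab[of j 1] j j3 4(1) by simp
      thus ?thesis using less.IH[of j] j less.prems hF by (simp add: copn_add)
    next
      case 5
      define j where "j = i - 2"
      have j: "i = j + 2" unfolding j_def using 5 by linarith
      have "(1 + tt) ^ 2 = 1 + tt ^ 2" by (simp add: L_square_add)
      hence "h * (tt ^ j * (1 + tt) ^ 2) = tt ^ j * h + tt ^ i * h"
        by (simp add: j algebra_simps power_add power2_eq_square)
      moreover have "j mod 3 = 2 mod 3" using j 5 by presburger
      moreover have "j + 2 + 2 \<le> q" using j 5 by simp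
      ultimately have "copn n (tt ^ j * h + tt ^ i * h) = 0" using ab[of j 2] by simp
      thus ?thesis using less.IH[of j] j less.prems hF by (simp add: copn_add)
    qed
  qed
  have "h = 0"
  proof (rule copn_nondegenerate[OF hF])
    fix i :: nat assume "i < 2 ^ n"
    hence "i < q" by (simp only: q_def)
    thus "copn n (tt ^ i * h) = 0" by (rule mi)
  qed
  hence "g + (\<alpha> ^ q * g0 + \<beta> ^ q) = 0" unfolding h_def by (simp only: mult_1_right add.assoc)
  thus "g = \<alpha> ^ q * g0 + \<beta> ^ q" by (rule iffD1[OF L_eq_iff])
qed

end

section \<open>Averaging over the roots of unity in the second coordinate\<close>

text \<open>\<open>X^k - 1\<close> splits, and a multiple root would be a zero of its derivative
  \<open>X^(k-1)\<close> for odd \<open>k\<close>, hence 0, which is not a root.\<close>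

lemma card_K_roots_of_unity:
  assumes "odd k"
  shows "finite {z::K. z ^ k = 1}" "card {z::K. z ^ k = 1} = k"
proof -
  have k: "k > 0" using assms by (auto intro!: gr0I)
  let ?p = "monom 1 k - 1 :: K poly"
  have deg: "degree ?p = k" using k by (subst diff_conv_add_uminus, subst degree_add_eq_left) (auto simp: degree_monom_eq)
  have lc: "lead_coeff ?p = 1" unfolding deg using k by simp
  have p0: "?p \<noteq> 0" using deg k by (metis degree_0 less_irrefl)
  obtain A where A: "size A = degree ?p" "?p = smult (lead_coeff ?p) (\<Prod>x\<in>#A. [:-x, 1:])"
    using alg_closed_imp_factorization[OF p0] by blast
  have p: "?p = (\<Prod>x\<in>#A. [:-x, 1:])" using A(2) unfolding lc by simp
  have "poly ?p z = (\<Prod>x\<in>#A. x + z)" for z unfolding p by (simp add: poly_prod_mset)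
  hence root: "poly ?p z = 0 \<longleftrightarrow> z \<in># A" for z
    by (auto simp: K_eq_iff image_iff intro!: bexI[of _ z])
  have pz: "poly ?p z = 0 \<longleftrightarrow> z ^ k = 1" for z by (simp add: poly_monom K_eq_iff)
  have set: "set_mset A = {z. z ^ k = 1}" using root pz by auto
  have "count A z = 1" if zA: "z \<in># A" for z
  proof (rule ccontr)
    assume "count A z \<noteq> 1"
    with zA have "count A z \<ge> 2" using count_greater_zero_iff[of A z] by linarith
    obtain A' where A': "A = add_mset z A'" using multi_member_split[OF zA] by blast
    with \<open>count A z \<ge> 2\<close> have "count A' z > 0" by simp
    hence "z \<in># A'" by (simp only: count_greater_zero_iff)
    then obtain B where "A' = add_mset z B" using multi_member_split by metis
    with A' have "A = add_mset z (add_mset z B)" by simp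
    hence "?p = [:-z, 1:] * ([:-z, 1:] * (\<Prod>x\<in>#B. [:-x, 1:]))" unfolding p by simp
    hence "poly (pderiv ?p) z = 0" by (simp only: pderiv_mult) simp
    hence "z = 0" using assms k by (simp add: pderiv_diff pderiv_monom poly_monom of_nat_char2)
    thus False using root[of z] pz[of z] zA k by (simp add: power_0_left)
  qed
  hence "A = mset_set (set_mset A)"
    by (intro multiset_eqI) (auto simp: count_mset_set' not_in_iff)
  hence "size A = card (set_mset A)" by (metis size_mset_set)
  thus "card {z::K. z ^ k = 1} = k" using A(1) deg set by simp
  thus "finite {z::K. z ^ k = 1}" using k by (intro card_ge_0_finite) simp
qed

text \<open>For each exponent below \<open>B\<close> the coefficients of the \<open>a j\<close> form
  a polynomial in \<open>\<delta>\<close> of degree less than \<open>k\<close> that vanishes at all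
  \<open>k\<close> roots of unity, hence is zero.\<close>

lemma vge_average:
  fixes a :: "nat \<Rightarrow> L"
  assumes "odd k" "\<And>\<delta>. \<delta> ^ k = 1 \<Longrightarrow> vge B (\<Sum>j<k. cst (\<delta> ^ j) * a j)" "j < k"
  shows "vge B (a j)"
  unfolding vge_def
proof (intro allI impI)
  fix i assume i: "i < B"
  define r where "r = (\<Sum>j<k. monom (fls_nth (a j) i) j)"
  have "poly r \<delta> = 0" if "\<delta> ^ k = 1" for \<delta>
  proof -
    have "fls_nth (\<Sum>j<k. cst (\<delta> ^ j) * a j) i = 0" using assms(2)[OF that] i by (auto simp: vge_def)
    thus ?thesis by (simp add: r_def poly_sum poly_monom fls_nth_sum mult.commute)
  qed
  hence sub: "{z. z ^ k = 1} \<subseteq> {z. poly r z = 0}" by auto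
  have "r = 0"
  proof (rule ccontr)
    assume r: "r \<noteq> 0"
    have k: "k > 0" using assms(3) by simp
    have "degree r \<le> k - 1" unfolding r_def
      by (intro degree_sum_le) (auto intro: order.trans[OF degree_monom_le])
    moreover have "k \<le> card {z. poly r z = 0}"
      using card_mono[OF poly_roots_finite[OF r] sub] card_K_roots_of_unity(2)[OF assms(1)] by simp
    ultimately show False using card_poly_roots_bound[OF r] k by simp
  qed
  hence "coeff r j = 0" by simp
  moreover have "coeff r j = (\<Sum>l<k. if l = j then fls_nth (a l) i else 0)"
    unfolding r_def coeff_sum by (intro sum.cong) auto
  ultimately show "fls_nth (a j) i = 0" using assms(3) by simp
qed

lemma poly_dvd_order:
  fixes a b :: "'a::alg_closed_field poly"
  assumes "a \<noteq> 0" "b \<noteq> 0" "\<And>c. ordp c b \<le> ordp c a"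
  shows "b dvd a"
  using assms
proof (induction "degree b" arbitrary: a b rule: less_induct)
  case less
  show ?case
  proof (cases "degree b = 0")
    case True
    then obtain d where d: "b = [:d:]" by (rule degree_eq_zeroE)
    hence "d \<noteq> 0" using less.prems(2) by simp
    hence "a = b * smult (inverse d) a" using d by simp
    thus ?thesis by (rule dvdI)
  next
    case False
    then obtain c where c: "poly b c = 0" using alg_closed_imp_poly_has_root[of b] by auto
    hence "ordp c b > 0" using order_gt_0_iff[OF less.prems(2)] by simp
    hence "ordp c a > 0" using less.prems(3)[of c] by (rule less_le_trans)
    hence "poly a c = 0" using order_gt_0_iff[OF less.prems(1)] by blast
    with c obtain a' b' where ab: "a = [:-c, 1:] * a'" "b = [:-c, 1:] * b'"
      by (auto simp: poly_eq_0_iff_dvd dvd_def)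
    have nz: "a' \<noteq> 0" "b' \<noteq> 0" using less.prems ab by auto
    have "degree b' < degree b" unfolding ab using nz by (subst degree_mult_eq) auto
    moreover have "ordp d b' \<le> ordp d a'" for d
    proof -
      have "ordp d a = ordp d [:-c, 1:] + ordp d a'"
        "ordp d b = ordp d [:-c, 1:] + ordp d b'"
        using less.prems(1,2) unfolding ab by (simp_all only: order_mult not_False_eq_True)
      thus ?thesis using less.prems(3)[of d] by linarith
    qed
    ultimately have "b' dvd a'" using less.hyps nz by blast
    thus ?thesis unfolding ab by (rule mult_dvd_mono[OF dvd_refl])
  qed
qed

lemma nonconst_nth: "fls_nth u k \<noteq> 0 \<Longrightarrow> k \<noteq> 0 \<Longrightarrow> nonconst u"
  by (auto simp: nonconst_def)

context curve
begin

lemma rel_twist: "rel u v \<Longrightarrow> \<delta> ^ (q + 1) = 1 \<Longrightarrow> rel u (cst \<delta> * v)"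
  unfolding rel_def power_mult_distrib fls_const_power[symmetric] by simp

lemma hom_coeff_bound:
  assumes "nonconst u" "rel u v" "p \<in> Car"
    "\<And>E. hom E \<Longrightarrow> E xx = u \<Longrightarrow> vge B (E (ev0 p))"
    "j < q + 1"
  shows "vge B (evR u (coeff p j) * v ^ j)"
proof (rule vge_average[where a = "\<lambda>j. evR u (coeff p j) * v ^ j" and k = "q + 1"])
  show "odd (q + 1)" using q_even by simp
  fix \<delta> :: K assume \<delta>: "\<delta> ^ (q + 1) = 1"
  obtain E where E: "hom E" "E xx = u" "\<And>p. E (ev0 p) = ev u (cst \<delta> * v) p"
    using hom_exists[OF assms(1) rel_twist[OF assms(2) \<delta>]] by metis
  have "degree p \<le> q" using assms(3) by simp
  hence "E (ev0 p) = (\<Sum>j\<le>q. evR u (coeff p j) * (cst \<delta> * v) ^ j)"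
    unfolding E(3) by (rule ev_altdef'[OF assms(1)])
  also have "\<dots> = (\<Sum>j<q+1. cst (\<delta> ^ j) * (evR u (coeff p j) * v ^ j))"
    by (rule sum.cong) (auto simp: power_mult_distrib fls_const_power)
  finally show "vge B (\<Sum>j<q+1. cst (\<delta> ^ j) * (evR u (coeff p j) * v ^ j))"
    using assms(4)[OF E(1,2)] by simp
qed (rule assms(5))

lemma rel_exists_subdegree:
  assumes "val (u ^ (2 * m) + u ^ m) = int (q + 1) * k"
  obtains v where "rel u v" "val v = k"
proof -
  obtain v where v: "v ^ (q + 1) = u ^ (2 * m) + u ^ m"
    using root_q1_exists[of "u ^ (2 * m) + u ^ m"] assms by auto
  hence "int (q + 1) * val v = int (q + 1) * k"
    using assms fls_subdegree_pow[of v "q + 1"] by metis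
  hence "val v = k" by simp
  thus ?thesis using that v by (simp only: rel_def)
qed

text \<open>Write \<open>f = \<Sum> c_j(x) y^j\<close>. Since \<open>y\<close> may be replaced by \<open>\<delta> y\<close> with \<open>\<delta>^(q+1) = 1\<close>, a bound on the
  order of \<open>f\<close> at all places over a point of the \<open>x\<close>-line bounds every single term. The orders at the
  places with \<open>x^m = 1\<close>, \<open>x = 0\<close> and \<open>x = \<infinity>\<close> are at least \<open>B1\<close>, \<open>B0\<close> and \<open>Bi\<close>.\<close>

lemma F_span_expand:
  assumes f: "f \<in> F"
    and S0: "0 \<in> S" and S_add: "\<And>a b. a \<in> S \<Longrightarrow> b \<in> S \<Longrightarrow> a + b \<in> S"
    and H_unit: "\<And>E c. hom E \<Longrightarrow> E xx = cst c + fls_X \<Longrightarrow> c \<noteq> 0 \<Longrightarrow> c ^ m \<noteq> 1 \<Longrightarrow> vge 0 (E f)"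
    and H_one: "\<And>E c. hom E \<Longrightarrow> E xx = cst c + fls_X ^ (q + 1) \<Longrightarrow> c ^ m = 1 \<Longrightarrow> vge B1 (E f)"
    and H_zero: "\<And>E. hom E \<Longrightarrow> E xx = fls_X ^ 3 \<Longrightarrow> vge B0 (E f)"
    and H_inf: "\<And>E. hom E \<Longrightarrow> E xx = inverse (fls_X ^ 3) \<Longrightarrow> vge Bi (E f)"
    and B: "B1 \<ge> - int q" "B0 \<le> 0"
    and S: "\<And>c i j s e. j \<le> q \<Longrightarrow> e \<le> 1 \<Longrightarrow> (e = 1 \<Longrightarrow> int (q + 1) + B1 \<le> int j) \<Longrightarrow>
        3 * int s \<le> int j - B0 \<Longrightarrow> 3 * int i \<le> 3 * int s + int (q + 1) * int e - 2 * int j - Bi \<Longrightarrow>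
        cst c * (xx ^ i * yy ^ j / (xx ^ s * (tt + 1) ^ e)) \<in> S"
  shows "f \<in> S"
proof -
  obtain p where p: "p \<in> Car" "f = ev0 p" using f F_eq by auto
  have sumS: "(\<And>i. i \<in> A \<Longrightarrow> g i \<in> S) \<Longrightarrow> sum g A \<in> S" for A :: "nat set" and g
    by (induction A rule: infinite_finite_induct) (auto simp: S0 S_add)
  have "evR xx (coeff p j) * yy ^ j \<in> S" if j: "j \<le> q" for j
  proof (cases "coeff p j = 0")
    case True
    thus ?thesis by (simp add: evx_0 S0)
  next
    case False
    then obtain a b where ab: "coeff p j = Fract a b" "a \<noteq> 0" "b \<noteq> 0" "evR xx (coeff p j) = pe a xx / pe b xx"
      using evR_nz_obtain[OF xx_nonconst] by metis
    have jq: "j < q + 1" using j by simp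
    have bound: "B \<le> val (pe a u) - val (pe b u) + int j * val v"
      if "nonconst u" "rel u v" "v \<noteq> 0" "\<And>E. hom E \<Longrightarrow> E xx = u \<Longrightarrow> vge B (E f)" for u v B
    proof -
      have nz: "pe a u \<noteq> 0" "pe b u \<noteq> 0" using pe_nonconst_nz[OF that(1)] ab by auto
      have "vge B (pe a u / pe b u * v ^ j)"
        using hom_coeff_bound[OF that(1,2) p(1) _ jq, of B] that(4) p(2) ab(1,3) by (simp add: evR_Fract[OF that(1)])
      thus ?thesis using nz that(3) by (simp add: vge_nz fls_divide_subdegree fls_subdegree_pow)
    qed
    have unit: "ordp c b \<le> ordp c a" if c: "c \<noteq> 0" "c ^ m \<noteq> 1" for c
    proof -
      let ?u = "cst c + fls_X :: L"
      have nc: "nonconst ?u" by (rule nonconst_nth[of _ 1]) simp_all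
      have "val (?u ^ (2 * m) + ?u ^ m) = int (q + 1) * 0"
        using rel_rhs_unit(1)[OF c, of fls_X] by simp
      then obtain v where v: "rel ?u v" "val v = 0" by (rule rel_exists_subdegree)
      have "?u ^ (2 * m) + ?u ^ m \<noteq> 0" using rel_rhs_unit(2)[OF c, of fls_X] by simp
      hence "v \<noteq> 0" using v(1) by (auto simp: rel_def)
      from bound[OF nc v(1) this, of 0] show ?thesis
        using H_unit[OF _ _ c] v(2) subdegree_pe_at(1)[of "fls_X :: L" a c] subdegree_pe_at(1)[of "fls_X :: L" b c] ab(2,3)
        by simp
    qed
    define N where "N = int (q + 1)"
    have one: "B1 \<le> N * (int (ordp c a) - int (ordp c b)) + int j" if c: "c ^ m = 1" for c
    proof -
      let ?u = "cst c + fls_X ^ (q + 1) :: L"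
      have nc: "nonconst ?u"
        by (rule nonconst_nth[of _ "int (q + 1)"]) (simp_all del: power_Suc of_nat_Suc of_nat_add)
      have "val (?u ^ (2 * m) + ?u ^ m) = int (q + 1) * 1"
        using rel_rhs_branch[OF c, of "fls_X ^ (q + 1)"] by (simp del: power_Suc)
      then obtain v where v: "rel ?u v" "val v = 1" by (rule rel_exists_subdegree)
      have "v \<noteq> 0" using v(2) by auto
      from bound[OF nc v(1) this, of B1] show ?thesis
        using H_one[OF _ _ c] v(2) subdegree_pe_at(1)[of "fls_X ^ (q + 1) :: L" a c]
          subdegree_pe_at(1)[of "fls_X ^ (q + 1) :: L" b c] ab(2,3)
        by (simp add: N_def algebra_simps del: power_Suc)
    qed
    have zero: "B0 \<le> 3 * (int (ordp 0 a) - int (ordp 0 b)) + int j"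
    proof -
      let ?u = "fls_X ^ 3 :: L"
      have nc: "nonconst ?u" by (rule nonconst_subdegree) simp
      obtain v where v: "rel ?u v" "val v = 1"
        using rel_exists_subdegree[OF rel_rhs_zero] .
      have "v \<noteq> 0" using v(2) by auto
      from bound[OF nc v(1) this, of B0] show ?thesis
        using H_zero v(2) subdegree_pe_at(1)[of "fls_X ^ 3 :: L" a 0]
          subdegree_pe_at(1)[of "fls_X ^ 3 :: L" b 0] ab(2,3)
        by (simp add: algebra_simps del: L_numeral power_Suc)
    qed
    have inf: "Bi \<le> - 3 * (int (degree a) - int (degree b)) - 2 * int j"
    proof -
      let ?u = "inverse (fls_X ^ 3) :: L"
      note su = inverse_X3_subdegree
      have nc: "nonconst ?u" by (rule nonconst_subdegree) (simp only: su)
      obtain v where v: "rel ?u v" "val v = -2"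
        using rel_exists_subdegree[OF rel_rhs_infinity] .
      have "v \<noteq> 0" using v(2) by auto
      from bound[OF nc v(1) this, of Bi] show ?thesis
        using H_inf v(2) subdegree_pe_neg[of ?u a] subdegree_pe_neg[of ?u b] ab(2,3)
        by (simp only: su) (simp add: algebra_simps)
    qed
    \<comment> \<open>At a point with \<open>x^m = 1\<close> a pole of \<open>c_j\<close> of order
      \<open>d\<close> satisfies \<open>(q + 1) d \<le> j - B1 \<le> 2 q\<close>, so
      \<open>d \<le> 1\<close> and one factor \<open>t + 1\<close> clears all of these
      poles.\<close>
    define e :: nat where "e = (if N + B1 \<le> int j then 1 else 0)"
    \<comment> \<open>Over \<open>x = 0\<close> the test place has \<open>x\<close> of order 3 and
      \<open>y\<close> of order 1, which bounds the pole order of \<open>c_j\<close> at 0 by this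
      quotient.\<close>
    define s where "s = nat ((int j - B0) div 3)"
    have s: "int s = (int j - B0) div 3" using B(2) by (simp add: s_def)
    have s3: "int j - B0 < 3 * int s + 3" "3 * int s \<le> int j - B0" unfolding s by presburger+
    have tX: "monom 1 m + 1 \<noteq> (0 :: K poly)"
    proof
      assume "monom 1 m + 1 = (0 :: K poly)"
      hence "coeff (monom 1 m + 1 :: K poly) m = 0" by simp
      thus False by simp
    qed
    let ?a = "a * (monom 1 s * (monom 1 m + 1) ^ e)"
    have a_nz: "?a \<noteq> 0" using ab tX by simp
    have "b dvd ?a"
    proof (rule poly_dvd_order[OF a_nz ab(3)])
      fix c
      have oa: "ordp c ?a = ordp c a + ordp c (monom 1 s) + ordp c ((monom 1 m + 1) ^ e)"
        using a_nz by (simp add: order_mult)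
      consider "c = 0" | "c ^ m = 1" | "c \<noteq> 0" "c ^ m \<noteq> 1" by blast
      thus "ordp c b \<le> ordp c ?a"
      proof cases
        case 1
        have "int (ordp 0 b) \<le> int (ordp 0 a) + int s" 
          using zero s3(1) unfolding right_diff_distrib by linarith
        thus ?thesis using oa unfolding 1 by simp
      next
        case 2
        define d where "d = int (ordp c b) - int (ordp c a)"
        have ge: "B1 \<le> int j - N * d" using one[OF 2] by (simp add: d_def algebra_simps)
        have N: "N = int q + 1" by (simp add: N_def)
        have d1: "d \<le> 1"
        proof (rule ccontr)
          assume "\<not> d \<le> 1"
          hence "N * 2 \<le> N * d" by (intro mult_left_mono) (auto simp: N_def)
          thus False using ge B(1) j N by linarith
        qed
        have "d \<le> int e"
        proof (cases "d = 1")
          case True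
          thus ?thesis using ge by (simp add: e_def)
        next
          case False
          thus ?thesis using d1 by simp
        qed
        moreover have "e \<le> ordp c ((monom 1 m + 1) ^ e)"
        proof (cases "e = 0")
          case False
          have "poly ((monom 1 m + 1) ^ e) c = 0" using 2 False by (simp add: poly_monom)
          hence "ordp c ((monom 1 m + 1) ^ e) > 0" using tX by (subst order_gt_0_iff) auto
          moreover have "e = 1" using False by (simp add: e_def split: if_splits)
          ultimately show ?thesis by simp
        qed simp
        ultimately show ?thesis unfolding oa d_def by linarith
      next
        case 3
        thus ?thesis unfolding oa using unit[of c] by simp
      qed
    qed
    then obtain r where r: "?a = b * r" by (auto elim: dvdE)
    have r0: "r \<noteq> 0" using r a_nz by auto
    have "degree ?a = degree a + (s + m * e)"
    proof -
      have "degree ((monom 1 m + 1) ^ e :: K poly) = m * e"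
        using m_pos by (subst degree_power_eq) (auto simp: tX degree_add_eq_left degree_monom_eq)
      thus ?thesis using ab tX by (simp add: degree_mult_eq degree_monom_eq)
    qed
    hence deg: "degree b + degree r = degree a + (s + m * e)"
      using ab r0 unfolding r by (simp add: degree_mult_eq)
    have nz: "pe a xx \<noteq> 0" "pe b xx \<noteq> 0" using pe_nonconst_nz[OF xx_nonconst] ab by auto
    have "pe a xx * (xx ^ s * (tt + 1) ^ e) = pe b xx * pe r xx"
      using arg_cong[OF r, of "\<lambda>p. pe p xx"] by (simp add: pe_mult pe_power pe_add pe_monom tt_def)
    hence "evR xx (coeff p j) = pe r xx / (xx ^ s * (tt + 1) ^ e)"
      unfolding ab(4) using nz by (subst frac_eq_eq) (simp_all add: mult.commute)
    also have "pe r xx = (\<Sum>i\<le>degree r. cst (coeff r i) * xx ^ i)"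
      unfolding pe_def by (simp add: poly_altdef coeff_map_poly degree_map_poly)
    finally have "evR xx (coeff p j) * yy ^ j =
        (\<Sum>i\<le>degree r. cst (coeff r i) * xx ^ i / (xx ^ s * (tt + 1) ^ e) * yy ^ j)"
      by (simp only: sum_divide_distrib sum_distrib_right)
    also have "\<dots> = (\<Sum>i\<le>degree r. cst (coeff r i) * (xx ^ i * yy ^ j / (xx ^ s * (tt + 1) ^ e)))"
      by (rule sum.cong) (simp_all add: mult_ac)
    finally have "evR xx (coeff p j) * yy ^ j =
        (\<Sum>i\<le>degree r. cst (coeff r i) * (xx ^ i * yy ^ j / (xx ^ s * (tt + 1) ^ e)))" .
    moreover have "\<dots> \<in> S"
    proof (rule sumS)
      fix i assume i: "i \<in> {..degree r}"
      show "cst (coeff r i) * (xx ^ i * yy ^ j / (xx ^ s * (tt + 1) ^ e)) \<in> S"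
      proof (rule S)
        show "j \<le> q" by (rule j)
        show "e \<le> 1" by (simp add: e_def)
        show "int (q + 1) + B1 \<le> int j" if "e = 1" using that by (simp add: e_def N_def split: if_splits)
        show "3 * int s \<le> int j - B0" by (rule s3)
        \<comment> \<open>After clearing denominators \<open>c_j\<close> has the polynomial
          numerator \<open>r\<close> in \<open>x\<close>; the order bound at infinity, where
          \<open>x\<close> and \<open>y\<close> have orders -3 and -2, limits its degree.\<close>
        have "int (degree r) = int (degree a) - int (degree b) + int s + int m * int e"
          using deg by (metis add_diff_cancel_left' of_nat_add of_nat_mult add.assoc add_diff_eq diff_add_eq)
        moreover have "int i \<le> int (degree r)" using i by simp
        moreover have "int (q + 1) * int e = 3 * (int m * int e)" unfolding q1 by simp
        ultimately show "3 * int i \<le> 3 * int s + int (q + 1) * int e - 2 * int j - Bi"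
          using inf unfolding right_diff_distrib by linarith
      qed
    qed
    ultimately show ?thesis by simp
  qed
  moreover have "f = (\<Sum>j\<le>q. evR xx (coeff p j) * yy ^ j)"
    unfolding p(2) using p(1) by (intro ev_altdef'[OF xx_nonconst]) simp
  ultimately show ?thesis using sumS[of "{..q}"] by simp
qed

section \<open>Places of the curve\<close>

text \<open>Since \<open>dt = (t/x) dx\<close>, regularity of \<open>f dt\<close> becomes a
  condition on \<open>f t / x\<close> at the test embeddings of \<open>F_span_expand\<close>, where
  \<open>x\<close> and hence \<open>dx\<close> are explicit.\<close>

lemma hom_Om_shift:
  assumes "hom E" "f \<in> F"
  shows "E (f * tt / xx) * fls_deriv (E xx) = E f * fls_deriv (E tt)"
proof -
  have u: "E xx \<noteq> 0" using assms(1) by (simp add: hom_nz)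
  have mm: "E xx ^ m = E xx ^ (m - 1) * E xx" using m_pos by (metis power_minus_mult)
  have "fls_deriv (E tt) = E xx ^ (m - 1) * fls_deriv (E xx)"
    using m_odd by (simp add: hom_tt[OF assms(1)] fls_deriv_power of_nat_char2)
  moreover have "E (f * tt / xx) = E f * E xx ^ (m - 1)"
    using assms u by (simp add: hom_divide hom_mult hom_tt mm)
  ultimately show ?thesis by (simp add: mult.assoc)
qed

lemma vge_divide:
  fixes f g :: L
  assumes "vge 0 (f * g)" "g \<noteq> 0" "val g = - k"
  shows "vge k f"
  using assms by (cases "f = 0") (auto simp: vge_iff)

lemma tt_yy: "tt * (tt + 1) = yy ^ (q + 1)"
  unfolding tt_rel by (simp add: power2_eq_square algebra_simps)

text \<open>The content is that holomorphic differentials are combinations of the forms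
  \<open>dform\<close>. At the test places \<open>dx\<close> has order 0, \<open>q\<close>, 2 and -4
  for generic \<open>x\<close>, \<open>x^m = 1\<close>, \<open>x = 0\<close> and
  \<open>x = \<infinity>\<close>; negated, these are the bounds for the coefficient
  \<open>f t / x\<close> of \<open>dx\<close>.\<close>

lemma QQ_imp_NN:
  assumes "QQ g"
  shows "g \<in> NN"
  unfolding NN_def
proof (intro CollectI conjI ballI)
  show g: "g \<in> F" using assms by (simp add: QQ_def)
  fix f assume f: "f \<in> Om"
  have fF: "f \<in> F" using f by (simp add: Om_def)
  let ?S = "{h \<in> F. copn n (g * (h * xx / tt)) = 0}"
  have reg: "vge 0 (E (f * tt / xx) * fls_deriv (E xx))" if "hom E" for E
    using f that by (simp add: Om_def hom_Om_shift fF)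
  have "f * tt / xx \<in> ?S"
  proof (rule F_span_expand[where ?B1.0 = "- int q" and ?B0.0 = "-2" and Bi = 4])
    show "f * tt / xx \<in> F" using fF by simp
    show "0 \<in> ?S" by simp
    show "a + b \<in> ?S" if "a \<in> ?S" "b \<in> ?S" for a b
    proof -
      have "g * ((a + b) * xx / tt) = g * (a * xx / tt) + g * (b * xx / tt)"
        by (simp add: algebra_simps add_divide_distrib)
      thus ?thesis using that g by (simp add: copn_add)
    qed
    show "vge 0 (E (f * tt / xx))" if "hom E" "E xx = cst c + fls_X" for E c
      using reg[OF that(1)] that(2) by simp
    show "vge (- int q) (E (f * tt / xx))" if "hom E" "E xx = cst c + fls_X ^ (q + 1)" for E c
    proof -
      have "fls_deriv (E xx) = fls_X ^ q"
        using q_even by (simp add: that(2) fls_deriv_power of_nat_char2 del: power_Suc)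
      thus ?thesis using vge_divide[OF reg[OF that(1)], of "- int q"] by simp
    qed
    show "vge (-2) (E (f * tt / xx))" if "hom E" "E xx = fls_X ^ 3" for E
    proof -
      have "fls_deriv (E xx) = fls_X ^ 2" by (simp add: that(2) fls_deriv_power)
      thus ?thesis using vge_divide[OF reg[OF that(1)], of "-2"] by simp
    qed
    show "vge 4 (E (f * tt / xx))" if "hom E" "E xx = inverse (fls_X ^ 3)" for E
    proof -
      let ?w = "fls_X ^ 3 :: L"
      have "fls_deriv (?w * inverse ?w) = 0" by simp
      hence "?w * fls_deriv (inverse ?w) + fls_deriv ?w * inverse ?w = 0" by (simp only: fls_deriv_mult)
      hence "?w * fls_deriv (inverse ?w) = fls_deriv ?w * inverse ?w" by (simp only: L_eq_iff)
      also have "fls_deriv ?w = fls_X ^ 2" by (simp add: fls_deriv_power)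
      finally have e: "?w * fls_deriv (inverse ?w) = fls_X ^ 2 * inverse ?w" .
      hence nz: "fls_deriv (inverse ?w) \<noteq> 0" by auto
      from e have "val (?w * fls_deriv (inverse ?w)) = val (fls_X ^ 2 * inverse ?w)" by simp
      hence "3 + val (fls_deriv (inverse ?w)) = 2 - 3"
        using nz by (subst (asm) fls_subdegree_mult, simp, simp, subst (asm) fls_subdegree_mult, simp, simp)
          (simp add: fls_inverse_subdegree)
      thus ?thesis using vge_divide[OF reg[OF that(1)], of 4] nz that(2) by simp
    qed
    fix c i j s and e :: nat
    assume h: "j \<le> q" "e \<le> 1" "e = 1 \<Longrightarrow> int (q + 1) + - int q \<le> int j"
      "3 * int s \<le> int j - - 2" "3 * int i \<le> 3 * int s + int (q + 1) * int e - 2 * int j - 4"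
    \<comment> \<open>For \<open>e = 0\<close> the two bounds give
      \<open>3 i \<le> -j - 2\<close>.\<close>
    have e: "e = 1"
    proof (rule ccontr)
      assume "e \<noteq> 1"
      hence "e = 0" using h(2) by simp
      thus False using h(4,5) by simp
    qed
    have j1: "1 \<le> j" using h(3)[OF e] by simp
    have b5: "3 * i + 2 * j + 4 \<le> 3 * s + 3 * m" using h(5) e q1 by (simp add: algebra_simps)
    have b4: "3 * s \<le> j + 2" using h(4) by simp
    have jq: "j + 1 \<le> q" using b4 b5 q1 h(1) by linarith
    \<comment> \<open>From \<open>y^j / (t + 1) = t / y^(q + 1 - j)\<close> and
      \<open>t = x^m\<close>: the exponent of \<open>y\<close> in the denominator is
      \<open>k + 2\<close>, and that of \<open>x\<close> is \<open>A + 1\<close> after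
      multiplication by \<open>x / t\<close>.\<close>
    define k where "k = q - 1 - j"
    define A where "A = i + m - s"
    have sm: "s \<le> m" using b4 h(1) q1 by linarith
    have k: "k + (j - 1) + 2 = q" "k + 2 + j = q + 1" using jq j1 by (auto simp: k_def)
    have A: "A + s = i + m" using sm by (simp add: A_def)
    define a where "a = 3 * A - k"
    have a: "a + k = 3 * A" "a \<le> k" using A b4 b5 k q1 sm by (auto simp: a_def)
    have "a + (j - 1) + 2 \<le> q" using a k by linarith
    hence q0: "copn n (g * (tt ^ a * (1 + tt) ^ (j - 1))) = 0"
      using assms dform_params[OF k(1) a(1)] by (simp add: QQ_def)
    let ?h = "xx ^ i * yy ^ j / (xx ^ s * (tt + 1) ^ e)"
    have hF: "?h \<in> F" by simp
    have "?h * xx / tt = dform A k"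
    proof -
      have "xx ^ i * yy ^ j * xx * (yy ^ (k + 2) * tt) = xx ^ (A + 1) * (xx ^ s * (tt + 1) * tt)"
      proof -
        have "xx ^ i * yy ^ j * xx * (yy ^ (k + 2) * tt) = xx ^ (i + 1) * (yy ^ (k + 2 + j)) * tt"
          by (simp add: power_add mult_ac)
        also have "yy ^ (k + 2 + j) = tt * (tt + 1)" unfolding k(2) tt_yy ..
        also have "xx ^ (i + 1) * (tt * (tt + 1)) * tt = xx ^ (i + m + 1) * ((tt + 1) * tt)"
          by (simp add: tt_def power_add mult_ac)
        also have "xx ^ (i + m + 1) = xx ^ (A + 1) * xx ^ s" unfolding A[symmetric] by (simp add: power_add mult_ac)
        finally show ?thesis by (simp only: mult_ac)
      qed
      moreover have "yy ^ (k + 2) * tt \<noteq> 0" "xx ^ s * (tt + 1) * tt \<noteq> 0" by simp_all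
      ultimately have "xx ^ i * yy ^ j * xx / (xx ^ s * (tt + 1) * tt) = xx ^ (A + 1) / (yy ^ (k + 2) * tt)"
        by (subst frac_eq_eq)
      thus ?thesis by (simp add: dform_def e)
    qed
    hence "copn n (g * (?h * xx / tt)) = 0" using copn_dform[OF k(1) a(1) g] q0 by simp
    hence "copn n (cst c * (g * (?h * xx / tt))) = 0"
      using copn_const_mult[of "g * (?h * xx / tt)" c] g hF by simp
    moreover have "cst c * (g * (?h * xx / tt)) = g * (cst c * ?h * xx / tt)" by simp
    ultimately have "copn n (g * (cst c * ?h * xx / tt)) = 0" by (simp only:)
    thus "cst c * ?h \<in> ?S" using hF by blast
  qed simp_all
  hence "copn n (g * (f * tt / xx * xx / tt)) = 0" by blast
  thus "copn n (g * f) = 0" by simp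
qed

lemma aut_g0:
  assumes "aut s"
  obtains \<alpha> \<beta> where "\<alpha> \<in> F" "\<beta> \<in> F" "s g0 = \<alpha> ^ q * g0 + \<beta> ^ q"
  using QQ_imp[OF NN_imp_QQ[OF NN_aut[OF assms QQ_imp_NN[OF QQ_g0]]]] .

text \<open>Primitive embeddings are the completions at the places of \<open>F\<close>.\<close>

definition prim :: "(L \<Rightarrow> L) \<Rightarrow> bool" where
  "prim E \<longleftrightarrow> hom E \<and> (\<exists>f\<in>F. val (E f) = 1)"

lemma prim_hom: "prim E \<Longrightarrow> hom E"
  by (simp add: prim_def)

lemma prim_aut: "prim E \<Longrightarrow> aut s \<Longrightarrow> prim (\<lambda>f. E (s f))"
proof -
  assume E: "prim E" and s: "aut s"
  then obtain f where "f \<in> F" "val (E f) = 1" by (auto simp: prim_def)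
  moreover from this s obtain f' where "f' \<in> F" "f = s f'" unfolding aut_def by blast
  ultimately show ?thesis using hom_aut[OF prim_hom[OF E] s] by (auto simp: prim_def)
qed

text \<open>If \<open>x\<close> is a series in \<open>\<zeta>\<close>, then so is \<open>y\<close>, being determined up to a root of unity, and hence all of
  \<open>F\<close>; so all orders are multiples of that of \<open>\<zeta>\<close>.\<close>

lemma compose_uniformizer:
  assumes E: "prim E" and \<zeta>: "E xx = fls_compose_fps \<xi> \<zeta>" "\<zeta> \<noteq> 0" "fps_nth \<zeta> 0 = 0"
    and \<xi>: "int (q + 1) dvd val (\<xi> ^ (2 * m) + \<xi> ^ m)"
  shows "subdegree \<zeta> = 1"
proof -
  have hom: "hom E" by (rule prim_hom[OF E])
  obtain v where v: "v ^ (q + 1) = \<xi> ^ (2 * m) + \<xi> ^ m" using root_q1_exists[OF \<xi>] by blast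
  have "E yy ^ (q + 1) = fls_compose_fps v \<zeta> ^ (q + 1)"
  proof -
    have "fls_compose_fps v \<zeta> ^ (q + 1) = fls_compose_fps (v ^ (q + 1)) \<zeta>"
      by (rule fls_compose_fps_power[OF \<zeta>(2,3), symmetric])
    also have "\<dots> = E xx ^ (2 * m) + E xx ^ m"
      unfolding v \<zeta>(1) by (simp only: fls_compose_fps_add[OF \<zeta>(2,3)] fls_compose_fps_power[OF \<zeta>(2,3)])
    also have "\<dots> = E yy ^ (q + 1)" using hom_rel[OF hom] by (simp only: rel_def)
    finally show ?thesis ..
  qed
  then obtain e where "E yy = cst e * fls_compose_fps v \<zeta>"
    using fls_root_of_unity_const[of "E yy" "q + 1"] by auto
  hence yy: "E yy = fls_compose_fps (cst e * v) \<zeta>"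
    by (simp add: fls_compose_fps_mult[OF \<zeta>(2,3)])
  have "\<exists>h. E f = fls_compose_fps h \<zeta>" if "f \<in> F" for f
    using that
  proof induction
    case (F_const c)
    show ?case by (metis fls_compose_fps_const hom_const[OF hom])
  next
    case F_xx
    show ?case using \<zeta>(1) by blast
  next
    case F_yy
    show ?case using yy by blast
  next
    case (F_add a b)
    thus ?case by (metis fls_compose_fps_add[OF \<zeta>(2,3)] hom_add[OF hom])
  next
    case (F_mult a b)
    thus ?case by (metis fls_compose_fps_mult[OF \<zeta>(2,3)] hom_mult[OF hom])
  next
    case (F_inverse a)
    thus ?case by (metis fls_compose_fps_inverse[OF \<zeta>(2,3)] hom_inverse[OF hom])
  qed
  moreover obtain f where "f \<in> F" "val (E f) = 1" using E by (auto simp: prim_def)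
  ultimately obtain h where h: "E f = fls_compose_fps h \<zeta>" "val (E f) = 1" by blast
  have "val h * int (subdegree \<zeta>) = 1"
    using h(2) unfolding h(1) fls_subdegree_compose[OF \<zeta>(2,3)] .
  hence "int (subdegree \<zeta>) dvd 1" by (metis dvd_triv_right)
  thus ?thesis by simp
qed

lemma fps_of_fls:
  fixes b :: L
  assumes "val b > 0"
  obtains \<zeta> where "b = fps_to_fls \<zeta>" "\<zeta> \<noteq> 0" "fps_nth \<zeta> 0 = 0" "int (subdegree \<zeta>) = val b"
proof
  have "fps_to_fls (fls_regpart b) = b"
    by (rule fls_eqI) (use assms in auto)
  thus b: "b = fps_to_fls (fls_regpart b)" by simp
  have "b \<noteq> 0" using assms by auto
  thus "fls_regpart b \<noteq> 0" using b by (metis fps_zero_to_fls)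
  show "fps_nth (fls_regpart b) 0 = 0" using assms by simp
  show "int (subdegree (fls_regpart b)) = val b" using b by (metis fls_subdegree_fls_to_fps)
qed

lemma prim_uniformizer:
  assumes "prim E" "val b > 0"
    "\<And>\<zeta>. b = fps_to_fls \<zeta> \<Longrightarrow> \<zeta> \<noteq> 0 \<Longrightarrow> fps_nth \<zeta> 0 = 0 \<Longrightarrow> E xx = fls_compose_fps \<xi> \<zeta>"
    "int (q + 1) dvd val (\<xi> ^ (2 * m) + \<xi> ^ m)"
  shows "val b = 1"
proof -
  obtain \<zeta> where "b = fps_to_fls \<zeta>" "\<zeta> \<noteq> 0" "fps_nth \<zeta> 0 = 0" "int (subdegree \<zeta>) = val b"
    using fps_of_fls[OF assms(2)] .
  thus ?thesis using compose_uniformizer[OF assms(1) assms(3) _ _ assms(4)] by simp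
qed

lemma residue_decomp:
  fixes u :: L
  assumes "val u = 0" "nonconst u"
  obtains c \<eta> where "u = cst c + \<eta>" "val \<eta> > 0" "c \<noteq> 0"
proof
  define c where "c = fls_nth u 0"
  have "u \<noteq> 0" using assms(2) by (metis fls_const_0 nonconst_def)
  thus "c \<noteq> 0" unfolding c_def using assms(1) nth_fls_subdegree_nonzero[of u] by simp
  show "u = cst c + (u + cst c)" by (simp add: add.commute)
  have nz: "u + cst c \<noteq> 0" using assms(2) L_eq_iff[of u "cst c"] by (auto simp: nonconst_def)
  have "1 \<le> val (u + cst c)"
  proof (rule fls_subdegree_geI[OF nz])
    fix k :: int assume "k < 1"
    thus "fls_nth (u + cst c) k = 0" using assms(1) by (cases "k = 0") (auto simp: c_def)
  qed
  thus "val (u + cst c) > 0" by simp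
qed

text \<open>In each case of \<open>hom_cases\<close>, \<open>E xx\<close> is an explicit series in
  some \<open>b\<close> of order \<open>\<kappa>\<close> (in the unramified case, of the order of
  \<open>\<eta>\<close>), and \<open>compose_uniformizer\<close> forces that order to be 1. Where
  \<open>t\<close> is not 0, 1 or \<open>\<infinity>\<close>, \<open>t\<close> minus its value is a
  uniformizer too, as \<open>t = x^m\<close> has nonzero derivative in \<open>x\<close>.\<close>

lemma prim_cases:
  assumes "prim E"
  obtains (zero) "val (E tt) = int (q + 1)" "val (E tt + 1) = 0"
      "val (E yy) = 1" "val (E xx) = 3"
  | (one) "val (E tt) = 0" "val (E tt + 1) = int (q + 1)"
      "val (E yy) = 1" "val (E xx) = 0"
  | (unit) c e where "val (E tt) = 0" "val (E tt + 1) = 0"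
      "val (E yy) = 0" "val (E xx) = 0"
      "E tt = cst c + e" "val e = 1"
  | (infinity) "val (E tt) = - int (q + 1)" "val (E tt + 1) = - int (q + 1)"
      "val (E yy) = - 2" "val (E xx) = - 3"
proof -
  have hom: "hom E" by (rule prim_hom[OF assms])
  have nc: "nonconst (E xx)" by (rule hom_nonconst[OF hom]) (simp_all add: xx_nonconst)
  have tt: "E tt = pe (monom 1 m) (E xx)" by (simp add: hom_tt[OF hom] pe_monom)
  have tt1: "E tt + 1 = pe (monom 1 m + 1) (E xx)" by (simp add: tt pe_add)
  have three: "of_nat 3 \<noteq> (0::K)" by (simp add: of_nat_char2)
  have X3: "fls_compose_fps (fls_X ^ 3) \<zeta> = fps_to_fls \<zeta> ^ 3" if "\<zeta> \<noteq> 0" "fps_nth \<zeta> 0 = 0" for \<zeta> :: "K fps"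
    by (simp only: fls_compose_fps_power[OF that] fls_compose_fps_X)
  from hom show ?thesis
  proof (cases rule: hom_cases)
    case (zero \<kappa>)
    obtain b where b: "b ^ 3 = E xx" using fls_root_exists[OF three, of "E xx"] zero by auto
    hence "3 * val b = 3 * \<kappa>" using zero fls_subdegree_pow[of b 3] by simp
    hence b\<kappa>: "val b = \<kappa>" by simp
    have "val b = 1"
    proof (rule prim_uniformizer[OF assms, where \<xi> = "fls_X ^ 3"])
      show "val b > 0" using b\<kappa> zero(1) by simp
      fix \<zeta> assume \<zeta>: "b = fps_to_fls \<zeta>" "\<zeta> \<noteq> 0" "fps_nth \<zeta> 0 = 0"
      show "E xx = fls_compose_fps (fls_X ^ 3) \<zeta>" using X3[OF \<zeta>(2,3)] b \<zeta>(1) by simp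
    next
      show "int (q + 1) dvd val ((fls_X ^ 3 :: L) ^ (2 * m) + (fls_X ^ 3) ^ m)"
        by (simp only: rel_rhs_zero dvd_triv_left)
    qed
    thus ?thesis using that(1) zero b\<kappa> by simp
  next
    case (infinity \<kappa>)
    have nz: "E xx \<noteq> 0" using hom by (simp add: hom_nz)
    have "int 3 dvd val (inverse (E xx))" using infinity nz by (simp add: fls_inverse_subdegree)
    then obtain b where b: "b ^ 3 = inverse (E xx)" using fls_root_exists[OF three] by blast
    hence "3 * val b = 3 * \<kappa>" using infinity nz fls_subdegree_pow[of b 3] by (simp add: fls_inverse_subdegree)
    hence b\<kappa>: "val b = \<kappa>" by simp
    have "val b = 1"
    proof (rule prim_uniformizer[OF assms, where \<xi> = "inverse (fls_X ^ 3)"])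
      show "val b > 0" using b\<kappa> infinity(1) by simp
      fix \<zeta> assume \<zeta>: "b = fps_to_fls \<zeta>" "\<zeta> \<noteq> 0" "fps_nth \<zeta> 0 = 0"
      show "E xx = fls_compose_fps (inverse (fls_X ^ 3)) \<zeta>"
        using X3[OF \<zeta>(2,3)] b \<zeta>(1) by (simp only: fls_compose_fps_inverse[OF \<zeta>(2,3)]) simp
    next
      show "int (q + 1) dvd val ((inverse (fls_X ^ 3) :: L) ^ (2 * m) + inverse (fls_X ^ 3) ^ m)"
        by (simp only: rel_rhs_infinity dvd_triv_left)
    qed
    thus ?thesis using that(4) infinity b\<kappa> by simp
  next
    case (one \<kappa>)
    obtain c \<eta> where c: "E xx = cst c + \<eta>" "val \<eta> > 0" "c \<noteq> 0"
      using residue_decomp[OF one(4) nc] .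
    have cm: "c ^ m = 1"
    proof (rule ccontr)
      assume "c ^ m \<noteq> 1"
      hence "poly (monom 1 m + 1) c \<noteq> 0" using K_eq_iff by (simp add: poly_monom)
      from pe_at_unit(1)[OF c(2) this] show False using one tt1 c(1) by simp
    qed
    have "val \<eta> = val (E xx ^ (2 * m) + E xx ^ m)"
      unfolding c(1) by (rule rel_rhs_branch[OF cm c(2), symmetric])
    also have "\<dots> = int (q + 1) * \<kappa>"
      using hom_rel[OF hom] one(3) fls_subdegree_pow[of "E yy" "q + 1"] by (simp only: rel_def)
    finally have sd: "val \<eta> = int (q + 1) * \<kappa>" .
    then obtain b where b: "b ^ (q + 1) = \<eta>" using root_q1_exists[of \<eta>] by auto
    hence "int (q + 1) * val b = int (q + 1) * \<kappa>" using sd fls_subdegree_pow[of b "q + 1"] by metis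
    hence b\<kappa>: "val b = \<kappa>" by simp
    have "val b = 1"
    proof (rule prim_uniformizer[OF assms, where \<xi> = "cst c + fls_X ^ (q + 1)"])
      show "val b > 0" using b\<kappa> one(1) by simp
      fix \<zeta> assume \<zeta>: "b = fps_to_fls \<zeta>" "\<zeta> \<noteq> 0" "fps_nth \<zeta> 0 = 0"
      show "E xx = fls_compose_fps (cst c + fls_X ^ (q + 1)) \<zeta>"
        unfolding c(1) b[symmetric] \<zeta>(1)
        by (simp only: fls_compose_fps_power[OF \<zeta>(2,3)] fls_compose_fps_X fls_compose_fps_add[OF \<zeta>(2,3)] fls_compose_fps_const)
    next
      show "int (q + 1) dvd val ((cst c + fls_X ^ (q + 1)) ^ (2 * m) + (cst c + fls_X ^ (q + 1)) ^ m)"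
        using rel_rhs_branch[OF cm, of "fls_X ^ (q + 1)"] by (simp del: power_Suc)
    qed
    thus ?thesis using that(2) one b\<kappa> by simp
  next
    case unit
    obtain c \<eta> where c: "E xx = cst c + \<eta>" "val \<eta> > 0" "c \<noteq> 0"
      using residue_decomp[OF unit(4) nc] .
    have dm: "poly (pderiv (monom 1 m + [:d:])) c \<noteq> 0" for d :: K
      using c(3) m_odd by (simp add: pderiv_add pderiv_monom poly_monom of_nat_char2 pderiv_pCons)
    have cm: "c ^ m \<noteq> 1"
    proof
      assume "c ^ m = 1"
      hence "poly (monom 1 m + [:1:]) c = 0" by (simp add: poly_monom)
      from subdegree_pe_simple_root(1)[OF c(2) this dm] show False
        using unit(2) tt1 c by (simp add: one_pCons)
    qed
    have \<eta>: "val \<eta> = 1"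
    proof (rule prim_uniformizer[OF assms c(2), where \<xi> = "cst c + fls_X"])
      fix \<zeta> assume \<zeta>: "\<eta> = fps_to_fls \<zeta>" "\<zeta> \<noteq> 0" "fps_nth \<zeta> 0 = 0"
      show "E xx = fls_compose_fps (cst c + fls_X) \<zeta>"
        unfolding c(1) \<zeta>(1) by (simp only: fls_compose_fps_X fls_compose_fps_add[OF \<zeta>(2,3)] fls_compose_fps_const)
    next
      show "int (q + 1) dvd val ((cst c + fls_X) ^ (2 * m) + (cst c + fls_X) ^ m)"
        using rel_rhs_unit(1)[OF c(3) cm, of fls_X] by simp
    qed
    have "poly (monom 1 m + [:c ^ m:]) c = 0" by (simp add: poly_monom)
    from subdegree_pe_simple_root(1)[OF c(2) this dm]
    have "val (E tt + cst (c ^ m)) = 1" using \<eta> by (simp add: c(1) tt pe_add)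
    moreover have "E tt = cst (c ^ m) + (E tt + cst (c ^ m))" by (simp add: add.left_commute)
    ultimately show ?thesis using that(3) unit by blast
  qed
qed

section \<open>Automorphisms preserve the ramification points\<close>

text \<open>Singles out the places over \<open>t = 0\<close>, \<open>t = 1\<close> and
  \<open>t = \<infinity>\<close>.\<close>

definition ram :: "(L \<Rightarrow> L) \<Rightarrow> bool" where
  "ram E \<longleftrightarrow> val (E tt) \<noteq> 0 \<or> val (E tt + 1) \<noteq> 0"

lemma hom_g0: "hom E \<Longrightarrow> E g0 = (E tt ^ q + E tt ^ 2) / (E tt ^ 2 + E tt + 1)"
  by (simp add: g0_def hom_divide hom_add hom_mult hom_power hom_1)

lemma den_nz:
  assumes "hom E"
  shows "E tt ^ 2 + E tt + 1 \<noteq> 0"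
proof -
  have "pe [:1, 1, 1:] (E tt) \<noteq> 0"
    using hom_nonconst[OF assms, of tt] tt_nonconst by (intro pe_nonconst_nz) (auto simp: nonconst_def)
  thus ?thesis by (simp add: algebra_simps power2_eq_square)
qed

lemma num_nz:
  assumes "hom E"
  shows "E tt ^ q + E tt ^ 2 \<noteq> 0"
proof -
  have "coeff (monom 1 q + monom 1 2 :: K poly) 2 = 1" using q_ge by simp
  hence "monom 1 q + monom 1 2 \<noteq> (0 :: K poly)" by (metis coeff_0 zero_neq_one)
  hence "pe (monom 1 q + monom 1 2) (E tt) \<noteq> 0"
    using hom_nonconst[OF assms, of tt] tt_nonconst by (intro pe_nonconst_nz) (auto simp: nonconst_def)
  thus ?thesis by (simp add: pe_add pe_monom)
qed

lemma deriv_power_even: "even k \<Longrightarrow> fls_deriv (u ^ k :: L) = 0"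
  by (simp add: fls_deriv_power of_nat_char2)

lemma deriv_mult_even: "even k \<Longrightarrow> fls_deriv (u ^ k * f :: L) = u ^ k * fls_deriv f"
  by (simp add: deriv_power_even)

lemma deriv_g0:
  assumes "hom E"
  shows "fls_deriv (E g0) = (E tt ^ q + E tt ^ 2) / (E tt ^ 2 + E tt + 1) ^ 2 * fls_deriv (E tt)"
proof -
  let ?A = "E tt ^ q + E tt ^ 2" and ?B = "E tt ^ 2 + E tt + 1"
  have "E g0 * ?B = ?A" using den_nz[OF assms] by (simp add: hom_g0[OF assms])
  hence "fls_deriv (E g0 * ?B) = fls_deriv ?A" by simp
  also have "\<dots> = 0" using q_even by (simp add: deriv_power_even)
  finally have "fls_deriv (E g0) * ?B = E g0 * fls_deriv (E tt)"
    by (simp add: deriv_power_even L_eq_iff mult.commute add.commute)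
  hence "fls_deriv (E g0) = E g0 * fls_deriv (E tt) / ?B"
    using den_nz[OF assms] by (metis nonzero_mult_div_cancel_right)
  thus ?thesis by (simp add: hom_g0[OF assms] power2_eq_square)
qed

lemma subdegree_g0:
  assumes "hom E"
  shows "val (E g0) =
      val (E tt ^ q + E tt ^ 2) - val (E tt ^ 2 + E tt + 1)" "E g0 \<noteq> 0"
  using num_nz[OF assms] den_nz[OF assms] by (simp_all add: hom_g0[OF assms] fls_divide_subdegree)

lemma subdegree_deriv_g0:
  assumes "hom E" "fls_deriv (E tt) \<noteq> 0"
  shows "val (fls_deriv (E g0)) = val (E tt ^ q + E tt ^ 2) -
      2 * val (E tt ^ 2 + E tt + 1) + val (fls_deriv (E tt))"
    "fls_deriv (E g0) \<noteq> 0"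
  using num_nz[OF assms(1)] den_nz[OF assms(1)] assms(2)
  by (simp_all add: deriv_g0[OF assms(1)] fls_divide_subdegree fls_subdegree_pow)

lemma subdegree_num:
  fixes T :: L
  assumes "val T > 0"
  shows "val (T ^ q + T ^ 2) = 2 * val T"
proof -
  have "T \<noteq> 0" using assms by auto
  moreover have "2 * val T < int q * val T" using assms q_ge by simp
  ultimately show ?thesis using fls_subdegree_add_eq2[of "T ^ 2" "T ^ q"] by (simp add: fls_subdegree_pow)
qed

lemma subdegree_den:
  fixes T :: L
  assumes "val T > 0"
  shows "val (T ^ 2 + T + 1) = 0"
proof -
  have "val (pe [:1, 1, 1:] (cst 0 + T)) = 0" by (rule pe_at_unit(1)[OF assms]) simp
  thus ?thesis by (simp add: algebra_simps power2_eq_square)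
qed

lemma deriv_subdegree_1:
  fixes f :: L
  assumes "val f = 1"
  shows "val (fls_deriv f) = 0" "fls_deriv f \<noteq> 0"
proof -
  have "f \<noteq> 0" using assms by auto
  hence nz: "fls_nth (fls_deriv f) 0 \<noteq> 0" using nth_fls_subdegree_nonzero[of f] assms by simp
  thus "fls_deriv f \<noteq> 0" by (metis fls_zero_nth)
  have "val (fls_deriv f) \<le> 0" by (rule fls_subdegree_leI[OF nz])
  moreover have "vge 0 (fls_deriv f)" by (rule vge_deriv) (use assms in \<open>auto simp: vge_iff\<close>)
  ultimately show "val (fls_deriv f) = 0" using \<open>fls_deriv f \<noteq> 0\<close> by (simp add: vge_nz)
qed

text \<open>Only orders modulo \<open>q\<close> matter later, so a factor \<open>w^q\<close> is
  free. It is 1 over \<open>t = 0\<close> and \<open>t = 1\<close>, and \<open>t^(-q)\<close> over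
  infinity, where it makes the orders agree with the other two cases.\<close>

lemma ram_g0:
  assumes "prim E" "ram E"
  obtains w where "w \<noteq> 0" "val (w ^ q * E g0) = 2 * int q + 2"
    "val (w ^ q * fls_deriv (E g0)) = 3 * int q + 2"
proof -
  have hom: "hom E" by (rule prim_hom[OF assms(1)])
  let ?T = "E tt" and ?v = "E yy" and ?u = "E xx"
  have nz: "?T \<noteq> 0" "?v \<noteq> 0" "?u \<noteq> 0" using hom by (simp_all add: hom_nz)
  have d1: "fls_deriv ?T = ?v ^ q * fls_deriv ?v" by (rule rel_deriv[OF hom_tt_rel[OF hom]])
  from assms(1) show ?thesis
  proof (cases rule: prim_cases)
    case zero
    have A: "val (?T ^ q + ?T ^ 2) = 2 * int (q + 1)" using subdegree_num[of ?T] zero by simp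
    have B: "val (?T ^ 2 + ?T + 1) = 0" using subdegree_den[of ?T] zero by simp
    have T': "val (fls_deriv ?T) = int q" "fls_deriv ?T \<noteq> 0"
      using deriv_subdegree_1[OF zero(3)] nz by (simp_all add: d1 fls_subdegree_pow zero(3))
    show ?thesis
      by (rule that[of 1]) (simp_all add: subdegree_g0[OF hom] subdegree_deriv_g0[OF hom T'(2)] A B T')
  next
    case one
    have eq: "?T ^ q + ?T ^ 2 = (?T + 1) ^ q + (?T + 1) ^ 2" "?T ^ 2 + ?T + 1 = (?T + 1) ^ 2 + (?T + 1) + 1"
      by (simp_all add: L_power_q_add L_square_add add_ac)
    have A: "val (?T ^ q + ?T ^ 2) = 2 * int (q + 1)"
      unfolding eq(1) using subdegree_num[of "?T + 1"] one by simp
    have B: "val (?T ^ 2 + ?T + 1) = 0"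
      unfolding eq(2) using subdegree_den[of "?T + 1"] one by simp
    have T': "val (fls_deriv ?T) = int q" "fls_deriv ?T \<noteq> 0"
      using deriv_subdegree_1[OF one(3)] nz by (simp_all add: d1 fls_subdegree_pow one(3))
    show ?thesis
      by (rule that[of 1]) (simp_all add: subdegree_g0[OF hom] subdegree_deriv_g0[OF hom T'(2)] A B T')
  next
    case (unit c e)
    thus ?thesis using assms(2) by (simp add: ram_def)
  next
    case infinity
    have N: "val ?T = - (int q + 1)" using infinity(1) by simp
    have A: "val (?T ^ q + ?T ^ 2) = - (int q * (int q + 1))"
    proof -
      have "int q * val ?T < 2 * val ?T" using N q_ge
        by (intro mult_strict_right_mono_neg) simp_all
      thus ?thesis using fls_subdegree_add_eq1[of "?T ^ q" "?T ^ 2"] nz N by (simp add: fls_subdegree_pow algebra_simps)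
    qed
    have B: "val (?T ^ 2 + ?T + 1) = - (2 * (int q + 1))"
    proof -
      have "val (pe [:1, 1, 1:] ?T) = - (2 * (int q + 1))"
        using subdegree_pe_neg[of ?T "[:1, 1, 1:]"] N by simp
      thus ?thesis by (simp add: algebra_simps power2_eq_square)
    qed
    have vu: "val (?v / ?u) = 1" using infinity nz by (simp add: fls_divide_subdegree)
    have T': "val (fls_deriv ?T) = - int q - 2" "fls_deriv ?T \<noteq> 0"
      unfolding rel_deriv_inverse[OF hom_tt_rel[OF hom] hom_xx_tt[OF hom] nz(1)]
      using deriv_subdegree_1[OF vu] nz vu N by (simp_all add: fls_subdegree_pow del: fls_deriv_mult)
    have iT: "val (inverse ?T ^ q) = int q * (int q + 1)"
      using nz N by (simp add: fls_subdegree_pow)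
    have iTnz: "inverse ?T ^ q \<noteq> 0" using nz by simp
    show ?thesis
    proof (rule that[of "inverse ?T"])
      show "inverse ?T \<noteq> 0" using nz by simp
      show "val (inverse ?T ^ q * E g0) = 2 * int q + 2"
        by (simp only: fls_subdegree_mult[OF iTnz subdegree_g0(2)[OF hom]] subdegree_g0(1)[OF hom] iT A B)
          (simp add: algebra_simps)
      show "val (inverse ?T ^ q * fls_deriv (E g0)) = 3 * int q + 2"
        by (simp only: fls_subdegree_mult[OF iTnz subdegree_deriv_g0(2)[OF hom T'(2)]]
            subdegree_deriv_g0(1)[OF hom T'(2)] iT A B T') (simp add: algebra_simps)
    qed
  qed
qed

text \<open>Here \<open>t - c\<close> is a uniformizer. The numerator of \<open>g0\<close> is the
  square of \<open>t^h + t\<close> with \<open>q = 2 h\<close>, and \<open>h\<close> is even, so its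
  roots are simple; so are those of \<open>t^2 + t + 1\<close>. The numerator thus has order 0 or 2
  and the denominator 0 or 1.\<close>

lemma unram_g0:
  assumes "prim E" "\<not> ram E"
  shows "fls_deriv (E g0) \<noteq> 0" "val (fls_deriv (E g0)) \<in> {-2, 0, 2}"
    and "val (fls_deriv (E g0)) = 2 \<Longrightarrow> val (E g0) = 2"
proof -
  have hom: "hom E" by (rule prim_hom[OF assms(1)])
  let ?T = "E tt"
  obtain c e where ce: "?T = cst c + e" "val e = 1"
    using assms(1)
  proof (cases rule: prim_cases)
    case (unit c e) thus ?thesis using that by blast
  qed (use assms(2) in \<open>simp_all add: ram_def\<close>)
  obtain h where h: "q = 2 * h" by (rule q_half)
  have "2 * h = 2 * 2 ^ (n - 1)" using h q_def n5 by (cases n) auto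
  hence h8: "even h" "h > 0" using n5 by auto
  let ?A = "?T ^ q + ?T ^ 2" and ?B = "?T ^ 2 + ?T + 1"
  have e0: "val e > 0" using ce by simp
  have Apow: "?A = pe (monom 1 h + [:0, 1:]) ?T ^ 2"
    by (simp add: pe_add pe_monom L_square_add power_mult[symmetric] h mult.commute)
  have A: "val (pe (monom 1 h + [:0, 1:]) ?T) \<in> {0, 1}"
  proof (cases "poly (monom 1 h + [:0, 1:]) c = 0")
    case True
    have "poly (pderiv (monom 1 h + [:0, 1:])) c \<noteq> 0"
      using h8 by (simp add: pderiv_add pderiv_monom poly_monom of_nat_char2 pderiv_pCons)
    from subdegree_pe_simple_root(1)[OF e0 True this] show ?thesis using ce by simp
  next
    case False
    from pe_at_unit(1)[OF e0 this] show ?thesis using ce by simp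
  qed
  have B': "?B = pe [:1, 1, 1:] ?T" by (simp add: algebra_simps power2_eq_square)
  have B: "val ?B \<in> {0, 1}"
  proof (cases "poly [:1, 1, 1:] c = 0")
    case True
    have "poly (pderiv [:1, 1, 1:]) c \<noteq> 0" by (simp add: pderiv_pCons)
    from subdegree_pe_simple_root(1)[OF e0 True this] show ?thesis using ce unfolding B' by simp
  next
    case False
    from pe_at_unit(1)[OF e0 this] show ?thesis using ce unfolding B' by simp
  qed
  have T': "val (fls_deriv ?T) = 0" "fls_deriv ?T \<noteq> 0"
    using deriv_subdegree_1[OF ce(2)] by (simp_all add: ce(1))
  have sA: "val ?A = 2 * val (pe (monom 1 h + [:0, 1:]) ?T)"
    unfolding Apow by (simp add: fls_subdegree_pow)
  have sd: "val (fls_deriv (E g0)) = val ?A - 2 * val ?B"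
    by (simp add: subdegree_deriv_g0[OF hom T'(2)] T')
  have sg: "val (E g0) = val ?A - val ?B"
    by (rule subdegree_g0(1)[OF hom])
  show "fls_deriv (E g0) \<noteq> 0" by (rule subdegree_deriv_g0(2)[OF hom T'(2)])
  show "val (fls_deriv (E g0)) \<in> {-2, 0, 2}" using A B unfolding sd sA by auto
  show "val (E g0) = 2" if "val (fls_deriv (E g0)) = 2"
    using A B that unfolding sd sg sA by auto
qed

text \<open>At a point of \<open>ram\<close> the order of \<open>d g0\<close> is \<open>2\<close> modulo \<open>q\<close>. At another place this forces both \<open>g0\<close>
  and \<open>d g0\<close> to have order \<open>2\<close>, which \<open>\<alpha>^q g0 + \<beta>^q\<close> cannot achieve at a point of \<open>ram\<close>.\<close>

lemma ram_aut:
  assumes "prim E" "ram E" "aut s"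
  shows "ram (\<lambda>f. E (s f))"
proof (rule ccontr)
  assume nr: "\<not> ram (\<lambda>f. E (s f))"
  note hom = prim_hom[OF assms(1)]
  note un = unram_g0[OF prim_aut[OF assms(1,3)] nr]
  obtain \<alpha> \<beta> where ab: "\<alpha> \<in> F" "\<beta> \<in> F" "s g0 = \<alpha> ^ q * g0 + \<beta> ^ q" by (rule aut_g0[OF assms(3)])
  obtain w where w: "w \<noteq> 0" "val (w ^ q * E g0) = 2 * int q + 2"
    "val (w ^ q * fls_deriv (E g0)) = 3 * int q + 2" by (rule ram_g0[OF assms(1,2)])
  define z where "z = E \<alpha> / w"
  have za: "E \<alpha> ^ q = z ^ q * w ^ q" using w(1) by (simp add: z_def power_divide)
  have sg: "E (s g0) = z ^ q * (w ^ q * E g0) + E \<beta> ^ q"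
    using ab by (simp add: hom_add[OF hom] hom_mult[OF hom] hom_power[OF hom] za)
  have d: "fls_deriv (E (s g0)) = z ^ q * (w ^ q * fls_deriv (E g0))"
    unfolding sg using q_even by (simp add: deriv_mult_even deriv_power_even del: fls_deriv_mult)
  with un(1) have z: "z \<noteq> 0" "w ^ q * fls_deriv (E g0) \<noteq> 0" using q_ge by auto
  have "val (fls_deriv (E (s g0))) = int q * val z + (3 * int q + 2)"
    unfolding d using z w(3) by (simp add: fls_subdegree_pow)
  also have "\<dots> = int q * (val z + 3) + 2" by (simp add: algebra_simps)
  finally have sd: "val (fls_deriv (E (s g0))) = int q * (val z + 3) + 2" .
  \<comment> \<open>The order \<open>q (val z + 3) + 2\<close> must be -2, 0 or 2, which for
    \<open>q \<ge> 32\<close> leaves only the zero multiple of \<open>q\<close>.\<close>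
  have z3: "val z + 3 = 0"
  proof (rule ccontr)
    assume "val z + 3 \<noteq> 0"
    hence "val z + 3 \<ge> 1 \<or> val z + 3 \<le> -1" by linarith
    hence "int q * (val z + 3) \<ge> int q \<or> int q * (val z + 3) \<le> - int q"
      using mult_left_mono[of 1 "val z + 3" "int q"] mult_left_mono[of "val z + 3" "-1" "int q"] by linarith
    moreover have "int q * (val z + 3) \<in> {-4, -2, 0}" using sd un(2) by auto
    ultimately show False using q_ge by fastforce
  qed
  hence "val (E (s g0)) = 2" using sd un(3) by simp
  \<comment> \<open>The first summand has order \<open>-3 q + 2 q + 2 = 2 - q\<close>. The order of
    \<open>E \<beta> ^ q\<close> is a multiple of \<open>q\<close>, hence different, so no
    cancellation can raise the order to 2.\<close>
  moreover have "val (E (s g0)) \<le> 2 - int q"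
  proof -
    let ?G = "z ^ q * (w ^ q * E g0)"
    have "w ^ q * E g0 \<noteq> 0"
    proof
      assume "w ^ q * E g0 = 0"
      thus False using w(2) by (simp only: fls_zero_subdegree)
    qed
    hence G: "?G \<noteq> 0" "val ?G = 2 - int q"
    proof -
      assume wg: "w ^ q * E g0 \<noteq> 0"
      have zq: "z ^ q \<noteq> 0" using z(1) by simp
      show "?G \<noteq> 0" using zq wg by simp
      have "val z = -3" using z3 by simp
      thus "val ?G = 2 - int q"
        by (simp only: fls_subdegree_mult[OF zq wg] w(2) fls_subdegree_pow)
    qed
    have b: "val (E \<beta> ^ q) = int q * val (E \<beta>)" by (simp add: fls_subdegree_pow)
    have ne: "int q * val (E \<beta>) \<noteq> 2 - int q"
    proof
      assume "int q * val (E \<beta>) = 2 - int q"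
      hence "2 = int q * (val (E \<beta>) + 1)" by (simp add: algebra_simps)
      hence "int q dvd 2" by (rule dvdI)
      thus False using q_ge zdvd_imp_le[of "int q" 2] by simp
    qed
    show ?thesis
    proof (cases "E \<beta> = 0")
      case True
      hence "E \<beta> ^ q = 0" using q_ge by simp
      thus ?thesis unfolding sg by (simp only: add_0_right G(2))
    next
      case False
      have "val ?G < val (E \<beta> ^ q) \<or> val (E \<beta> ^ q) < val ?G"
        using ne unfolding b G(2) by linarith
      thus ?thesis
        unfolding sg using fls_subdegree_add_eq1[OF G(1)] fls_subdegree_add_eq2[of "E \<beta> ^ q" ?G] False G(2) by auto
    qed
  qed
  ultimately show False using q_ge by simp
qed

lemma ram_aut_iff:
  assumes "prim E" "aut s"
  shows "ram (\<lambda>f. E (s f)) \<longleftrightarrow> ram E"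
proof
  assume r: "ram (\<lambda>f. E (s f))"
  obtain u where u: "aut u" "\<And>f. f \<in> F \<Longrightarrow> s (u f) = f" using aut_inverse[OF assms(2)] by metis
  have "ram (\<lambda>f. E (s (u f)))" using ram_aut[OF prim_aut[OF assms] r u(1)] .
  thus "ram E" by (simp add: ram_def u(2))
qed (rule ram_aut[OF assms(1) _ assms(2)])

text \<open>The Riemann--Roch space of the sum of the ramification points.\<close>

definition Msp :: "L set" where
  "Msp = {f \<in> F. \<forall>E. prim E \<longrightarrow> vge (if ram E then -1 else 0) (E f)}"

lemma Msp_aut:
  assumes "aut s" "f \<in> Msp"
  shows "s f \<in> Msp"
  unfolding Msp_def
proof (intro CollectI conjI allI impI)
  show "s f \<in> F" using assms by (auto simp: Msp_def aut_F)
  fix E assume E: "prim E"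
  have "vge (if ram (\<lambda>f. E (s f)) then -1 else 0) (E (s f))"
    using assms(2) prim_aut[OF E assms(1)] unfolding Msp_def by blast
  thus "vge (if ram E then - 1 else 0) (E (s f))" by (simp only: ram_aut_iff[OF E assms(1)])
qed

text \<open>For a function with the orders of \<open>x^i y^j\<close>, the inequalities say that the
  pole order is at most 1 over \<open>t = 0\<close>, \<open>t = 1\<close> and
  \<open>t = \<infinity>\<close>.\<close>

lemma MspI:
  assumes "f \<in> F" "f \<noteq> 0"
    "\<And>E. prim E \<Longrightarrow> val (E f) = i * val (E xx) + j * val (E yy)"
    "3 * i + j \<ge> -1" "j \<ge> -1" "3 * i + 2 * j \<le> 1"
  shows "f \<in> Msp"
  unfolding Msp_def
proof (intro CollectI conjI allI impI)
  fix E assume E: "prim E"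
  have nz: "E f \<noteq> 0" by (rule hom_nz[OF prim_hom[OF E] assms(1,2)])
  note sd = assms(3)[OF E]
  from E show "vge (if ram E then - 1 else 0) (E f)"
  proof (cases rule: prim_cases)
    case (unit c e)
    thus ?thesis using nz by (simp add: ram_def vge_nz sd)
  qed (use nz sd assms(4-6) in \<open>simp_all add: ram_def vge_nz\<close>)
qed (rule assms(1))

lemma Msp_basis: "xx / yy \<in> Msp" "1 / yy \<in> Msp" "yy ^ 2 / xx \<in> Msp"
proof -
  have nz: "E xx \<noteq> 0" "E yy \<noteq> 0" if "prim E" for E
    using prim_hom[OF that] by (simp_all add: hom_nz)
  show "xx / yy \<in> Msp" by (rule MspI[where i = 1 and j = "-1"])
    (use nz in \<open>simp_all add: prim_hom hom_divide fls_divide_subdegree\<close>)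
  show "1 / yy \<in> Msp" by (rule MspI[where i = 0 and j = "-1"])
    (use nz in \<open>simp_all add: prim_hom hom_divide hom_1 fls_divide_subdegree\<close>)
  show "yy ^ 2 / xx \<in> Msp" by (rule MspI[where i = "-1" and j = 2])
    (use nz in \<open>simp_all add: prim_hom hom_divide hom_power fls_divide_subdegree fls_subdegree_pow\<close>)
qed

text \<open>Each test embedding of \<open>F_span_expand\<close> turns out to be primitive, so the
  bounds of \<open>Msp\<close> apply to it; the inequalities on the exponents then leave exactly
  four monomials.\<close>

lemma Msp_expand:
  assumes f: "f \<in> Msp"
  shows "\<exists>c0 c1 c2 c3. f = cst c0 + cst c1 * (xx / yy) + cst c2 * (1 / yy) + cst c3 * (yy ^ 2 / xx)"
proof -
  let ?g = "\<lambda>c0 c1 c2 c3. cst c0 + cst c1 * (xx / yy) + cst c2 * (1 / yy) + cst c3 * (yy ^ 2 / xx)"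
  define S where "S = {f. \<exists>c0 c1 c2 c3. f = ?g c0 c1 c2 c3}"
  have fF: "f \<in> F" and M: "\<And>E. prim E \<Longrightarrow> vge (if ram E then -1 else 0) (E f)"
    using f by (auto simp: Msp_def)
  have M1: "vge (-1) (E f)" if "prim E" for E
    using M[OF that] by (auto split: if_splits elim: vge_mono)
  have gS: "?g c0 c1 c2 c3 \<in> S" for c0 c1 c2 c3 unfolding S_def by blast
  have "f \<in> S"
  proof (rule F_span_expand[OF fF, where ?B1.0 = "-1" and ?B0.0 = "-1" and Bi = "-1"])
    show "0 \<in> S" using gS[of 0 0 0 0] by simp
    show "a + b \<in> S" if ab: "a \<in> S" "b \<in> S" for a b
    proof -
      obtain a0 a1 a2 a3 b0 b1 b2 b3 where "a = ?g a0 a1 a2 a3" "b = ?g b0 b1 b2 b3" using ab unfolding S_def by blast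
      hence "a + b = ?g (a0 + b0) (a1 + b1) (a2 + b2) (a3 + b3)"
        by (simp only: fls_plus_const[symmetric] distrib_right add_ac)
      thus ?thesis using gS by simp
    qed
    show "vge 0 (E f)" if h: "hom E" "E xx = cst c + fls_X" "c \<noteq> 0" "c ^ m \<noteq> 1" for E c
    proof -
      have "E (xx + cst c) = fls_X"
        using h by (simp add: hom_add[OF h(1)] hom_const[OF h(1)] add_ac)
      hence "val (E (xx + cst c)) = 1" by simp
      hence p: "prim E" unfolding prim_def using h(1) F_add F_xx F_const by blast
      have tt1: "E tt = pe (monom 1 m) (E xx)" "E tt + 1 = pe (monom 1 m + 1) (E xx)"
        by (simp_all add: hom_tt[OF h(1)] pe_add pe_monom)
      have "poly (monom 1 m) c \<noteq> 0" using h(3) by (simp add: poly_monom)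
      moreover have "poly (monom 1 m + 1) c \<noteq> 0" using h(4) K_eq_iff by (simp add: poly_monom)
      ultimately have "val (E tt) = 0" "val (E tt + 1) = 0"
        using pe_at_unit(1)[of "fls_X :: L" "monom 1 m" c] pe_at_unit(1)[of "fls_X :: L" "monom 1 m + 1" c]
        by (simp_all only: tt1(2), simp_all only: tt1(1) h(2), simp_all)
      hence "\<not> ram E" by (simp add: ram_def)
      thus ?thesis using M[OF p] by simp
    qed
    show "vge (-1) (E f)" if h: "hom E" "E xx = cst c + fls_X ^ (q + 1)" "c ^ m = 1" for E c
    proof (rule M1)
      have "int (q + 1) * val (E yy) = int (q + 1) * 1"
        using hom_rel[OF h(1)] rel_rhs_branch[OF h(3), of "fls_X ^ (q + 1)"] fls_subdegree_pow[of "E yy" "q + 1"]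
        by (simp only: rel_def h(2)) simp
      hence "val (E yy) = 1" by simp
      thus "prim E" unfolding prim_def using h(1) F_yy by blast
    qed
    show "vge (-1) (E f)" if h: "hom E" "E xx = fls_X ^ 3" for E
    proof (rule M1)
      have "val (E xx) = 3" using h(2) by simp
      with h(1) have "val (E yy) = 1" by (cases rule: hom_cases) auto
      thus "prim E" unfolding prim_def using h(1) F_yy by blast
    qed
    show "vge (-1) (E f)" if h: "hom E" "E xx = inverse (fls_X ^ 3)" for E
    proof (rule M1)
      have su: "val (E xx) = -3" unfolding h(2) by (rule inverse_X3_subdegree)
      with h(1) have "val (E yy) = -2" by (cases rule: hom_cases) auto
      hence "val (E (yy / xx)) = 1"
        using su h(1) by (simp add: hom_divide fls_divide_subdegree hom_nz)
      thus "prim E" unfolding prim_def using h(1) F_yy F_xx F_divide by blast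
    qed
    fix c i j s and e :: nat
    assume h: "j \<le> q" "e \<le> 1" "e = 1 \<Longrightarrow> int (q + 1) + - 1 \<le> int j"
      "3 * int s \<le> int j - - 1" "3 * int i \<le> 3 * int s + int (q + 1) * int e - 2 * int j - - 1"
    show "cst c * (xx ^ i * yy ^ j / (xx ^ s * (tt + 1) ^ e)) \<in> S"
    proof (cases "e = 0")
      case True
      \<comment> \<open>The bounds \<open>3 s \<le> j + 1\<close> and
        \<open>3 i \<le> 3 s - 2 j + 1\<close> give \<open>j \<le> 2\<close>, and
        \<open>j = 1\<close> forces \<open>s = 0\<close> and a negative \<open>i\<close>. The
        solutions are 1 and \<open>y^2 / x\<close>.\<close>
      hence "(j = 0 \<and> s = 0 \<and> i = 0) \<or> (j = 2 \<and> s = 1 \<and> i = 0)" using h(4,5) by presburger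
      thus ?thesis using gS[of c 0 0 0] gS[of 0 0 0 c] True by auto
    next
      case False
      hence e: "e = 1" using h(2) by simp
      \<comment> \<open>Now \<open>s \<le> m\<close> and \<open>i \<le> s - m + 1\<close>; the three
        solutions reduce to \<open>1/y\<close> or \<open>x/y\<close> through
        \<open>x^m (t + 1) = y^(q+1)\<close>.\<close>
      have j: "j = q" using h(1) h(3)[OF e] by simp
      have xm: "xx ^ m * (tt + 1) = yy ^ q * yy" using tt_yy by (simp add: tt_def mult.commute)
      have c1: "yy ^ q / (xx ^ m * (tt + 1)) = 1 / yy" unfolding xm by simp
      consider "s = m" "i = 0" | "s = m" "i = 1" | "m = s + 1" "i = 0"
        using h(4,5) q1 unfolding e j by fastforce
      hence "xx ^ i * yy ^ j / (xx ^ s * (tt + 1) ^ e) = 1 / yy \<or>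
          xx ^ i * yy ^ j / (xx ^ s * (tt + 1) ^ e) = xx / yy"
      proof cases
        case 1
        thus ?thesis using c1 by (simp only: e j power_0 power_one_right mult_1_left) simp
      next
        case 2
        have "xx * yy ^ q / (xx ^ m * (tt + 1)) = xx * (1 / yy)" by (simp only: c1[symmetric]) simp
        thus ?thesis using 2 by (simp only: e j power_one_right) simp
      next
        case 3
        have "xx ^ m = xx ^ s * xx" by (subst 3(1)) simp
        hence "yy ^ q * yy = xx * (xx ^ s * (tt + 1))" using xm by (simp add: mult_ac)
        hence "yy ^ q / (xx ^ s * (tt + 1)) = xx / yy" by (subst frac_eq_eq) simp_all
        thus ?thesis using 3(2) by (simp only: e j power_0 power_one_right mult_1_left) simp
      qed
      moreover have "cst c * (1 / yy) \<in> S" "cst c * (xx / yy) \<in> S"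
        using gS[of 0 0 c 0] gS[of 0 c 0 0] by simp_all
      ultimately show ?thesis by metis
    qed
  qed (use q_ge in simp_all)
  thus ?thesis unfolding S_def by blast
qed

end

section \<open>The linear series of the ramification points\<close>

text \<open>For a monomial the multiplicity of the root 0 equals the degree. Both are additive over
  factors and the first never exceeds the second, so equality passes to each factor.\<close>

lemma monom_factor:
  fixes f g :: "'a::idom poly"
  assumes "f * g = monom c k" "c \<noteq> 0"
  obtains d i where "f = monom d i"
proof -
  have nz: "f \<noteq> 0" "g \<noteq> 0" using assms by auto
  have "ordp 0 f + ordp 0 g = k"
    using order_mult[of f g 0] assms nz by simp
  moreover have "degree f + degree g = k"
    using degree_mult_eq[OF nz] assms by (simp add: degree_monom_eq)
  moreover have "ordp 0 f \<le> degree f" "ordp 0 g \<le> degree g"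
    using nz by (auto intro: order_degree)
  ultimately have eq: "ordp 0 f = degree f" by linarith
  have "[:- 0, 1:] ^ degree f dvd f" using order_1[of 0 f] eq by simp
  then obtain r where r: "f = monom 1 (degree f) * r"
    by (auto simp: monom_altdef elim: dvdE)
  hence "r \<noteq> 0" using nz by auto
  hence "degree f = degree f + degree r" using r degree_mult_eq[of "monom 1 (degree f)" r]
    by (simp add: degree_monom_eq)
  then obtain d where "r = [:d:]" by (metis add_cancel_left_right degree_eq_zeroE)
  hence "f = monom d (degree f)" using r by (simp add: smult_monom mult.commute[of _ "[:d:]"])
  thus ?thesis by (rule that)
qed

lemma monom_factor3:
  fixes f g h :: "'a::idom poly"
  assumes "f * g * h = monom c k" "c \<noteq> 0"
  obtains d1 d2 d3 i1 i2 i3 where "f = monom d1 i1" "g = monom d2 i2" "h = monom d3 i3"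
    "d1 * d2 * d3 = c" "i1 + i2 + i3 = k"
proof -
  obtain d1 i1 where f: "f = monom d1 i1" using monom_factor[of f "g * h" c k] assms by (metis mult.assoc)
  obtain d2 i2 where g: "g = monom d2 i2" using monom_factor[of g "f * h" c k] assms by (metis mult.assoc mult.commute)
  obtain d3 i3 where h: "h = monom d3 i3" using monom_factor[of h "f * g" c k] assms by (metis mult.commute)
  have eq: "monom (d1 * d2 * d3) (i1 + i2 + i3) = monom c k"
    using assms(1) unfolding f g h by (simp add: mult_monom)
  hence "d1 * d2 * d3 \<noteq> 0" using assms(2) by (metis monom_eq_0_iff)
  hence "i1 + i2 + i3 = k" "d1 * d2 * d3 = c"
    using eq assms(2) by (metis degree_monom_eq, metis degree_monom_eq coeff_monom)
  thus ?thesis using that f g h by blast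
qed

context curve
begin

text \<open>Coefficients are kept in \<open>K[x]\<close> instead of \<open>K(x)\<close>, so that
  \<open>monom_factor3\<close> can be applied first in \<open>y\<close> and then in
  \<open>x\<close>.\<close>

definition ev2 :: "K poly poly \<Rightarrow> L" where
  "ev2 B = poly (map_poly (\<lambda>c. pe c xx) B) yy"

lemma ev2_0 [simp]: "ev2 0 = 0"
  by (simp add: ev2_def)

lemma ev2_pCons [simp]: "ev2 (pCons c B) = pe c xx + yy * ev2 B"
  by (simp add: ev2_def map_poly_pCons)

lemma ev2_add: "ev2 (A + B) = ev2 A + ev2 B"
  by (induction A B rule: poly_induct2) (simp_all add: pe_add algebra_simps)

lemma ev2_smult: "ev2 (smult c B) = pe c xx * ev2 B"
  by (induction B) (simp_all add: pe_mult algebra_simps)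

lemma ev2_mult: "ev2 (A * B) = ev2 A * ev2 B"
  by (induction A) (simp_all add: ev2_add ev2_smult algebra_simps)

lemma ev2_monom: "ev2 (monom c k) = pe c xx * yy ^ k"
  by (induction k) (simp_all add: monom_0 monom_Suc algebra_simps)

lemma ev2_eq_0:
  assumes "ev2 B = 0" "degree B < q + 1"
  shows "B = 0"
proof -
  let ?f = "\<lambda>c. Fract c 1 :: RF"
  have f0: "?f 0 = 0" by (simp add: Zero_fract_def)
  have "ev0 (map_poly ?f B) = ev2 B"
    by (induction B) (simp_all add: map_poly_pCons f0 ev0_0 ev0_pCons
      evx_Fract)
  moreover have "degree (map_poly ?f B) < q + 1" using assms(2) map_poly_degree_leq[of ?f B] by (simp add: f0)
  ultimately have "map_poly ?f B = 0" using assms(1) ev0_eq_0 by simp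
  hence "?f (coeff B i) = 0" for i using coeff_map_poly[of ?f, OF f0, of B i] by simp
  hence "coeff B i = 0" for i by (simp add: Zero_fract_def eq_fract)
  thus "B = 0" by (simp add: poly_eq_iff)
qed

definition pp :: L where "pp = xx / yy"
definition ss :: L where "ss = 1 / yy"
definition ww :: L where "ww = yy ^ 2 / xx"

lemma psw_F [simp]: "pp \<in> F" "ss \<in> F" "ww \<in> F"
  by (simp_all add: pp_def ss_def ww_def)

lemma psw_nz [simp]: "pp \<noteq> 0" "ss \<noteq> 0" "ww \<noteq> 0"
  by (simp_all add: pp_def ss_def ww_def)

lemma psw_prod: "pp * ss * ww = 1"
  by (simp add: pp_def ss_def ww_def power2_eq_square)

lemma xx_psw: "xx = pp / ss" and yy_psw: "yy = 1 / ss"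
  by (simp_all add: pp_def ss_def)

lemma psw_fermat: "pp ^ m + ss ^ m + ww ^ m = 0"
proof -
  have y3: "yy ^ m * yy ^ (2 * m) = xx ^ m * (xx ^ m + 1)"
  proof -
    have "yy ^ m * yy ^ (2 * m) = yy ^ (q + 1)" unfolding q1 power_add[symmetric] by simp
    thus ?thesis using tt_yy by (simp add: tt_def)
  qed
  have "ww ^ m = (xx ^ m + 1) / yy ^ m"
    unfolding ww_def power_divide power_mult[symmetric]
    using y3 by (subst frac_eq_eq) (simp_all add: mult_ac)
  thus ?thesis by (simp add: pp_def ss_def power_divide add_divide_distrib add_ac)
qed

lemma psw_subdegree: "val pp = -1" "val ss = -1" "val ww = 2"
  by (simp_all add: pp_def ss_def ww_def fls_divide_subdegree fls_subdegree_pow xx_subdegree yy_subdegree)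

lemma psw_nonconst: "nonconst pp" "nonconst ss" "nonconst ww"
  by (rule nonconst_subdegree; simp add: psw_subdegree)+

lemma psw_ratio_nonconst: "nonconst (pp / ss)" "nonconst (pp / ww)" "nonconst (ss / ww)"
proof -
  show "nonconst (pp / ss)" using xx_nonconst by (simp add: xx_psw[symmetric])
  show "nonconst (pp / ww)" by (rule nonconst_subdegree) (simp add: fls_divide_subdegree psw_subdegree)
  show "nonconst (ss / ww)" by (rule nonconst_subdegree) (simp add: fls_divide_subdegree psw_subdegree)
qed

definition lin :: "K \<Rightarrow> K \<Rightarrow> K \<Rightarrow> K \<Rightarrow> L" where
  "lin a b c d = cst a + cst b * pp + cst c * ss + cst d * ww"

text \<open>\<open>x y (a + b p + c s + d w)\<close> as a polynomial in \<open>y\<close> over \<open>K[x]\<close>. In the product of three such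
  polynomials \<open>y\<close> has degree at most \<open>9 \<le> q\<close>, so \<open>s(p) s(s) s(w) = 1\<close> becomes an identity of
  polynomials, and the factors of the monomial \<open>x^3 y^3\<close> are monomials.\<close>

definition linB :: "K \<Rightarrow> K \<Rightarrow> K \<Rightarrow> K \<Rightarrow> K poly poly" where
  "linB a b c d = [:[:0, c, b:], [:0, a:], 0, [:d:]:]"

lemma ev2_linB: "ev2 (linB a b c d) = xx * yy * lin a b c d"
proof -
  have "xx * yy * lin a b c d = cst a * (xx * yy) + cst b * (xx * yy * pp) +
      cst c * (xx * yy * ss) + cst d * (xx * yy * ww)"
    by (simp add: lin_def algebra_simps)
  moreover have "xx * yy * pp = xx * xx" "xx * yy * ss = xx" "xx * yy * ww = yy * yy * yy"
    by (simp_all add: pp_def ss_def ww_def power2_eq_square)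
  ultimately show ?thesis by (simp add: linB_def algebra_simps)
qed

text \<open>The four coefficients of \<open>linB\<close> sit at different monomials
  \<open>x y\<close>, \<open>x^2\<close>, \<open>x\<close>, \<open>y^3\<close>, so a single monomial
  leaves exactly one of them.\<close>

lemma linB_shape:
  assumes "linB a b c d = monom (monom e k) i" "e \<noteq> 0"
  shows "(k = 1 \<and> i = 1 \<and> lin a b c d = cst e) \<or>
    (k = 2 \<and> i = 0 \<and> lin a b c d = cst e * pp) \<or>
    (k = 1 \<and> i = 0 \<and> lin a b c d = cst e * ss) \<or>
    (k = 0 \<and> i = 3 \<and> lin a b c d = cst e * ww)"
proof -
  have co: "coeff (coeff (linB a b c d) u) v = (if u = i \<and> v = k then e else 0)" for u v
    unfolding assms(1) by simp
  have "coeff (coeff (linB a b c d) i) k = e" using co[of i k] by simp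
  hence cases: "(i = 0 \<and> k = 1) \<or> (i = 0 \<and> k = 2) \<or> (i = 1 \<and> k = 1) \<or> (i = 3 \<and> k = 0)"
    using assms(2) by (auto simp: linB_def coeff_pCons split: nat.splits)
  have vals: "c = (if 0 = i \<and> 1 = k then e else 0)" "b = (if 0 = i \<and> 2 = k then e else 0)"
    "a = (if 1 = i \<and> 1 = k then e else 0)" "d = (if 3 = i \<and> 0 = k then e else 0)"
    using co[of 0 1] co[of 0 2] co[of 1 1] co[of 3 0]
    by (simp_all add: linB_def numeral_2_eq_2 numeral_3_eq_3)
  show ?thesis using cases vals by (auto simp: lin_def)
qed

lemma lin_prod:
  assumes "lin a1 b1 c1 d1 * lin a2 b2 c2 d2 * lin a3 b3 c3 d3 = 1"
  shows "linB a1 b1 c1 d1 * linB a2 b2 c2 d2 * linB a3 b3 c3 d3 = monom (monom 1 3) 3"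
    (is "?P = ?M")
proof -
  have dl: "degree (linB a b c d) \<le> 3" for a b c d
    by (rule degree_le) (auto simp: linB_def coeff_pCons split: nat.splits)
  have "degree ?P \<le> 9"
    by (rule order.trans[OF degree_mult_le], rule order.trans[OF add_mono[OF order.trans[OF degree_mult_le add_mono[OF dl dl]] dl]]) simp
  moreover have "degree ?M \<le> 9" by (rule order.trans[OF degree_monom_le]) simp
  ultimately have "degree (?P - ?M) \<le> 9" by (rule degree_diff_le)
  hence deg: "degree (?P - ?M) < q + 1" using q_ge by simp
  have "ev2 ?P = (xx * yy) ^ 3 * (lin a1 b1 c1 d1 * lin a2 b2 c2 d2 * lin a3 b3 c3 d3)"
    by (simp only: ev2_mult ev2_linB power3_eq_cube mult_ac)
  also have "\<dots> = ev2 ?M" by (simp add: assms ev2_monom pe_monom power_mult_distrib)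
  finally have "ev2 (?P - ?M) = 0"
    using ev2_add[of "?P - ?M" ?M] by (metis add_cancel_left_left diff_add_cancel)
  hence "?P - ?M = 0" using ev2_eq_0 deg by blast
  thus ?thesis by simp
qed

definition perms :: "(L \<times> L \<times> L) set" where
  "perms = {(pp, ss, ww), (ss, pp, ww), (ww, pp, ss), (ss, ww, pp), (ww, ss, pp), (pp, ww, ss)}"

lemma perms_ratio:
  assumes "(f, g, h) \<in> perms"
  shows "nonconst (f / h)" "nonconst (g / h)" "f \<noteq> 0" "g \<noteq> 0" "h \<noteq> 0" "f ^ m + g ^ m + h ^ m = 0" "f * g * h = 1"
proof -
  have inv: "nonconst (a / b) \<Longrightarrow> nonconst (b / a)" for a b :: L
    unfolding nonconst_def by (metis fls_inverse_const inverse_divide inverse_inverse_eq)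
  show "nonconst (f / h)" "nonconst (g / h)"
    using assms psw_ratio_nonconst inv by (auto simp: perms_def)
  show "f \<noteq> 0" "g \<noteq> 0" "h \<noteq> 0" using assms by (auto simp: perms_def)
  show "f ^ m + g ^ m + h ^ m = 0" using assms psw_fermat by (auto simp: perms_def add_ac)
  show "f * g * h = 1" using assms psw_prod by (auto simp: perms_def mult_ac)
qed

text \<open>The constant term is excluded because images of nonconstant functions are nonconstant.
  The exponents for \<open>pp\<close>, \<open>ss\<close>, \<open>ww\<close> are \<open>x^2\<close>,
  \<open>x\<close>, \<open>y^3\<close>; a product \<open>x^3 y^3\<close> needs exactly one
  \<open>ww\<close> for the power of \<open>y\<close>, and then one \<open>pp\<close> and one
  \<open>ss\<close>.\<close>

lemma aut_perm:
  assumes s: "aut s"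
  obtains f g h a b c where "(f, g, h) \<in> perms" "s pp = cst a * f" "s ss = cst b * g"
    "s ww = cst c * h" "a * b * c = 1"
proof -
  have "pp \<in> Msp" "ss \<in> Msp" "ww \<in> Msp" using Msp_basis by (simp_all add: pp_def ss_def ww_def)
  hence "s pp \<in> Msp" "s ss \<in> Msp" "s ww \<in> Msp" using Msp_aut[OF s] by auto
  then obtain a1 b1 c1 d1 a2 b2 c2 d2 a3 b3 c3 d3 where
    l: "s pp = lin a1 b1 c1 d1" "s ss = lin a2 b2 c2 d2" "s ww = lin a3 b3 c3 d3"
    using Msp_expand unfolding lin_def pp_def ss_def ww_def by meson
  note hom = aut_hom[OF s]
  have "s pp * s ss * s ww = s (pp * ss * ww)" by (simp add: hom_mult[OF hom])
  also have "\<dots> = 1" by (simp add: psw_prod hom_1[OF hom])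
  finally have "lin a1 b1 c1 d1 * lin a2 b2 c2 d2 * lin a3 b3 c3 d3 = 1" unfolding l .
  note prod = lin_prod[OF this]
  have "monom 1 3 \<noteq> (0 :: K poly)" by (simp add: monom_eq_0_iff)
  then obtain e1 e2 e3 i1 i2 i3 where e: "linB a1 b1 c1 d1 = monom e1 i1" "linB a2 b2 c2 d2 = monom e2 i2"
    "linB a3 b3 c3 d3 = monom e3 i3" "e1 * e2 * e3 = monom 1 3" "i1 + i2 + i3 = 3"
    using monom_factor3[OF prod] by metis
  obtain a b c k1 k2 k3 where k: "e1 = monom a k1" "e2 = monom b k2" "e3 = monom c k3"
    "a * b * c = 1" "k1 + k2 + k3 = 3"
    using monom_factor3[OF e(4)] by (metis zero_neq_one)
  have nz: "a \<noteq> 0" "b \<noteq> 0" "c \<noteq> 0" using k(4) by auto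
  have nc: "s f \<noteq> cst d" if "f \<in> F" "nonconst f" for f d
    using hom_nonconst[OF hom that] by (auto simp: nonconst_def)
  have nc3: "s pp \<noteq> cst d" "s ss \<noteq> cst d" "s ww \<noteq> cst d" for d
    using nc psw_nonconst by auto
  note sh = linB_shape[OF e(1)[unfolded k(1)] nz(1), folded l(1)]
    linB_shape[OF e(2)[unfolded k(2)] nz(2), folded l(2)]
    linB_shape[OF e(3)[unfolded k(3)] nz(3), folded l(3)]
  have s1: "(k1 = 2 \<and> i1 = 0 \<and> s pp = cst a * pp) \<or> (k1 = 1 \<and> i1 = 0 \<and> s pp = cst a * ss) \<or>
      (k1 = 0 \<and> i1 = 3 \<and> s pp = cst a * ww)" using sh(1) nc3(1) by metis
  have s2: "(k2 = 2 \<and> i2 = 0 \<and> s ss = cst b * pp) \<or> (k2 = 1 \<and> i2 = 0 \<and> s ss = cst b * ss) \<or>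
      (k2 = 0 \<and> i2 = 3 \<and> s ss = cst b * ww)" using sh(2) nc3(2) by metis
  have s3: "(k3 = 2 \<and> i3 = 0 \<and> s ww = cst c * pp) \<or> (k3 = 1 \<and> i3 = 0 \<and> s ww = cst c * ss) \<or>
      (k3 = 0 \<and> i3 = 3 \<and> s ww = cst c * ww)" using sh(3) nc3(3) by metis
  have "\<exists>f g h. (f, g, h) \<in> perms \<and> s pp = cst a * f \<and> s ss = cst b * g \<and> s ww = cst c * h"
    using s1
  proof (elim disjE conjE)
    assume 1: "k1 = 2" "i1 = 0" "s pp = cst a * pp"
    from s2 s3 have "(s ss = cst b * ss \<and> s ww = cst c * ww) \<or> (s ss = cst b * ww \<and> s ww = cst c * ss)"
      by (elim disjE conjE) (use 1 e(5) k(5) in simp_all)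
    thus ?thesis using 1(3) unfolding perms_def by blast
  next
    assume 1: "k1 = 1" "i1 = 0" "s pp = cst a * ss"
    from s2 s3 have "(s ss = cst b * pp \<and> s ww = cst c * ww) \<or> (s ss = cst b * ww \<and> s ww = cst c * pp)"
      by (elim disjE conjE) (use 1 e(5) k(5) in simp_all)
    thus ?thesis using 1(3) unfolding perms_def by blast
  next
    assume 1: "k1 = 0" "i1 = 3" "s pp = cst a * ww"
    from s2 s3 have "(s ss = cst b * pp \<and> s ww = cst c * ss) \<or> (s ss = cst b * ss \<and> s ww = cst c * pp)"
      by (elim disjE conjE) (use 1 e(5) k(5) in simp_all)
    thus ?thesis using 1(3) unfolding perms_def by blast
  qed
  thus ?thesis using that k(4) by blast
qed

text \<open>Subtracting a multiple of the relation \<open>f^m + g^m + h^m = 0\<close> from its image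
  leaves a relation between two m-th powers. A nonzero coefficient there would make the ratio of two
  of the functions an m-th root of a constant, hence constant.\<close>

lemma aut_perm_powers:
  assumes s: "aut s" and f: "(f, g, h) \<in> perms"
    and e: "s pp = cst a * f" "s ss = cst b * g" "s ww = cst c * h"
  shows "a ^ m = c ^ m" "b ^ m = c ^ m"
proof -
  note hom = aut_hom[OF s] and pr = perms_ratio[OF f]
  have "s (pp ^ m + ss ^ m + ww ^ m) = 0" by (simp only: psw_fermat hom_0[OF hom])
  hence "s pp ^ m + s ss ^ m + s ww ^ m = 0" by (simp add: hom_add[OF hom] hom_power[OF hom])
  hence 1: "cst (a ^ m) * f ^ m + cst (b ^ m) * g ^ m + cst (c ^ m) * h ^ m = 0"
    unfolding e by (simp add: power_mult_distrib fls_const_power)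
  have key: "u = 0" if uv: "cst u * f ^ m + cst v * g ^ m = 0 \<or> cst u * f ^ m + cst v * h ^ m = 0" for u v
  proof (rule ccontr)
    assume u: "u \<noteq> 0"
    have fg: "nonconst (f / g)" using f psw_ratio_nonconst
      by (auto simp: perms_def nonconst_def) (metis fls_inverse_const inverse_divide inverse_inverse_eq)+
    obtain z where z: "z \<noteq> 0" "nonconst (f / z)" "cst u * f ^ m = cst v * z ^ m"
      using uv
    proof
      assume "cst u * f ^ m + cst v * g ^ m = 0"
      hence "cst u * f ^ m = cst v * g ^ m" by (simp only: L_eq_iff)
      thus ?thesis using that[of g] fg pr(4) by blast
    next
      assume "cst u * f ^ m + cst v * h ^ m = 0"
      hence "cst u * f ^ m = cst v * h ^ m" by (simp only: L_eq_iff)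
      thus ?thesis using that[of h] pr(1,5) by blast
    qed
    have "(f / z) ^ m = cst (v / u)"
    proof -
      have "(f / z) ^ m = cst v / cst u" unfolding power_divide
        using z(1,3) u by (subst frac_eq_eq) (simp_all add: mult.commute)
      thus ?thesis by (simp only: fls_const_divide_const)
    qed
    moreover obtain d where "d ^ m = v / u" using nth_root_exists[of m "v / u"] by auto
    ultimately have "(f / z) ^ m = cst d ^ m" by (simp flip: fls_const_power)
    then obtain e' where "f / z = cst e' * cst d" using fls_root_of_unity_const[of "f / z" m "cst d"] by auto
    thus False using z(2) unfolding nonconst_def by (metis fls_const_mult_const)
  qed
  have hm: "h ^ m = f ^ m + g ^ m" using pr(6) L_eq_iff[of "f ^ m + g ^ m" "h ^ m"] by simp
  have "cst (a ^ m + c ^ m) * f ^ m + cst (b ^ m + c ^ m) * g ^ m = 0"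
    using 1 unfolding hm by (simp add: algebra_simps flip: fls_plus_const)
  hence "a ^ m + c ^ m = 0" using key by blast
  thus "a ^ m = c ^ m" by (simp only: K_eq_iff)
  have gm: "g ^ m = f ^ m + h ^ m" using pr(6) L_eq_iff[of "g ^ m" "f ^ m + h ^ m"] by (simp add: add_ac)
  have "cst (a ^ m + b ^ m) * f ^ m + cst (c ^ m + b ^ m) * h ^ m = 0"
    using 1 unfolding gm by (simp add: algebra_simps flip: fls_plus_const)
  hence "a ^ m + b ^ m = 0" using key by blast
  hence "a ^ m = b ^ m" by (simp only: K_eq_iff)
  thus "b ^ m = c ^ m" using \<open>a ^ m = c ^ m\<close> by simp
qed

section \<open>The generators of \<open>G\<close> as automorphisms of \<open>F\<close>\<close>

lemma autI:
  assumes "hom E" "E xx \<in> F" "E yy \<in> F" "a \<in> F" "E a = xx" "b \<in> F" "E b = yy"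
  shows "aut E"
proof -
  note hom = assms(1)
  have "E f \<in> F" if "f \<in> F" for f
    using that by induction (simp_all add: assms(2,3) hom_const[OF hom] hom_add[OF hom] hom_mult[OF hom] hom_inverse[OF hom])
  moreover have "f \<in> E ` F" if "f \<in> F" for f
    using that
  proof induction
    case (F_const c)
    show ?case by (metis hom_const[OF hom] curve.F.F_const[OF curve_axioms] image_eqI)
  next
    case F_xx
    show ?case unfolding image_iff by (rule bexI[of _ a]) (simp_all add: assms)
  next
    case F_yy
    show ?case unfolding image_iff by (rule bexI[of _ b]) (simp_all add: assms)
  next
    case (F_add f g)
    then obtain f' g' where "f' \<in> F" "g' \<in> F" "f = E f'" "g = E g'" by blast
    thus ?case by (intro image_eqI[of _ _ "f' + g'"]) (simp_all add: hom_add[OF hom])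
  next
    case (F_mult f g)
    then obtain f' g' where "f' \<in> F" "g' \<in> F" "f = E f'" "g = E g'" by blast
    thus ?case by (intro image_eqI[of _ _ "f' * g'"]) (simp_all add: hom_mult[OF hom])
  next
    case (F_inverse f)
    then obtain f' where "f' \<in> F" "f = E f'" by blast
    thus ?case by (intro image_eqI[of _ _ "inverse f'"]) (simp_all add: hom_inverse[OF hom])
  qed
  ultimately show ?thesis unfolding aut_def using hom by blast
qed

lemma aut_gd:
  assumes "\<gamma> ^ m = 1" "\<delta> ^ (q + 1) = 1"
  obtains s where "aut s" "s xx = cst \<gamma> * xx" "s yy = cst \<delta> * yy"
proof -
  have nz: "\<gamma> \<noteq> 0" "\<delta> \<noteq> 0" using assms by (auto simp: power_0_left)
  have nc: "nonconst (cst \<gamma> * xx)" unfolding nonconst_def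
  proof (intro allI notI)
    fix c assume "cst \<gamma> * xx = cst c"
    hence "xx = cst c / cst \<gamma>" using nz by (simp add: field_simps)
    thus False using xx_ne_const by (simp add: fls_const_divide_const)
  qed
  have "rel (cst \<gamma> * xx) (cst \<delta> * yy)"
    using rel_base assms power_mult[of \<gamma> m 2] unfolding rel_def power_mult_distrib fls_const_power[symmetric]
    by (simp add: mult.commute[of 2 m])
  then obtain s where s: "hom s" "s xx = cst \<gamma> * xx" "s yy = cst \<delta> * yy"
    using hom_exists[OF nc] by metis
  have "aut s"
  proof (rule autI[OF s(1)])
    show "s (cst (inverse \<gamma>) * xx) = xx" "s (cst (inverse \<delta>) * yy) = yy"
      using nz by (simp_all add: hom_mult[OF s(1)] hom_const[OF s(1)] s(2,3) mult.assoc[symmetric])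
  qed (simp_all add: s)
  thus ?thesis using that s by blast
qed

lemma yy_q1: "yy ^ (3 * m) = xx ^ (2 * m) + xx ^ m"
  using rel_base by (simp only: rel_def q1)

lemma aut_2:
  obtains s where "aut s" "s xx = inverse xx" "s yy = yy * inverse xx"
proof -
  have nc: "nonconst (inverse xx)" unfolding nonconst_def
    by (metis fls_inverse_const inverse_inverse_eq xx_ne_const)
  have "rel (inverse xx) (yy * inverse xx)"
  proof -
    have "xx ^ (3 * m) = xx ^ (2 * m) * xx ^ m" unfolding power_add[symmetric] by simp
    moreover have "xx ^ (2 * m) = xx ^ m * xx ^ m" unfolding power_add[symmetric] by (simp add: mult_2)
    ultimately show ?thesis unfolding rel_def q1 power_mult_distrib yy_q1 power_inverse
      by (simp add: field_simps)
  qed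
  then obtain s where s: "hom s" "s xx = inverse xx" "s yy = yy * inverse xx"
    using hom_exists[OF nc] by metis
  have "aut s"
  proof (rule autI[OF s(1)])
    show "s (inverse xx) = xx" by (simp add: hom_inverse[OF s(1)] s)
    show "s (yy * inverse xx) = yy" by (simp add: hom_mult[OF s(1)] hom_inverse[OF s(1)] s)
  qed (simp_all add: s)
  thus ?thesis using that s by blast
qed

text \<open>On \<open>t\<close> this map is \<open>t\<close> to \<open>1 + 1/t\<close>, which
  permutes 0, 1 and \<open>\<infinity>\<close> cyclically.\<close>

lemma aut_3:
  obtains s where "aut s" "s xx = yy ^ 3 * inverse (xx ^ 2)" "s yy = yy * inverse xx"
proof -
  have nc: "nonconst (yy ^ 3 * inverse (xx ^ 2))"
    by (rule nonconst_subdegree) (simp add: fls_subdegree_pow xx_subdegree yy_subdegree del: L_numeral)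
  have "rel (yy ^ 3 * inverse (xx ^ 2)) (yy * inverse xx)"
  proof -
    define t where "t = xx ^ m"
    have t: "t \<noteq> 0" by (simp add: t_def)
    have p: "(yy ^ 3 * inverse (xx ^ 2)) ^ m = (t ^ 2 + t) / t ^ 2"
      unfolding power_mult_distrib power_inverse power_mult[symmetric] yy_q1 t_def
      by (simp add: divide_inverse power_mult[symmetric] mult.commute[of m])
    have "(yy * inverse xx) ^ (q + 1) = (t ^ 2 + t) / t ^ 3"
      unfolding power_mult_distrib power_inverse q1 yy_q1 t_def
      by (simp add: divide_inverse power_mult[symmetric] mult.commute[of m])
    moreover have "(yy ^ 3 * inverse (xx ^ 2)) ^ (2 * m) = ((t ^ 2 + t) / t ^ 2) ^ 2"
      by (simp only: mult.commute[of 2 m] power_mult p)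
    moreover have "(t ^ 2 + t) / t ^ 3 = ((t ^ 2 + t) / t ^ 2) ^ 2 + (t ^ 2 + t) / t ^ 2"
    proof -
      have "(t ^ 2 + t) / t ^ 2 = 1 + inverse t" using t by (simp add: field_simps power2_eq_square)
      moreover have "(t ^ 2 + t) / t ^ 3 = inverse t + inverse t ^ 2" using t by (simp add: field_simps power2_eq_square power3_eq_cube)
      ultimately show ?thesis by (simp add: L_square_add add_ac)
    qed
    ultimately show ?thesis unfolding rel_def p by simp
  qed
  then obtain s where s: "hom s" "s xx = yy ^ 3 * inverse (xx ^ 2)" "s yy = yy * inverse xx"
    using hom_exists[OF nc] by metis
  have "aut s"
  proof (rule autI[OF s(1)])
    \<comment> \<open>\<open>x / y^3\<close> and \<open>x / y^2\<close> are the images of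
      \<open>x\<close> and \<open>y\<close> under the inverse automorphism.\<close>
    have "s (xx / yy ^ 3) = yy ^ 3 * inverse (xx ^ 2) / (yy * inverse xx) ^ 3"
      by (simp only: hom_divide[OF s(1)] hom_power[OF s(1)] s F_xx F_yy F_power)
    also have "\<dots> = xx" by (simp add: power2_eq_square power3_eq_cube field_simps del: L_numeral)
    finally show "s (xx / yy ^ 3) = xx" .
    have "s (xx / yy ^ 2) = yy ^ 3 * inverse (xx ^ 2) / (yy * inverse xx) ^ 2"
      by (simp only: hom_divide[OF s(1)] hom_power[OF s(1)] s F_xx F_yy F_power)
    also have "\<dots> = yy" by (simp add: power2_eq_square power3_eq_cube field_simps del: L_numeral)
    finally show "s (xx / yy ^ 2) = yy" .
  qed (simp_all add: s)
  thus ?thesis using that s by blast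
qed

section \<open>The automorphism group\<close>

lemma FF_simps [simp]:
  "carrier (FF q) = Car" "a \<otimes>\<^bsub>FF q\<^esub> b = (a * b) mod F3 q" "\<one>\<^bsub>FF q\<^esub> = 1"
  "a \<oplus>\<^bsub>FF q\<^esub> b = a + b"
  by (simp_all add: FF_def)

lemma ev0_mult_mod: "ev0 ((a * b) mod F3 q) = ev0 a * ev0 b"
  by (simp only: ev_mod[OF xx_nonconst rel_base] ev0_mult)

lemma rep_eqI: "ev0 p = f \<Longrightarrow> p \<in> Car \<Longrightarrow> rep f = p"
  using rep_ev0 by auto

definition toF :: "(P \<Rightarrow> P) \<Rightarrow> L \<Rightarrow> L" where
  "toF \<sigma> f = ev0 (\<sigma> (rep f))"

text \<open>The restriction supplies the extensionality demanded by \<open>AutX3\<close>, so that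
  automorphisms agreeing on \<open>F\<close> become equal.\<close>

definition fromF :: "(L \<Rightarrow> L) \<Rightarrow> P \<Rightarrow> P" where
  "fromF s = restrict (\<lambda>p. rep (s (ev0 p))) Car"

lemma ev0_constL: "ev0 (constL c) = cst c"
  by (simp add: constL_def ev0_const evx_cK)

lemma ev0_xL: "ev0 xL = xx"
  by (simp add: xL_def ev0_const evx_Xf)

lemma ev0_yL: "ev0 yL = yy"
  by (simp add: yL_def ev0_pCons ev0_0 evx_0 evx_1)

lemma L_Car: "constL c \<in> Car" "xL \<in> Car" "yL \<in> Car"
  using q_ge by (simp_all add: constL_def xL_def yL_def)

lemma rep_L: "rep (cst c) = constL c" "rep xx = xL" "rep yy = yL"
  by (rule rep_eqI; simp only: ev0_constL ev0_xL ev0_yL L_Car)+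

lemma AutX3_D:
  assumes "\<sigma> \<in> AutX3 q"
  shows "bij_betw \<sigma> Car Car" "\<And>a. a \<in> Car \<Longrightarrow> \<sigma> a \<in> Car"
    "\<And>a b. a \<in> Car \<Longrightarrow> b \<in> Car \<Longrightarrow> \<sigma> ((a * b) mod F3 q) = (\<sigma> a * \<sigma> b) mod F3 q"
    "\<And>a b. a \<in> Car \<Longrightarrow> b \<in> Car \<Longrightarrow> \<sigma> (a + b) = \<sigma> a + \<sigma> b"
    "\<sigma> (constL c) = constL c" "\<sigma> \<in> extensional Car"
proof -
  have h: "\<sigma> \<in> ring_hom (FF q) (FF q)" "bij_betw \<sigma> Car Car"
    using assms by (auto simp: AutX3_def ring_iso_def)
  show "bij_betw \<sigma> Car Car" by (rule h)
  show "\<And>a. a \<in> Car \<Longrightarrow> \<sigma> a \<in> Car" using ring_hom_closed[OF h(1)] by simp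
  show "\<And>a b. a \<in> Car \<Longrightarrow> b \<in> Car \<Longrightarrow> \<sigma> ((a * b) mod F3 q) = (\<sigma> a * \<sigma> b) mod F3 q"
    using ring_hom_mult[OF h(1)] by simp
  show "\<And>a b. a \<in> Car \<Longrightarrow> b \<in> Car \<Longrightarrow> \<sigma> (a + b) = \<sigma> a + \<sigma> b"
    using ring_hom_add[OF h(1)] by simp
  show "\<sigma> (constL c) = constL c" "\<sigma> \<in> extensional Car" using assms by (simp_all add: AutX3_def)
qed

lemma toF_aut:
  assumes "\<sigma> \<in> AutX3 q"
  shows "aut (toF \<sigma>)"
proof -
  note D = AutX3_D[OF assms]
  have rc: "rep f \<in> Car" if "f \<in> F" for f using rep_Car that .
  have "hom (toF \<sigma>)" unfolding hom_def
  proof (intro conjI allI ballI)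
    fix c show "toF \<sigma> (cst c) = cst c" by (simp only: toF_def rep_L D(5) ev0_constL)
  next
    fix a b assume ab: "a \<in> F" "b \<in> F"
    have "rep (a + b) = rep a + rep b"
      by (rule rep_eqI) (use ab rc[of a] rc[of b] degree_add_less[of "rep a" "q + 1" "rep b"] in \<open>simp_all add: ev0_add\<close>)
    thus "toF \<sigma> (a + b) = toF \<sigma> a + toF \<sigma> b"
      using D(4)[OF rc[OF ab(1)] rc[OF ab(2)]] by (simp add: toF_def ev0_add)
    have "rep (a * b) = (rep a * rep b) mod F3 q"
      by (rule rep_eqI) (use ab mod_Car in \<open>simp_all only: ev0_mult_mod ev0_rep\<close>)
    thus "toF \<sigma> (a * b) = toF \<sigma> a * toF \<sigma> b"
      using D(3)[OF rc[OF ab(1)] rc[OF ab(2)]] by (simp add: toF_def ev0_mult_mod)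
  qed
  moreover have "toF \<sigma> ` F = F"
  proof
    show "toF \<sigma> ` F \<subseteq> F" by (auto simp: toF_def)
    show "F \<subseteq> toF \<sigma> ` F"
    proof
      fix f assume f: "f \<in> F"
      hence "rep f \<in> \<sigma> ` Car" using rc[OF f] by (simp only: bij_betw_imp_surj_on[OF D(1)])
      then obtain p where p: "rep f = \<sigma> p" "p \<in> Car" by (rule imageE)
      hence "f = toF \<sigma> (ev0 p)"
        using f by (simp only: toF_def rep_ev0[OF p(2)] p(1)[symmetric] ev0_rep)
      thus "f \<in> toF \<sigma> ` F" by (rule image_eqI) simp
    qed
  qed
  ultimately show ?thesis by (simp add: aut_def)
qed

lemma fromF_apply: "p \<in> Car \<Longrightarrow> fromF s p = rep (s (ev0 p))"
  by (simp only: fromF_def restrict_apply if_True)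

lemma fromF_cong: "(\<And>f. f \<in> F \<Longrightarrow> s f = s' f) \<Longrightarrow> fromF s = fromF s'"
  unfolding fromF_def by (rule restrict_ext) simp

lemma fromF_toF:
  assumes "\<sigma> \<in> AutX3 q"
  shows "fromF (toF \<sigma>) = \<sigma>"
proof (rule extensionalityI[where A = Car])
  show "fromF (toF \<sigma>) \<in> extensional Car" by (simp only: fromF_def restrict_extensional)
  show "\<sigma> \<in> extensional Car" by (rule AutX3_D(6)[OF assms])
  fix p assume "p \<in> Car"
  thus "fromF (toF \<sigma>) p = \<sigma> p" using AutX3_D(2)[OF assms] by (simp only: fromF_apply toF_def rep_ev0)
qed

lemma ev0_fromF: "aut s \<Longrightarrow> p \<in> Car \<Longrightarrow> ev0 (fromF s p) = s (ev0 p)"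
  by (simp only: fromF_apply ev0_rep aut_F F_ev0)

lemma fromF_Car: "aut s \<Longrightarrow> p \<in> Car \<Longrightarrow> fromF s p \<in> Car"
  by (simp only: fromF_apply rep_Car aut_F F_ev0)

lemma fromF_AutX3:
  assumes s: "aut s"
  shows "fromF s \<in> AutX3 q"
proof -
  note hom = aut_hom[OF s]
  have "fromF s \<in> ring_hom (FF q) (FF q)"
  proof (rule ring_hom_memI)
    fix a assume "a \<in> carrier (FF q)"
    hence a: "a \<in> Car" by simp
    show "fromF s a \<in> carrier (FF q)" using fromF_Car[OF s a] by simp
    fix b assume "b \<in> carrier (FF q)"
    hence b: "b \<in> Car" by simp
    have "fromF s ((a * b) mod F3 q) = (fromF s a * fromF s b) mod F3 q"
      unfolding fromF_apply[OF mod_Car]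
      by (rule rep_eqI) (simp_all only: ev0_mult_mod ev0_fromF[OF s a] ev0_fromF[OF s b] hom_mult[OF hom] F_ev0 mod_Car)
    thus "fromF s (a \<otimes>\<^bsub>FF q\<^esub> b) = fromF s a \<otimes>\<^bsub>FF q\<^esub> fromF s b" by simp
    have ab: "a + b \<in> Car" using a b degree_add_less[of a "q + 1" b] by simp
    have fab: "fromF s a + fromF s b \<in> Car"
      using fromF_Car[OF s a] fromF_Car[OF s b] degree_add_less[of "fromF s a" "q + 1" "fromF s b"] by simp
    have "fromF s (a + b) = fromF s a + fromF s b"
      unfolding fromF_apply[OF ab]
      by (rule rep_eqI) (simp_all only: ev0_add ev0_fromF[OF s a] ev0_fromF[OF s b] hom_add[OF hom] F_ev0 fab)
    thus "fromF s (a \<oplus>\<^bsub>FF q\<^esub> b) = fromF s a \<oplus>\<^bsub>FF q\<^esub> fromF s b" by simp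
  next
    have c: "(1::P) \<in> Car" by simp
    have "fromF s 1 = 1"
      unfolding fromF_apply[OF c] by (rule rep_eqI) (simp_all only: ev0_1 hom_1[OF hom] c)
    thus "fromF s \<one>\<^bsub>FF q\<^esub> = \<one>\<^bsub>FF q\<^esub>" by simp
  qed
  moreover have "bij_betw (fromF s) Car Car"
  proof (rule bij_betw_imageI)
    show "inj_on (fromF s) Car"
    proof (rule inj_onI)
      fix a b assume ab: "a \<in> Car" "b \<in> Car" "fromF s a = fromF s b"
      hence "s (ev0 a) = s (ev0 b)" using ev0_fromF[OF s] by metis
      hence "ev0 a = ev0 b" by (rule hom_inj[OF hom F_ev0 F_ev0])
      thus "a = b" using ab(1,2) by (rule inj_onD[OF ev0_inj])
    qed
    show "fromF s ` Car = Car"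
    proof
      show "fromF s ` Car \<subseteq> Car" using fromF_Car[OF s] by blast
      show "Car \<subseteq> fromF s ` Car"
      proof
        fix p assume p: "p \<in> Car"
        have "ev0 p \<in> s ` F" using s by (simp add: aut_def)
        then obtain f where f: "f \<in> F" "s f = ev0 p" by auto
        have "p = fromF s (rep f)"
          using f p by (simp only: fromF_apply[OF rep_Car[OF f(1)]] ev0_rep rep_ev0)
        thus "p \<in> fromF s ` Car" by (rule image_eqI[OF _ rep_Car[OF f(1)]])
      qed
    qed
  qed
  moreover have "fromF s (constL c) = constL c" for c
    by (simp only: fromF_apply[OF L_Car(1)] ev0_constL hom_const[OF hom] rep_L)
  moreover have "fromF s \<in> extensional Car" by (simp only: fromF_def restrict_extensional)
  ultimately show ?thesis by (simp add: AutX3_def ring_iso_def)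
qed

lemma fromF_compose:
  assumes "aut s" "aut s'"
  shows "compose Car (fromF s) (fromF s') = fromF (\<lambda>f. s (s' f))"
proof (rule extensionalityI[where A = Car])
  show "compose Car (fromF s) (fromF s') \<in> extensional Car" by (rule compose_extensional)
  show "fromF (\<lambda>f. s (s' f)) \<in> extensional Car" by (simp only: fromF_def restrict_extensional)
  fix p assume p: "p \<in> Car"
  show "compose Car (fromF s) (fromF s') p = fromF (\<lambda>f. s (s' f)) p"
    by (simp only: compose_eq[OF p] fromF_apply[OF p] fromF_apply[OF rep_Car[OF aut_F[OF assms(2) F_ev0]]]
      ev0_rep[OF aut_F[OF assms(2) F_ev0]])
qed

lemma aut_compose: "aut s \<Longrightarrow> aut s' \<Longrightarrow> aut (\<lambda>f. s (s' f))"
  using hom_aut[OF aut_hom] unfolding aut_def by (metis image_image)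

lemma aut_id: "aut (\<lambda>f. f)"
  by (simp add: aut_def hom_def)

lemma fromF_id: "fromF (\<lambda>f. f) = restrict id Car"
  unfolding fromF_def by (rule restrict_ext) (simp only: rep_ev0 id_apply)

lemma AutX3_E:
  assumes "\<sigma> \<in> AutX3 q"
  obtains s where "aut s" "\<sigma> = fromF s"
  using toF_aut[OF assms] fromF_toF[OF assms] by metis

lemma AutGrp_simps [simp]: "carrier (AutGrp q) = AutX3 q" "\<sigma> \<otimes>\<^bsub>AutGrp q\<^esub> \<tau> = compose Car \<sigma> \<tau>"
  "\<one>\<^bsub>AutGrp q\<^esub> = restrict id Car"
  by (simp_all add: AutGrp_def)

text \<open>The group laws give the inclusion of \<open>GroupG q\<close> in \<open>AutX3 q\<close>,
  because \<open>generate\<close> also adjoins inverses.\<close>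

lemma AutGrp_group: "group (AutGrp q)"
proof (rule groupI)
  fix \<sigma> \<tau> \<rho>
  assume "\<sigma> \<in> carrier (AutGrp q)" "\<tau> \<in> carrier (AutGrp q)"
  then obtain s t where st: "aut s" "\<sigma> = fromF s" "aut t" "\<tau> = fromF t" by (auto elim!: AutX3_E)
  thus "\<sigma> \<otimes>\<^bsub>AutGrp q\<^esub> \<tau> \<in> carrier (AutGrp q)"
    by (simp only: AutGrp_simps fromF_compose fromF_AutX3 aut_compose)
  assume "\<rho> \<in> carrier (AutGrp q)"
  then obtain r where r: "aut r" "\<rho> = fromF r" by (auto elim!: AutX3_E)
  show "\<sigma> \<otimes>\<^bsub>AutGrp q\<^esub> \<tau> \<otimes>\<^bsub>AutGrp q\<^esub> \<rho> = \<sigma> \<otimes>\<^bsub>AutGrp q\<^esub> (\<tau> \<otimes>\<^bsub>AutGrp q\<^esub> \<rho>)"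
    using st r by (simp only: AutGrp_simps fromF_compose aut_compose)
next
  show "\<one>\<^bsub>AutGrp q\<^esub> \<in> carrier (AutGrp q)"
    using fromF_AutX3[OF aut_id] by (simp only: AutGrp_simps fromF_id)
next
  fix \<sigma> assume "\<sigma> \<in> carrier (AutGrp q)"
  then obtain s where s: "aut s" "\<sigma> = fromF s" by (auto elim!: AutX3_E)
  show "\<one>\<^bsub>AutGrp q\<^esub> \<otimes>\<^bsub>AutGrp q\<^esub> \<sigma> = \<sigma>"
    using s by (simp only: AutGrp_simps fromF_id[symmetric] fromF_compose aut_id)
  obtain u where u: "aut u" "\<And>f. f \<in> F \<Longrightarrow> u (s f) = f" using aut_inverse[OF s(1)] by metis
  have "fromF u \<otimes>\<^bsub>AutGrp q\<^esub> \<sigma> = \<one>\<^bsub>AutGrp q\<^esub>"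
    using fromF_cong[of "\<lambda>f. u (s f)" "\<lambda>f. f"] u(2)
    by (simp only: AutGrp_simps fromF_id[symmetric] s(2) fromF_compose[OF u(1) s(1)])
  thus "\<exists>\<tau>\<in>carrier (AutGrp q). \<tau> \<otimes>\<^bsub>AutGrp q\<^esub> \<sigma> = \<one>\<^bsub>AutGrp q\<^esub>"
    using fromF_AutX3[OF u(1)] by (intro bexI[of _ "fromF u"]) (simp_all only: AutGrp_simps)
qed

text \<open>The description in \<open>autmap\<close> is unique because an automorphism is determined
  by its values at \<open>x\<close> and \<open>y\<close>.\<close>

lemma autmap_eq:
  assumes s: "aut s" and u: "ev0 u = s xx" "u \<in> Car" and v: "ev0 v = s yy" "v \<in> Car"
  shows "autmap q u v = fromF s"
  unfolding autmap_def
proof (rule the_equality)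
  show "fromF s \<in> AutX3 q \<and> fromF s xL = u \<and> fromF s yL = v"
    using fromF_AutX3[OF s] rep_eqI[OF u] rep_eqI[OF v]
    by (simp only: fromF_apply L_Car ev0_xL ev0_yL simp_thms)
  fix \<sigma> assume h: "\<sigma> \<in> AutX3 q \<and> \<sigma> xL = u \<and> \<sigma> yL = v"
  then obtain t where t: "aut t" "\<sigma> = fromF t" using AutX3_E by blast
  have "t xx = s xx" "t yy = s yy"
    using ev0_fromF[OF t(1) L_Car(2)] ev0_fromF[OF t(1) L_Car(3)] h u(1) v(1) t(2) by (simp_all only: ev0_xL ev0_yL)
  hence "t f = s f" if "f \<in> F" for f using hom_eqI[OF aut_hom[OF t(1)] aut_hom[OF s]] that by blast
  thus "\<sigma> = fromF s" unfolding t(2) by (rule fromF_cong)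
qed

lemma theta_gd_eq:
  assumes "aut s" "s xx = cst \<gamma> * xx" "s yy = cst \<delta> * yy"
  shows "theta_gd q \<gamma> \<delta> = fromF s"
  unfolding theta_gd_def
  by (rule autmap_eq[OF assms(1)])
     (use q_ge in \<open>simp_all add: assms(2,3) ev0_pCons ev0_0 evx_0
        evx_mult evx_cK evx_Xf\<close>)

lemma theta2_eq:
  assumes "aut s" "s xx = inverse xx" "s yy = yy * inverse xx"
  shows "theta2 q = fromF s"
  unfolding theta2_def
  by (rule autmap_eq[OF assms(1)])
     (use q_ge in \<open>simp_all add: assms(2,3) ev0_pCons ev0_0 evx_0
        evx_inverse evx_Xf\<close>)

lemma theta3_eq:
  assumes "aut s" "s xx = yy ^ 3 * inverse (xx ^ 2)" "s yy = yy * inverse xx"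
  shows "theta3 q = fromF s"
  unfolding theta3_def
proof (rule autmap_eq[OF assms(1)])
  show "monom (inverse (Xf ^ 2)) 3 \<in> Car" using q_ge degree_monom_le[of "inverse (Xf ^ 2)" 3] by simp
  show "[:0, inverse Xf:] \<in> Car" using q_ge by simp
qed (simp_all add: assms(2,3) ev0_pCons ev0_0 evx_0
      ev0_monom evx_inverse evx_power evx_Xf mult.commute)

section \<open>Every automorphism is generated by the given maps\<close>

definition inG :: "(L \<Rightarrow> L) \<Rightarrow> bool" where
  "inG s \<longleftrightarrow> aut s \<and> fromF s \<in> GroupG q"

lemma inG_compose: "inG s \<Longrightarrow> inG s' \<Longrightarrow> inG (\<lambda>f. s (s' f))"
  unfolding inG_def GroupG_def
  using generate.eng[of "fromF s" "AutGrp q" "gensG q" "fromF s'"] aut_compose[of s s'] fromF_compose[of s s']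
  by simp

lemma inG_id: "inG (\<lambda>f. f)"
  unfolding inG_def GroupG_def using generate.one[of "AutGrp q" "gensG q"] aut_id fromF_id by simp

lemma inG_gen: "aut s \<Longrightarrow> fromF s \<in> gensG q \<Longrightarrow> inG s"
  unfolding inG_def GroupG_def by (simp add: generate.incl)

lemma gensG_AutX3: "gensG q \<subseteq> AutX3 q"
proof
  fix \<sigma> assume "\<sigma> \<in> gensG q"
  then consider \<gamma> \<delta> where "\<sigma> = theta_gd q \<gamma> \<delta>" "\<gamma> ^ m = 1" "\<delta> ^ (q + 1) = 1"
    | "\<sigma> = theta2 q" | "\<sigma> = theta3 q"
    unfolding gensG_def m_def by blast
  thus "\<sigma> \<in> AutX3 q"
  proof cases
    case 1
    obtain s where "aut s" "s xx = cst \<gamma> * xx" "s yy = cst \<delta> * yy" using aut_gd[OF 1(2,3)] .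
    thus ?thesis using theta_gd_eq fromF_AutX3 1(1) by metis
  next
    case 2 thus ?thesis using aut_2 theta2_eq fromF_AutX3 by metis
  next
    case 3 thus ?thesis using aut_3 theta3_eq fromF_AutX3 by metis
  qed
qed

lemma hom_psw:
  assumes "hom s"
  shows "s pp = s xx / s yy" "s ss = 1 / s yy" "s ww = s yy ^ 2 / s xx"
  by (simp_all add: pp_def ss_def ww_def hom_divide[OF assms] hom_power[OF assms] hom_1[OF assms])

text \<open>As \<open>x = p/s\<close> and \<open>y = 1/s\<close>, the parameters must be
  \<open>\<gamma> = a/b\<close> and \<open>\<delta> = 1/b\<close>. Raising \<open>a b c = 1\<close>
  to the power \<open>m\<close> gives \<open>b^(3m) = 1\<close>, that is
  \<open>\<delta>^(q+1) = 1\<close>.\<close>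

lemma inG_diag:
  assumes "a * b * c = 1" "a ^ m = c ^ m" "b ^ m = c ^ m"
  obtains s where "inG s" "s pp = cst a * pp" "s ss = cst b * ss" "s ww = cst c * ww"
proof -
  have nz: "a \<noteq> 0" "b \<noteq> 0" "c \<noteq> 0" using assms(1) by auto
  have g: "(a / b) ^ m = 1" using assms nz by (simp add: power_divide)
  have "(a * b * c) ^ m = 1" by (simp add: assms(1))
  hence "b ^ (3 * m) = 1"
    using assms(2,3) by (simp add: power_mult_distrib power_mult[symmetric] mult.commute[of 3] power_mult power3_eq_cube)
  hence d: "inverse b ^ (q + 1) = 1" unfolding q1 by (simp add: power_inverse)
  obtain s where s: "aut s" "s xx = cst (a / b) * xx" "s yy = cst (inverse b) * yy"
    using aut_gd[OF g d] .
  have "theta_gd q (a / b) (inverse b) \<in> gensG q"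
    unfolding gensG_def m_def[symmetric] using g d by blast
  hence "fromF s \<in> gensG q" by (simp only: theta_gd_eq[OF s])
  hence "inG s" using inG_gen s(1) by blast
  moreover have ib: "cst (inverse b) = inverse (cst b)" "cst (a / b) = cst a / cst b"
    by (simp_all add: fls_inverse_const fls_const_divide_const)
  have "cst a * cst b * cst c = (1::L)" using assms(1) by simp
  hence c: "cst c = inverse (cst a * cst b :: L)"
    by (metis inverse_unique)
  have "s pp = cst a * pp" "s ss = cst b * ss" "s ww = cst c * ww"
    unfolding hom_psw[OF aut_hom[OF s(1)]] s ib c using nz
    by (simp_all add: pp_def ss_def ww_def field_simps power2_eq_square del: fls_const_mult_const)
  ultimately show ?thesis using that by blast
qed

text \<open>\<open>theta2\<close> exchanges \<open>p\<close> and \<open>s\<close>, and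
  \<open>theta3\<close> is the 3-cycle \<open>p\<close> to \<open>w\<close> to \<open>s\<close> to
  \<open>p\<close>; together they generate all six permutations.\<close>

lemma inG_perm:
  assumes "(f, g, h) \<in> perms"
  obtains s where "inG s" "s pp = f" "s ss = g" "s ww = h"
proof -
  obtain s2 where s2: "aut s2" "s2 xx = inverse xx" "s2 yy = yy * inverse xx" by (rule aut_2)
  obtain s3 where s3: "aut s3" "s3 xx = yy ^ 3 * inverse (xx ^ 2)" "s3 yy = yy * inverse xx" by (rule aut_3)
  have 2: "inG s2" by (rule inG_gen[OF s2(1)]) (simp add: theta2_eq[OF s2, symmetric] gensG_def)
  have 3: "inG s3" by (rule inG_gen[OF s3(1)]) (simp add: theta3_eq[OF s3, symmetric] gensG_def)
  have p2: "s2 pp = ss" "s2 ss = pp" "s2 ww = ww"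
    unfolding hom_psw[OF aut_hom[OF s2(1)]] s2
    by (simp_all add: pp_def ss_def ww_def field_simps power2_eq_square del: L_numeral)
  have p3: "s3 pp = ww" "s3 ss = pp" "s3 ww = ss"
    unfolding hom_psw[OF aut_hom[OF s3(1)]] s3
    by (simp_all add: pp_def ss_def ww_def field_simps power2_eq_square power3_eq_cube del: L_numeral)
  from assms consider "(f, g, h) = (pp, ss, ww)" | "(f, g, h) = (ss, pp, ww)" | "(f, g, h) = (ww, pp, ss)"
    | "(f, g, h) = (ss, ww, pp)" | "(f, g, h) = (ww, ss, pp)" | "(f, g, h) = (pp, ww, ss)"
    unfolding perms_def by blast
  thus ?thesis
  proof cases
    case 1 thus ?thesis using that[OF inG_id] by simp
  next
    case 2 thus ?thesis using that[OF \<open>inG s2\<close>] p2 by simp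
  next
    case 3 thus ?thesis using that[OF \<open>inG s3\<close>] p3 by simp
  next
    case 4 thus ?thesis using that[OF inG_compose[OF \<open>inG s3\<close> \<open>inG s3\<close>]] p3 by simp
  next
    case 5 thus ?thesis using that[OF inG_compose[OF \<open>inG s2\<close> \<open>inG s3\<close>]] p2 p3 by simp
  next
    case 6 thus ?thesis using that[OF inG_compose[OF \<open>inG s3\<close> \<open>inG s2\<close>]] p2 p3 by simp
  qed
qed

text \<open>The automorphism is factored as a permutation \<open>w\<close> followed by a scaling
  \<open>d\<close>. Agreement on \<open>p\<close> and \<open>s\<close> suffices, since
  \<open>x\<close> and \<open>y\<close> are expressed by them.\<close>

lemma aut_inG:
  assumes s: "aut s"
  shows "fromF s \<in> GroupG q"
proof -
  obtain f g h a b c where p: "(f, g, h) \<in> perms" "s pp = cst a * f" "s ss = cst b * g"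
    "s ww = cst c * h" "a * b * c = 1" using aut_perm[OF s] .
  note pw = aut_perm_powers[OF s p(1-4)]
  obtain w where w: "inG w" "w pp = f" "w ss = g" "w ww = h" using inG_perm[OF p(1)] .
  have ex: "\<exists>d. inG d \<and> d f = cst a * f \<and> d g = cst b * g \<and> d h = cst c * h"
  proof -
    \<comment> \<open>The scaling acts after the permutation, so it must multiply \<open>f\<close>,
      \<open>g\<close>, \<open>h\<close> by \<open>a\<close>, \<open>b\<close>, \<open>c\<close>; in
      terms of \<open>pp\<close>, \<open>ss\<close>, \<open>ww\<close> the scalars appear permuted,
      one instance of \<open>D\<close> for each element of \<open>perms\<close>.\<close>
    have D: "\<exists>d. inG d \<and> d pp = cst a' * pp \<and> d ss = cst b' * ss \<and> d ww = cst c' * ww"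
      if "a' * b' * c' = 1" "a' ^ m = c' ^ m" "b' ^ m = c' ^ m" for a' b' c'
      using inG_diag[OF that] by metis
    have pr: "a * b * c = 1" "b * a * c = 1" "b * c * a = 1" "c * b * a = 1" "c * a * b = 1" "a * c * b = 1"
      using p(5) by (simp_all add: mult_ac)
    have "a ^ m = b ^ m" "b ^ m = a ^ m" "c ^ m = a ^ m" "c ^ m = b ^ m" using pw by simp_all
    note eqs = this pw refl
    show ?thesis
      using p(1) D[OF pr(1) eqs(5,6)] D[OF pr(2) eqs(6,5)] D[OF pr(3) eqs(2,3)] D[OF pr(4) eqs(3,2)]
        D[OF pr(5) eqs(4,1)] D[OF pr(6) eqs(1,4)]
      unfolding perms_def by (elim insertE emptyE) (simp_all, blast+)
  qed
  then obtain d where d: "inG d" "d f = cst a * f" "d g = cst b * g" by blast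
  have dw: "inG (\<lambda>f. d (w f))" by (rule inG_compose[OF d(1) w(1)])
  hence adw: "aut (\<lambda>f. d (w f))" by (simp add: inG_def)
  have e: "d (w pp) = s pp" "d (w ss) = s ss" using d w p by simp_all
  have "d (w xx) = s xx" "d (w yy) = s yy"
    unfolding xx_psw yy_psw
    using hom_divide[OF aut_hom[OF adw], of pp ss] hom_divide[OF aut_hom[OF adw], of 1 ss] hom_1[OF aut_hom[OF adw]]
    by (simp_all add: hom_divide[OF aut_hom[OF s]] hom_1[OF aut_hom[OF s]] e)
  hence "s f = d (w f)" if "f \<in> F" for f
    using hom_eqI[OF aut_hom[OF s] aut_hom[OF adw]] that by metis
  hence "fromF s = fromF (\<lambda>f. d (w f))" by (rule fromF_cong)
  thus ?thesis using dw by (simp add: inG_def)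
qed

lemma AutX3_eq_GroupG: "AutX3 q = GroupG q"
proof
  show "AutX3 q \<subseteq> GroupG q" using AutX3_E aut_inG by blast
  show "GroupG q \<subseteq> AutX3 q"
    unfolding GroupG_def using group.generate_incl[OF AutGrp_group, of "gensG q"] gensG_AutX3 by simp
qed

end

theorem theorem6p8:
  fixes n q :: nat
  assumes "q = 2 ^ n" and "n \<ge> 5" and "odd n"
  shows "AutX3 q = GroupG q"
proof -
  interpret curve n q "m_of q" by standard (use assms in simp_all)
  show ?thesis by (rule AutX3_eq_GroupG)
qed

end
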